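(* Let $d\in\{1,2,3\}$, let the domain $\mathcal X\subseteq\mathbb R^d$, the design distribution $P$ with density $p$, and the kernel $K$ satisfy the conditions listed in the context. There exist constants $C_0,c_0,N,C,C_1,c,c_1>0$, depending only on $d,\mathcal X,p,K$ (in particular not on $f_0,M,n,r,\delta$), such that the following holds. Let $n\ge N$, $n^{-1/2}\le M\le n^{1/d}$, $f_0\in H^1(\mathcal X,M)$, $\delta\in(0,1)$, let $$C_0\Bigl(\frac{\log n}{n}\Bigr)^{1/d}\le r\le \min\Bigl\{c_0,\; M^{(d-4)/(4+2d)}\,n^{-3/(4+2d)}\Bigr\},$$ and let $(X_1,Y_1),\dots,(X_n,Y_n)$ be i.i.d. from the regression model with regression function $f_0$. Then the Laplacian smoothing estimator $\hat f$ computed on the neighborhood graph $G_{n,r}$ with $\rho=M^{-4/(2+d)}(nr^{d+2})^{-1}n^{-2/(2+d)}$ satisfies $$\|\hat f-f_0\|_n^2\le \frac{C}{\delta}\,M^{2d/(2+d)}\,n^{-2/(2+d)}$$ with probability at least $1-\delta-C_1n\exp(-c_1nr^d)-\exp\bigl(-c(M^2n)^{d/(2+d)}\bigr)$.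
   Context: Design: $P$ is supported on $\mathcal X\subseteq\mathbb R^d$, an open connected set with Lipschitz boundary; $P$ has a density $p$ with $0<p_{\min}\le p(x)\le p_{\max}<\infty$ for all $x\in\mathcal X$, and $p$ is Lipschitz on $\mathcal X$ with constant $L_p$. Model: $X_i\sim P$ and $Y_i=f_0(X_i)+\varepsilon_i$, with $\varepsilon_i\sim N(0,1)$ independent of $X_i$, the pairs being i.i.d. Kernel: $K:[0,\infty)\to[0,\infty)$ is nonincreasing, supported on $[0,1]$, Lipschitz on $[0,1]$, $K(1)>0$, $\int_{\mathbb R^d}K(\|z\|_2)\,dz=1$, and $\sigma_K=\frac1d\int_{\mathbb R^d}\|x\|_2^2K(\|x\|_2)\,dx<\infty$. Neighborhood graph $G_{n,r}$: vertices $\{1,\dots,n\}$, weights $W_{ij}=K(\|X_i-X_j\|_2/r)$, degree matrix $D$ diagonal with $D_{ii}=\sum_jW_{ij}$, Laplacian $L=D-W$. Laplacian smoothing estimator: $\hat f=\operatorname{argmin}_{f\in\mathbb R^n}\sum_{i=1}^n(Y_i-f_i)^2+\rho f^\top Lf=(I+\rho L)^{-1}(Y_1,\dots,Y_n)^\top$. In-sample error: $\|\hat f-f_0\|_n^2=\frac1n\sum_{i=1}^n(\hat f_i-f_0(X_i))^2$. Sobolev ball: $H^1(\mathcal X)$ is the set of $f\in L^2(\mathcal X)$ with weak partial derivatives in $L^2(\mathcal X)$; $|f|_{H^1(\mathcal X)}^2=\int_{\mathcal X}\|\nabla f(x)\|_2^2\,dx$; $\|f\|_{H^1(\mathcal X)}=\|f\|_{L^2(\mathcal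 X)}+|f|_{H^1(\mathcal X)}$; $H^1(\mathcal X,M)=\{f\in H^1(\mathcal X):\|f\|_{H^1(\mathcal X)}^2\le M^2\}$. Point evaluations $f_0(X_i)$ refer to a fixed representative of $f_0$ (e.g. the precise representative); the choice does not matter almost surely since $P$ has a density. *)

theory Defs
  imports "HOL-Probability.Probability"
begin

text \<open>
  Open sets with Lipschitz boundary: near every boundary point the set is, in suitable orthonormal
  coordinates, the strict epigraph of a Lipschitz function. The vertical axis is the unit vector
  \<open>u\<close>, and \<open>y - (y \<bullet> u) *\<^sub>R u\<close> is the projection of \<open>y\<close> to the hyperplane orthogonal to \<open>u\<close>, so that
  no identification of that hyperplane with a coordinate space is needed (in dimension one it is
  the trivial space). The radius \<open>\<epsilon>\<close> and the Lipschitz constant \<open>L\<close> are uniform over the boundary.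
  If the boundary is compact, in particular for bounded \<open>X\<close>, uniformity follows from the
  pointwise condition; for unbounded sets it is the usual meaning of the notion.
\<close>

definition lipschitz_boundary :: "'a::euclidean_space set \<Rightarrow> bool" where
  "lipschitz_boundary X \<longleftrightarrow>
    (\<exists>\<epsilon>>0. \<exists>L. \<forall>x\<in>frontier X. \<exists>u \<phi>.
        norm u = 1 \<and> L-lipschitz_on {z. z \<bullet> u = 0} \<phi> \<and>
        X \<inter> ball x \<epsilon> = {y \<in> ball x \<epsilon>. \<phi> (y - (y \<bullet> u) *\<^sub>R u) < y \<bullet> u})"


primrec ck_function :: "nat \<Rightarrow> ('a::euclidean_space \<Rightarrow> real) \<Rightarrow> bool" where
  "ck_function 0 \<phi> \<longleftrightarrow> continuous_on UNIV \<phi>"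
| "ck_function (Suc k) \<phi> \<longleftrightarrow>
     (\<forall>x. \<phi> differentiable (at x)) \<and>
     (\<forall>i\<in>Basis. ck_function k (\<lambda>x. frechet_derivative \<phi> (at x) i))"

definition test_function :: "'a::euclidean_space set \<Rightarrow> ('a \<Rightarrow> real) \<Rightarrow> bool" where
  "test_function X \<phi> \<longleftrightarrow>
     (\<forall>k. ck_function k \<phi>) \<and> compact (closure {x. \<phi> x \<noteq> 0}) \<and> closure {x. \<phi> x \<noteq> 0} \<subseteq> X"

definition L2_space :: "'a::euclidean_space set \<Rightarrow> ('a \<Rightarrow> 'b::euclidean_space) set" where
  "L2_space X = {f. f \<in> borel_measurable (lebesgue_on X) \<and>
                    integrable (lebesgue_on X) (\<lambda>x. (norm (f x))\<^sup>2)}"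

definition L2_norm_on :: "'a::euclidean_space set \<Rightarrow> ('a \<Rightarrow> 'b::euclidean_space) \<Rightarrow> real" where
  "L2_norm_on X f = sqrt (\<integral>x. (norm (f x))\<^sup>2 \<partial>lebesgue_on X)"

text \<open>The components \<open>g x \<bullet> i\<close>, \<open>i \<in> Basis\<close>, are the weak partial derivatives of \<open>f\<close>.\<close>

definition is_weak_gradient ::
  "'a::euclidean_space set \<Rightarrow> ('a \<Rightarrow> real) \<Rightarrow> ('a \<Rightarrow> 'a) \<Rightarrow> bool" where
  "is_weak_gradient X f g \<longleftrightarrow>
     (\<forall>\<phi>. test_function X \<phi> \<longrightarrow> (\<forall>i\<in>Basis.
        (\<integral>x. f x * frechet_derivative \<phi> (at x) i \<partial>lebesgue_on X)
        = - (\<integral>x. (g x \<bullet> i) * \<phi> x \<partial>lebesgue_on X)))"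

definition H1_space :: "'a::euclidean_space set \<Rightarrow> ('a \<Rightarrow> real) set" where
  "H1_space X = {f \<in> L2_space X. \<exists>g\<in>L2_space X. is_weak_gradient X f g}"

text \<open>Unique up to null sets for \<open>f \<in> H1_space X\<close> and open \<open>X\<close>, which is all the seminorm needs.\<close>

definition weak_gradient ::
  "'a::euclidean_space set \<Rightarrow> ('a \<Rightarrow> real) \<Rightarrow> 'a \<Rightarrow> 'a" where
  "weak_gradient X f = (SOME g. g \<in> L2_space X \<and> is_weak_gradient X f g)"

definition H1_seminorm :: "'a::euclidean_space set \<Rightarrow> ('a \<Rightarrow> real) \<Rightarrow> real" where
  "H1_seminorm X f = L2_norm_on X (weak_gradient X f)"

definition H1_norm :: "'a::euclidean_space set \<Rightarrow> ('a \<Rightarrow> real) \<Rightarrow> real" where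
  "H1_norm X f = L2_norm_on X f + H1_seminorm X f"

text \<open>
  Elements are functions, not equivalence classes: every Lebesgue measurable representative is a
  member, so that point evaluations of a member are meaningful.
\<close>

definition H1_ball :: "'a::euclidean_space set \<Rightarrow> real \<Rightarrow> ('a \<Rightarrow> real) set" where
  "H1_ball X M = {f \<in> H1_space X. (H1_norm X f)\<^sup>2 \<le> M\<^sup>2}"


definition design_distribution ::
  "'a::euclidean_space set \<Rightarrow> ('a \<Rightarrow> real) \<Rightarrow> 'a measure" where
  "design_distribution X p = density (lebesgue_on X) (\<lambda>x. ennreal (p x))"

text \<open>Law of \<open>(x, f\<^sub>0 x + e)\<close> with \<open>x\<close> distributed as \<open>P\<close> and an independent standard normal \<open>e\<close>.\<close>

definition regression_law :: "'a measure \<Rightarrow> ('a \<Rightarrow> real) \<Rightarrow> ('a \<times> real) measure" where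
  "regression_law P f0 =
     distr (P \<Otimes>\<^sub>M std_normal_distribution) (P \<Otimes>\<^sub>M borel) (\<lambda>(x, e). (x, f0 x + e))"

text \<open>
  Law of an i.i.d. sample; a sample point \<open>\<omega>\<close> consists of the pairs \<open>\<omega> i\<close> for \<open>i < n\<close>.
\<close>

definition regression_sample ::
  "nat \<Rightarrow> 'a measure \<Rightarrow> ('a \<Rightarrow> real) \<Rightarrow> (nat \<Rightarrow> 'a \<times> real) measure" where
  "regression_sample n P f0 = (\<Pi>\<^sub>M i\<in>{..<n}. regression_law P f0)"


text \<open>
  Vectors and matrices of varying size \<open>n\<close> are functions on indices below \<open>n\<close>.
\<close>

definition weight_matrix ::
  "(real \<Rightarrow> real) \<Rightarrow> real \<Rightarrow> (nat \<Rightarrow> 'a::euclidean_space) \<Rightarrow> nat \<Rightarrow> nat \<Rightarrow> real" where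
  "weight_matrix K r x i j = K (norm (x i - x j) / r)"

definition degree_matrix :: "nat \<Rightarrow> (nat \<Rightarrow> nat \<Rightarrow> real) \<Rightarrow> nat \<Rightarrow> nat \<Rightarrow> real" where
  "degree_matrix n W i j = (if i = j then \<Sum>k<n. W i k else 0)"

definition laplacian_matrix :: "nat \<Rightarrow> (nat \<Rightarrow> nat \<Rightarrow> real) \<Rightarrow> nat \<Rightarrow> nat \<Rightarrow> real" where
  "laplacian_matrix n W i j = degree_matrix n W i j - W i j"

definition laplacian_smoothing_objective ::
  "nat \<Rightarrow> real \<Rightarrow> (nat \<Rightarrow> nat \<Rightarrow> real) \<Rightarrow> (nat \<Rightarrow> real) \<Rightarrow> (nat \<Rightarrow> real) \<Rightarrow> real" where
  "laplacian_smoothing_objective n \<rho> L y f =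
     (\<Sum>i<n. (y i - f i)\<^sup>2) + \<rho> * (\<Sum>i<n. \<Sum>j<n. f i * L i j * f j)"

text \<open>
  Restricting to functions that are \<open>undefined\<close> at indices \<open>\<ge> n\<close> makes the minimizer unique for
  positive semidefinite \<open>L\<close> and \<open>\<rho> \<ge> 0\<close>.
\<close>

definition laplacian_smoothing ::
  "(real \<Rightarrow> real) \<Rightarrow> nat \<Rightarrow> real \<Rightarrow> real \<Rightarrow> (nat \<Rightarrow> 'a::euclidean_space \<times> real) \<Rightarrow> nat \<Rightarrow> real" where
  "laplacian_smoothing K n r \<rho> \<omega> =
     arg_min
       (laplacian_smoothing_objective n \<rho>
          (laplacian_matrix n (weight_matrix K r (\<lambda>i. fst (\<omega> i)))) (\<lambda>i. snd (\<omega> i)))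
       (\<lambda>f. f \<in> {..<n} \<rightarrow>\<^sub>E UNIV)"

definition in_sample_error ::
  "nat \<Rightarrow> ('a \<Rightarrow> real) \<Rightarrow> (nat \<Rightarrow> 'a \<times> real) \<Rightarrow> (nat \<Rightarrow> real) \<Rightarrow> real" where
  "in_sample_error n f0 \<omega> f = (1 / real n) * (\<Sum>i<n. (f i - f0 (fst (\<omega> i)))\<^sup>2)"

end

theory Submission
  imports Defs
begin

text \<open>
  The error splits into \<open>2 \<rho> \<theta>\<^sup>T L \<theta> / n\<close> and \<open>(2 / n) \<Sum>\<^sub>k \<langle>\<epsilon>, v\<^sub>k\<rangle>\<^sup>2 / (1 + \<rho> \<lambda>\<^sub>k)\<^sup>2\<close>, with \<open>\<lambda>\<^sub>k, v\<^sub>k\<close> the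
  spectrum of \<open>L\<close>. The expectation of the first term is a nonlocal Dirichlet energy of \<open>f\<^sub>0\<close> at scale
  \<open>r\<close>, which the fundamental theorem of calculus along translations bounds by \<open>r\<^sup>d\<^sup>+\<^sup>2 |f\<^sub>0|\<^sup>2\<close> in
  \<open>H\<^sup>1\<close>. For the second, cover the domain by about \<open>s\<^sup>-\<^sup>d\<close> cells of size \<open>s \<ge> r\<close>, each star-shaped with
  respect to a ball of radius \<open>s\<close> (this is what the Lipschitz boundary provides). If every ball of
  radius \<open>r / 4\<close> contains of the order of \<open>n r\<^sup>d\<close> design points, a nonlocal Poincare inequality on
  the cells and Bessel's inequality leave at most \<open>C s\<^sup>-\<^sup>d\<close> eigenvalues below
  \<open>c n r\<^sup>d\<^sup>+\<^sup>2 / s\<^sup>2\<close>. With \<open>\<sigma> = (M\<^sup>2 n)\<^sup>-\<^sup>1\<^sup>/\<^sup>(\<^sup>2\<^sup>+\<^sup>d\<^sup>)\<close> the choice of \<open>\<rho>\<close> reads \<open>\<rho> n r\<^sup>d\<^sup>+\<^sup>2 = \<sigma>\<^sup>2\<close>, and summing over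
  dyadic \<open>s\<close>, which converges because \<open>d < 4\<close>, bounds the variance by \<open>C / (n \<sigma>\<^sup>d)\<close>.
  Markov's inequality for both terms gives the claim; only the exceptional event for the design
  points, controlled by Chernoff bounds, costs probability beyond \<open>\<delta>\<close>.
\<close>

section \<open>Diagonalization and spectral smoothing\<close>

text \<open>The graph Laplacian is never compared with a differential operator. A vector on the
  design points becomes a local average \<open>avg\<close>, a step function, so its regularity can
  only be measured by finite differences at scale \<open>r\<close>. The same nonlocal energy
  therefore serves twice: for \<open>avg\<close> it is bounded by the graph energy, for the
  regression function by the gradient. Both uses share one geometric device: nearby points of
  \<open>X\<close> need not be joined by a segment inside \<open>X\<close>, but both see a common
  pivot ball, and differences are routed through it. Measurability shapes the rest. Eigenvectors are
  chosen separately for each sample, with no measurable dependence on it, so spectral formulas are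
  only used pointwise or for a frozen design, and measurability of the estimator comes from an
  explicit iteration. Sobolev functions are only Lebesgue measurable and are replaced by Borel
  representatives before integrals are exchanged. \<open>X\<close> may be unbounded; the lower bound
  on the density makes its volume finite, and this keeps the nets finite.\<close>

definition orthogonal_array :: "nat \<Rightarrow> (nat \<times> nat \<Rightarrow> real) \<Rightarrow> bool" where
  "orthogonal_array n V \<longleftrightarrow>
     (\<forall>p. p \<notin> {..<n} \<times> {..<n} \<longrightarrow> V p = 0) \<and>
     (\<forall>k<n. \<forall>l<n. (\<Sum>i<n. V (k, i) * V (l, i)) = (if k = l then 1 else 0)) \<and>
     (\<forall>i<n. \<forall>j<n. (\<Sum>k<n. V (k, i) * V (k, j)) = (if i = j then 1 else 0))"

lemma abs_le_1_if_orthogonal_array: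
  assumes "orthogonal_array n V" shows "\<bar>V p\<bar> \<le> 1"
proof (cases "p \<in> {..<n} \<times> {..<n}")
  case True
  then obtain k i where p: "p = (k, i)" "k < n" "i < n" by auto
  have "(V (k, i))\<^sup>2 \<le> (\<Sum>i<n. (V (k, i))\<^sup>2)"
    using p by (intro member_le_sum) auto
  also have "\<dots> = 1"
    using assms p by (auto simp: orthogonal_array_def power2_eq_square)
  finally show ?thesis using p by (simp add: abs_square_le_1)
next
  case False
  then have "V p = 0" using assms unfolding orthogonal_array_def by blast
  then show ?thesis by simp
qed

text \<open>Vanishing off the square keeps the set inside the cube \<open>[-1, 1]\<close> over all
  index pairs, compact by Tychonoff; the orthogonality relations are closed because each involves
  finitely many coordinates.\<close>

lemma compact_orthogonal_array: "compact {V. orthogonal_array n V}"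
proof -
  let ?K = "PiE UNIV (\<lambda>_ :: nat \<times> nat. {-1..1 :: real})"
  have "compactin (product_topology (\<lambda>_. euclidean) UNIV) ?K"
    by (subst compactin_PiE) auto
  then have K: "compact ?K"
    unfolding euclidean_product_topology compactin_euclidean_iff .
  have cont: "continuous_on UNIV (\<lambda>V :: nat \<times> nat \<Rightarrow> real. \<Sum>i<n. V (f i) * V (g i))" for f g
    by (intro continuous_intros) auto
  have "closed {V. orthogonal_array n V}"
    unfolding orthogonal_array_def
    by (intro closed_Collect_conj closed_Collect_all closed_Collect_imp open_Collect_const
        closed_Collect_eq cont continuous_on_const) auto
  moreover have "{V. orthogonal_array n V} \<subseteq> ?K"
    using abs_le_1_if_orthogonal_array by (force simp: abs_le_iff)
  ultimately show ?thesis
    using K compact_Int_closed[of ?K "{V. orthogonal_array n V}"] by (simp add: Int_absorb1)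
qed

definition qform :: "nat \<Rightarrow> (nat \<Rightarrow> nat \<Rightarrow> real) \<Rightarrow> (nat \<Rightarrow> real) \<Rightarrow> (nat \<Rightarrow> real) \<Rightarrow> real" where
  "qform n L u w = (\<Sum>i<n. \<Sum>j<n. u i * L i j * w j)"

definition ip :: "nat \<Rightarrow> (nat \<Rightarrow> real) \<Rightarrow> (nat \<Rightarrow> real) \<Rightarrow> real" where
  "ip n u w = (\<Sum>i<n. u i * w i)"

lemma ip_add_left: "ip n (\<lambda>i. a * u i + b * w i) z = a * ip n u z + b * ip n w z"
  by (simp add: ip_def sum.distrib sum_distrib_left algebra_simps)

lemma ip_commute: "ip n u w = ip n w u"
  by (simp add: ip_def mult.commute)

lemma ip_add_right: "ip n z (\<lambda>i. a * u i + b * w i) = a * ip n z u + b * ip n z w"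
  by (simp add: ip_commute[of n z] ip_add_left)

lemma qform_add_left: "qform n L (\<lambda>i. a * u i + b * w i) z = a * qform n L u z + b * qform n L w z"
  by (simp add: qform_def sum.distrib sum_distrib_left algebra_simps)

lemma qform_add_right: "qform n L z (\<lambda>i. a * u i + b * w i) = a * qform n L z u + b * qform n L z w"
  by (simp add: qform_def sum.distrib sum_distrib_left algebra_simps)

lemma qform_commute:
  assumes "\<And>i j. i < n \<Longrightarrow> j < n \<Longrightarrow> L i j = L j i"
  shows "qform n L u w = qform n L w u"
  unfolding qform_def
  by (subst sum.swap) (use assms in \<open>auto intro!: sum.cong\<close>)

lemma ip_diff_left: "ip n (\<lambda>i. a * u i - b * w i) z = a * ip n u z - b * ip n w z"
  using ip_add_left[of n a u "- b" w z] by simp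

lemma ip_diff_right: "ip n z (\<lambda>i. a * u i - b * w i) = a * ip n z u - b * ip n z w"
  using ip_add_right[of n z a u "- b" w] by simp

lemma qform_diff_left: "qform n L (\<lambda>i. a * u i - b * w i) z = a * qform n L u z - b * qform n L w z"
  using qform_add_left[of n L a u "- b" w z] by simp

lemma qform_diff_right: "qform n L z (\<lambda>i. a * u i - b * w i) = a * qform n L z u - b * qform n L z w"
  using qform_add_right[of n L z a u "- b" w] by simp

lemma sum_remove2:
  fixes h :: "nat \<Rightarrow> real"
  assumes "a < n" "b < n" "a \<noteq> b"
  shows "(\<Sum>k<n. h k) = h a + h b + (\<Sum>k\<in>{..<n} - {a, b}. h k)"
proof -
  have "{..<n} - {a} - {b} = {..<n} - {a, b}" by auto
  then show ?thesis
    using sum.remove[of "{..<n}" a h] sum.remove[of "{..<n} - {a}" b h] assms by simp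
qed

text \<open>Givens rotation of the rows \<open>a\<close> and \<open>b\<close> by the angle
  \<open>t\<close>.\<close>

definition rot :: "nat \<Rightarrow> nat \<Rightarrow> real \<Rightarrow> (nat \<times> nat \<Rightarrow> real) \<Rightarrow> nat \<times> nat \<Rightarrow> real" where
  "rot a b t V = (\<lambda>(k, i).
     if k = a then cos t * V (a, i) + sin t * V (b, i)
     else if k = b then cos t * V (b, i) - sin t * V (a, i) else V (k, i))"

lemma rot_simps:
  "(\<lambda>i. rot a b t V (a, i)) = (\<lambda>i. cos t * V (a, i) + sin t * V (b, i))"
  "a \<noteq> b \<Longrightarrow> (\<lambda>i. rot a b t V (b, i)) = (\<lambda>i. cos t * V (b, i) - sin t * V (a, i))"
  "k \<noteq> a \<Longrightarrow> k \<noteq> b \<Longrightarrow> (\<lambda>i. rot a b t V (k, i)) = (\<lambda>i. V (k, i))"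
  by (auto simp: rot_def)

lemma orthogonal_array_rot:
  assumes V: "orthogonal_array n V" and ab: "a < n" "b < n" "a \<noteq> b"
  shows "orthogonal_array n (rot a b t V)"
proof -
  have row: "ip n (\<lambda>i. V (k, i)) (\<lambda>i. V (l, i)) = (if k = l then 1 else 0)" if "k < n" "l < n" for k l
    using V that by (simp add: orthogonal_array_def ip_def)
  have cs: "cos t * cos t + sin t * sin t = 1" by (metis sin_cos_squared_add3)
  have 1: "ip n (\<lambda>i. rot a b t V (k, i)) (\<lambda>i. rot a b t V (l, i)) = (if k = l then 1 else 0)"
    if "k < n" "l < n" for k l
    using that ab cs
    by (cases "k = a"; cases "k = b"; cases "l = a"; cases "l = b")
       (simp_all add: rot_simps ip_add_left ip_add_right ip_diff_left ip_diff_right row algebra_simps)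
  \<comment> \<open>Column products are kept because a plane rotation preserves the inner product of
    the pairs of entries that it mixes.\<close>
  have 2: "(\<Sum>k<n. rot a b t V (k, i) * rot a b t V (k, j)) = (\<Sum>k<n. V (k, i) * V (k, j))" for i j
  proof -
    have "rot a b t V (a, i) * rot a b t V (a, j) + rot a b t V (b, i) * rot a b t V (b, j) =
          (cos t * cos t + sin t * sin t) * (V (a, i) * V (a, j) + V (b, i) * V (b, j))"
      using ab unfolding rot_def by (simp del: sin_cos_squared_add3) (simp only: algebra_simps)
    moreover have "(\<Sum>k\<in>{..<n} - {a, b}. rot a b t V (k, i) * rot a b t V (k, j)) =
          (\<Sum>k\<in>{..<n} - {a, b}. V (k, i) * V (k, j))"
      by (intro sum.cong) (auto simp: rot_def)
    ultimately show ?thesis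
      by (simp add: sum_remove2[OF ab] cs)
  qed
  show ?thesis
    using V 1 ab unfolding orthogonal_array_def 2 ip_def by (auto simp: rot_def)
qed

text \<open>
  The trace of \<open>diag(0, \<dots>, n - 1) V L V\<^sup>T\<close> over orthogonal \<open>V\<close> is stationary only if
  \<open>V L V\<^sup>T\<close> is diagonal: otherwise rotating two rows increases it.
\<close>

theorem symmetric_diagonalization:
  assumes sym: "\<And>i j. i < n \<Longrightarrow> j < n \<Longrightarrow> L i j = L j i"
  obtains v :: "nat \<Rightarrow> nat \<Rightarrow> real"
  where "\<And>k l. k < n \<Longrightarrow> l < n \<Longrightarrow> ip n (v k) (v l) = (if k = l then 1 else 0)"
    and "\<And>i j. i < n \<Longrightarrow> j < n \<Longrightarrow> (\<Sum>k<n. v k i * v k j) = (if i = j then 1 else 0)"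
    and "\<And>k l. k < n \<Longrightarrow> l < n \<Longrightarrow> k \<noteq> l \<Longrightarrow> qform n L (v k) (v l) = 0"
proof -
  let ?O = "{V. orthogonal_array n V}"
  define \<Phi> where "\<Phi> V = (\<Sum>k<n. real k * qform n L (\<lambda>i. V (k, i)) (\<lambda>i. V (k, i)))"
    for V :: "nat \<times> nat \<Rightarrow> real"
  have "(\<lambda>(k, i). if k < n \<and> k = i then 1 else 0) \<in> ?O"
    by (auto simp: orthogonal_array_def of_bool_def[symmetric] if_distrib[where f="\<lambda>x. x * _"]
        if_distrib[where f="\<lambda>x. _ * x"] cong: if_cong)
  then have ne: "?O \<noteq> {}" by auto
  have "continuous_on ?O \<Phi>"
    unfolding \<Phi>_def qform_def
    by (intro continuous_intros continuous_on_subset[OF continuous_on_product_coordinates]) auto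
  from continuous_attains_sup[OF compact_orthogonal_array ne this]
  obtain V where V: "orthogonal_array n V" and max: "\<And>W. orthogonal_array n W \<Longrightarrow> \<Phi> W \<le> \<Phi> V"
    by auto
  have off: "qform n L (\<lambda>i. V (a, i)) (\<lambda>i. V (b, i)) = 0" if ab: "a < n" "b < n" "a \<noteq> b" for a b
  proof -
    define q where "q x y = qform n L (\<lambda>i. V (x, i)) (\<lambda>i. V (y, i))" for x y
    have qs: "q b a = q a b" unfolding q_def by (rule qform_commute[OF sym])
    \<comment> \<open>\<open>g\<close> is \<open>\<Phi>\<close> along the rotation. Its slope at 0
      is \<open>2 * (a - b)\<close> times the off-diagonal entry, and the distinct weights make the
      factor \<open>a - b\<close> nonzero.\<close>
    define g where "g t = real a * (cos t * (cos t * q a a + sin t * q a b) + sin t * (cos t * q a b + sin t * q b b))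
       + real b * (- sin t * (- sin t * q a a + cos t * q a b) + cos t * (- sin t * q a b + cos t * q b b))
       + (\<Sum>k\<in>{..<n} - {a, b}. real k * q k k)" for t
    have g: "\<Phi> (rot a b t V) = g t" for t
    proof -
      have "(\<Sum>k\<in>{..<n} - {a, b}. real k * qform n L (\<lambda>i. rot a b t V (k, i)) (\<lambda>i. rot a b t V (k, i)))
          = (\<Sum>k\<in>{..<n} - {a, b}. real k * q k k)"
        by (intro sum.cong) (auto simp: q_def rot_simps)
      then show ?thesis
        unfolding \<Phi>_def g_def sum_remove2[OF ab]
        using ab(3) qs by (simp add: rot_simps qform_add_left qform_add_right qform_diff_left qform_diff_right q_def algebra_simps)
    qed
    have "rot a b 0 V = V" by (auto simp: rot_def)
    then have le: "g t \<le> g 0" for t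
      using max[OF orthogonal_array_rot[OF V ab, of t]] g[of t] g[of 0] by simp
    have "(g has_real_derivative 2 * (real a - real b) * q a b) (at 0)"
      unfolding g_def by (auto intro!: derivative_eq_intros simp: algebra_simps)
    then have "2 * (real a - real b) * q a b = 0"
      by (rule DERIV_local_max[of _ _ _ 1]) (use le in auto)
    then show ?thesis using ab by (simp add: q_def)
  qed
  show thesis
    by (rule that[of "\<lambda>k i. V (k, i)"]) (use V off in \<open>auto simp: orthogonal_array_def ip_def\<close>)
qed

lemma square_diff_le: "(x - y)\<^sup>2 \<le> 2 * x\<^sup>2 + 2 * (y :: real)\<^sup>2"
  using zero_le_power2[of "x + y"] by (simp add: power2_eq_square algebra_simps)

text \<open>Stated through quadratic forms and not as \<open>L v = \<lambda> v\<close>, which is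
  what the variational diagonalization delivers. \<open>row\<close> is orthonormality,
  \<open>col\<close> completeness of the basis.\<close>

locale eigensystem =
  fixes n :: nat and L :: "nat \<Rightarrow> nat \<Rightarrow> real" and v :: "nat \<Rightarrow> nat \<Rightarrow> real"
  assumes psd: "\<And>f. 0 \<le> qform n L f f"
    and row: "\<And>k l. k < n \<Longrightarrow> l < n \<Longrightarrow> ip n (v k) (v l) = (if k = l then 1 else 0)"
    and col: "\<And>i j. i < n \<Longrightarrow> j < n \<Longrightarrow> (\<Sum>k<n. v k i * v k j) = (if i = j then 1 else 0)"
    and offdiag: "\<And>k l. k < n \<Longrightarrow> l < n \<Longrightarrow> k \<noteq> l \<Longrightarrow> qform n L (v k) (v l) = 0"
begin

definition ev :: "nat \<Rightarrow> real" where "ev k = qform n L (v k) (v k)"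

lemma ev_nonneg: "0 \<le> ev k"
  by (simp add: ev_def psd)

lemma expand:
  assumes "i < n" shows "f i = (\<Sum>k<n. ip n f (v k) * v k i)"
proof -
  have "(\<Sum>k<n. ip n f (v k) * v k i) = (\<Sum>k<n. \<Sum>j<n. f j * (v k j * v k i))"
    by (simp add: ip_def sum_distrib_right mult.assoc)
  also have "\<dots> = (\<Sum>j<n. f j * (\<Sum>k<n. v k j * v k i))"
    by (subst sum.swap) (simp add: sum_distrib_left)
  also have "\<dots> = (\<Sum>j<n. if j = i then f j else 0)"
    by (intro sum.cong) (use assms in \<open>auto simp: col\<close>)
  finally show ?thesis using assms by simp
qed

lemma ip_combination:
  assumes "l < n" shows "ip n (\<lambda>i. \<Sum>k<n. a k * v k i) (v l) = a l"
proof -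
  have "ip n (\<lambda>i. \<Sum>k<n. a k * v k i) (v l) = (\<Sum>k<n. a k * ip n (v k) (v l))"
    unfolding ip_def sum_distrib_right sum_distrib_left
    by (subst sum.swap) (simp add: algebra_simps)
  also have "\<dots> = (\<Sum>k<n. if k = l then a k else 0)"
    by (intro sum.cong) (use assms in \<open>auto simp: row\<close>)
  finally show ?thesis using assms by simp
qed

lemma parseval: "(\<Sum>i<n. (f i)\<^sup>2) = (\<Sum>k<n. (ip n f (v k))\<^sup>2)"
proof -
  have "(\<Sum>i<n. (f i)\<^sup>2) = (\<Sum>i<n. \<Sum>k<n. f i * (ip n f (v k) * v k i))"
    by (intro sum.cong) (auto simp: power2_eq_square expand[of _ f] simp flip: sum_distrib_left)
  also have "\<dots> = (\<Sum>k<n. ip n f (v k) * (\<Sum>i<n. f i * v k i))"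
    by (subst sum.swap) (simp add: sum_distrib_left algebra_simps)
  finally show ?thesis by (simp add: ip_def power2_eq_square)
qed

lemma qform_sum_right:
  "qform n L u (\<lambda>i. \<Sum>k<n. a k * w k i) = (\<Sum>k<n. a k * qform n L u (w k))"
proof -
  have "qform n L u (\<lambda>i. \<Sum>k<n. a k * w k i) = (\<Sum>i<n. \<Sum>j<n. \<Sum>k<n. a k * (u i * L i j * w k j))"
    by (simp add: qform_def sum_distrib_left algebra_simps)
  also have "\<dots> = (\<Sum>i<n. \<Sum>k<n. \<Sum>j<n. a k * (u i * L i j * w k j))"
    by (intro sum.cong refl sum.swap)
  also have "\<dots> = (\<Sum>k<n. \<Sum>i<n. \<Sum>j<n. a k * (u i * L i j * w k j))"
    by (rule sum.swap)
  finally show ?thesis by (simp add: qform_def sum_distrib_left)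
qed

lemma qform_sum_left:
  "qform n L (\<lambda>i. \<Sum>k<n. a k * w k i) u = (\<Sum>k<n. a k * qform n L (w k) u)"
proof -
  have "qform n L (\<lambda>i. \<Sum>k<n. a k * w k i) u = (\<Sum>i<n. \<Sum>j<n. \<Sum>k<n. a k * (w k i * L i j * u j))"
    by (simp add: qform_def sum_distrib_left sum_distrib_right algebra_simps)
  also have "\<dots> = (\<Sum>i<n. \<Sum>k<n. \<Sum>j<n. a k * (w k i * L i j * u j))"
    by (intro sum.cong refl sum.swap)
  also have "\<dots> = (\<Sum>k<n. \<Sum>i<n. \<Sum>j<n. a k * (w k i * L i j * u j))"
    by (rule sum.swap)
  finally show ?thesis by (simp add: qform_def sum_distrib_left)
qed

lemma qform_cong: "(\<And>i. i < n \<Longrightarrow> f i = g i) \<Longrightarrow> qform n L f f = qform n L g g"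
  by (auto simp: qform_def intro!: sum.cong)

lemma qform_diagonal: "qform n L f f = (\<Sum>k<n. ev k * (ip n f (v k))\<^sup>2)"
proof -
  have "qform n L f f = qform n L (\<lambda>i. \<Sum>k<n. ip n f (v k) * v k i) (\<lambda>i. \<Sum>k<n. ip n f (v k) * v k i)"
    by (rule qform_cong) (rule expand)
  also have "\<dots> = (\<Sum>k<n. ip n f (v k) * (\<Sum>l<n. ip n f (v l) * qform n L (v k) (v l)))"
    by (simp add: qform_sum_left qform_sum_right)
  also have "\<dots> = (\<Sum>k<n. ip n f (v k) * (\<Sum>l<n. if l = k then ip n f (v l) * ev k else 0))"
    by (intro sum.cong arg_cong2[where f="(*)"] refl) (auto simp: offdiag ev_def)
  finally show ?thesis by (simp add: power2_eq_square algebra_simps)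
qed

lemma bessel:
  assumes "I \<subseteq> {..<n}" shows "(\<Sum>k\<in>I. (ip n f (v k))\<^sup>2) \<le> (\<Sum>i<n. (f i)\<^sup>2)"
  unfolding parseval[of f] by (rule sum_mono2) (use assms in auto)

text \<open>The inverse of \<open>I + \<rho> L\<close> applied to \<open>y\<close>, written in the
  eigenbasis.\<close>

definition smoother :: "real \<Rightarrow> (nat \<Rightarrow> real) \<Rightarrow> nat \<Rightarrow> real" where
  "smoother \<rho> y = (\<lambda>i. \<Sum>k<n. ip n y (v k) / (1 + \<rho> * ev k) * v k i)"

lemma ip_smoother: "l < n \<Longrightarrow> ip n (smoother \<rho> y) (v l) = ip n y (v l) / (1 + \<rho> * ev l)"
  unfolding smoother_def by (rule ip_combination)

lemma objective_diagonal:
  "laplacian_smoothing_objective n \<rho> L y f =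
     (\<Sum>k<n. (ip n y (v k) - ip n f (v k))\<^sup>2 + \<rho> * (ev k * (ip n f (v k))\<^sup>2))"
proof -
  have "ip n (\<lambda>i. y i - f i) z = ip n y z - ip n f z" for z
    by (simp add: ip_def algebra_simps sum_subtractf)
  then have "laplacian_smoothing_objective n \<rho> L y f =
      (\<Sum>k<n. (ip n y (v k) - ip n f (v k))\<^sup>2) + \<rho> * (\<Sum>k<n. ev k * (ip n f (v k))\<^sup>2)"
    using parseval[of "\<lambda>i. y i - f i"] qform_diagonal[of f]
    by (simp add: laplacian_smoothing_objective_def qform_def)
  then show ?thesis by (simp add: sum.distrib sum_distrib_left)
qed

text \<open>Completing the square in each eigencoordinate. The excess has weights
  \<open>1 + \<rho> * ev k \<ge> 1\<close>, so minimality and uniqueness of the smoother follow from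
  one identity.\<close>

lemma objective_decomposition:
  assumes "0 \<le> \<rho>"
  shows "laplacian_smoothing_objective n \<rho> L y f = laplacian_smoothing_objective n \<rho> L y (smoother \<rho> y)
     + (\<Sum>k<n. (1 + \<rho> * ev k) * (ip n f (v k) - ip n (smoother \<rho> y) (v k))\<^sup>2)"
  unfolding objective_diagonal sum.distrib[symmetric]
proof (rule sum.cong[OF refl])
  fix k assume "k \<in> {..<n}"
  then have k: "k < n" by simp
  define m a b where "m = \<rho> * ev k" and "a = ip n y (v k)" and "b = ip n f (v k)"
  have m: "0 \<le> m" using assms by (simp add: m_def ev_nonneg)
  have "(a - b)\<^sup>2 + m * b\<^sup>2 = (a - a / (1 + m))\<^sup>2 + m * (a / (1 + m))\<^sup>2 + (1 + m) * (b - a / (1 + m))\<^sup>2"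
  proof -
    define c where "c = a / (1 + m)"
    have "a = (1 + m) * c" using m by (simp add: c_def)
    then show ?thesis unfolding c_def[symmetric] by (simp add: power2_eq_square algebra_simps)
  qed
  then show "(ip n y (v k) - ip n f (v k))\<^sup>2 + \<rho> * (ev k * (ip n f (v k))\<^sup>2) =
    (ip n y (v k) - ip n (smoother \<rho> y) (v k))\<^sup>2 + \<rho> * (ev k * (ip n (smoother \<rho> y) (v k))\<^sup>2) +
    (1 + \<rho> * ev k) * (ip n f (v k) - ip n (smoother \<rho> y) (v k))\<^sup>2"
    by (simp add: ip_smoother[OF k] m_def a_def b_def mult.assoc)
qed

text \<open>\<open>arg_min\<close> is a choice, so existence of a minimizer has to come first. Any
  minimizer then has zero excess, hence the same eigencoordinates as the smoother.\<close>

lemma arg_min_objective: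
  assumes "0 \<le> \<rho>" and i: "i < n"
  shows "arg_min (laplacian_smoothing_objective n \<rho> L y) (\<lambda>f. f \<in> {..<n} \<rightarrow>\<^sub>E UNIV) i = smoother \<rho> y i"
proof -
  let ?F = "laplacian_smoothing_objective n \<rho> L y"
  \<comment> \<open>The constraint set contains only functions undefined from \<open>n\<close> on,
    so the competitor is the restriction; the objective does not see the difference.\<close>
  let ?s = "restrict (smoother \<rho> y) {..<n}"
  have ip_s: "ip n ?s z = ip n (smoother \<rho> y) z" for z
    by (simp add: ip_def)
  have Fs: "?F ?s = ?F (smoother \<rho> y)"
    unfolding objective_diagonal ip_s ..
  have nonneg: "0 \<le> (1 + \<rho> * ev k) * x\<^sup>2" for k x
    using assms ev_nonneg by (intro mult_nonneg_nonneg add_nonneg_nonneg) auto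
  have le: "?F (smoother \<rho> y) \<le> ?F f" for f
    unfolding objective_decomposition[OF assms(1), of y f] using nonneg by (simp add: sum_nonneg)
  have "is_arg_min ?F (\<lambda>f. f \<in> {..<n} \<rightarrow>\<^sub>E UNIV) ?s"
    unfolding is_arg_min_def using le Fs by (auto simp: not_less)
  then have am: "is_arg_min ?F (\<lambda>f. f \<in> {..<n} \<rightarrow>\<^sub>E UNIV) (arg_min ?F (\<lambda>f. f \<in> {..<n} \<rightarrow>\<^sub>E UNIV))"
    unfolding arg_min_def by (rule someI[of "is_arg_min ?F (\<lambda>f. f \<in> {..<n} \<rightarrow>\<^sub>E UNIV)"])
  define f where "f = arg_min ?F (\<lambda>f. f \<in> {..<n} \<rightarrow>\<^sub>E UNIV)"
  have "\<not> ?F ?s < ?F f"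
  proof
    assume "?F ?s < ?F f"
    then have "\<exists>g. g \<in> {..<n} \<rightarrow>\<^sub>E UNIV \<and> ?F g < ?F f"
      by (intro exI[of _ ?s]) simp
    then show False
      using am unfolding is_arg_min_def f_def[symmetric] by (elim conjE notE)
  qed
  then have "(\<Sum>k<n. (1 + \<rho> * ev k) * (ip n f (v k) - ip n (smoother \<rho> y) (v k))\<^sup>2) \<le> 0"
    using objective_decomposition[OF assms(1), of y f] Fs by linarith
  then have z: "(\<Sum>k<n. (1 + \<rho> * ev k) * (ip n f (v k) - ip n (smoother \<rho> y) (v k))\<^sup>2) = 0"
    using nonneg by (intro antisym sum_nonneg) auto
  have "ip n f (v k) = ip n (smoother \<rho> y) (v k)" if "k < n" for k
  proof -
    have "(1 + \<rho> * ev k) * (ip n f (v k) - ip n (smoother \<rho> y) (v k))\<^sup>2 = 0"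
      using z that by (subst (asm) sum_nonneg_eq_0_iff) (auto simp: nonneg)
    moreover have "1 + \<rho> * ev k > 0"
      using assms ev_nonneg[of k] by (intro add_pos_nonneg) auto
    ultimately show ?thesis by simp
  qed
  then show ?thesis
    using expand[OF i, of f] expand[OF i, of "smoother \<rho> y"] by (simp add: f_def)
qed

text \<open>With \<open>m = \<rho> * ev k\<close> the coordinate error is
  \<open>b / (1 + m) - m / (1 + m) * a\<close>, and \<open>(m / (1 + m))^2 \<le> m\<close> converts
  the bias into the Laplacian energy of \<open>\<theta>\<close>. The distribution of the eigenvalues
  thus matters for the noise term alone.\<close>

lemma smoother_error:
  assumes "0 \<le> \<rho>"
  shows "(\<Sum>i<n. (smoother \<rho> (\<lambda>i. \<theta> i + \<epsilon> i) i - \<theta> i)\<^sup>2)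
    \<le> 2 * \<rho> * qform n L \<theta> \<theta> + 2 * (\<Sum>k<n. (ip n \<epsilon> (v k))\<^sup>2 / (1 + \<rho> * ev k)\<^sup>2)"
proof -
  have ipd: "ip n (\<lambda>i. a i - b i) z = ip n a z - ip n b z" and ipa: "ip n (\<lambda>i. a i + b i) z = ip n a z + ip n b z"
    for a b z
    by (simp_all add: ip_def algebra_simps sum_subtractf sum.distrib)
  have "(ip n (\<lambda>i. smoother \<rho> (\<lambda>i. \<theta> i + \<epsilon> i) i - \<theta> i) (v k))\<^sup>2
     \<le> 2 * \<rho> * (ev k * (ip n \<theta> (v k))\<^sup>2) + 2 * ((ip n \<epsilon> (v k))\<^sup>2 / (1 + \<rho> * ev k)\<^sup>2)" if k: "k < n" for k
  proof -
    define m a b where "m = \<rho> * ev k" and "a = ip n \<theta> (v k)" and "b = ip n \<epsilon> (v k)"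
    have m: "0 \<le> m" using assms by (simp add: m_def ev_nonneg)
    have "(a + b) / (1 + m) - a = b / (1 + m) - m / (1 + m) * a"
    proof -
      have "1 + m \<noteq> 0" using m by simp
      then show ?thesis by (simp add: divide_simps) (simp add: algebra_simps)
    qed
    then have "((a + b) / (1 + m) - a)\<^sup>2 = (b / (1 + m) - m / (1 + m) * a)\<^sup>2" by simp
    also have "\<dots> \<le> 2 * (b / (1 + m))\<^sup>2 + 2 * (m / (1 + m) * a)\<^sup>2"
      by (rule square_diff_le)
    also have "(m / (1 + m) * a)\<^sup>2 \<le> m * a\<^sup>2"
    proof -
      have "(m / (1 + m))\<^sup>2 \<le> m"
      proof -
        have "m\<^sup>2 \<le> m * (1 + m)\<^sup>2"
          using m by (simp add: power2_eq_square algebra_simps)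
        then show ?thesis using m by (simp add: power_divide divide_le_eq)
      qed
      then have "(m / (1 + m))\<^sup>2 * a\<^sup>2 \<le> m * a\<^sup>2" by (rule mult_right_mono) simp
      then show ?thesis by (simp only: power_mult_distrib)
    qed
    finally show ?thesis
      by (simp add: ipd ipa ip_smoother[OF k] m_def a_def b_def power_divide mult.assoc)
  qed
  then show ?thesis
    unfolding parseval[of "\<lambda>i. smoother \<rho> (\<lambda>i. \<theta> i + \<epsilon> i) i - \<theta> i"] qform_diagonal
    unfolding sum_distrib_left sum.distrib[symmetric] by (intro sum_mono) simp
qed

text \<open>
  If \<open>\<Sum>\<^sub>D \<langle>f, u\<^sub>D\<rangle>\<^sup>2\<close> controls \<open>f\<close> up to energy, the eigenvectors of small eigenvalue
  have at least half of their mass in the span of the \<open>u\<^sub>D\<close>, so Bessel bounds their number.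
\<close>

lemma count_small_eigenvalues:
  assumes "finite D" and u: "\<And>c. c \<in> D \<Longrightarrow> (\<Sum>i<n. (u c i)\<^sup>2) \<le> B"
    and poincare: "\<And>f. (\<Sum>i<n. (f i)\<^sup>2) \<le> (\<Sum>c\<in>D. (ip n f (u c))\<^sup>2) + T * qform n L f f"
    and T: "0 < T"
  shows "real (card {k. k < n \<and> ev k < 1 / (2 * T)}) \<le> 2 * B * card D"
proof -
  let ?I = "{k. k < n \<and> ev k < 1 / (2 * T)}"
  have "1 / 2 \<le> (\<Sum>c\<in>D. (ip n (u c) (v k))\<^sup>2)" if "k \<in> ?I" for k
  proof -
    have "(\<Sum>i<n. (v k i)\<^sup>2) = 1"
      using row[of k k] that by (simp add: ip_def power2_eq_square)
    \<comment> \<open>The threshold \<open>1 / (2 * T)\<close> is chosen so that the energy term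
      takes at most half of the unit norm.\<close>
    moreover have "T * ev k \<le> 1 / 2"
      using that T by (simp add: field_simps)
    ultimately show ?thesis
      using poincare[of "v k"] by (simp add: ev_def ip_commute)
  qed
  then have "(\<Sum>k\<in>?I. 1 / 2) \<le> (\<Sum>k\<in>?I. \<Sum>c\<in>D. (ip n (u c) (v k))\<^sup>2)"
    by (intro sum_mono) auto
  also have "\<dots> = (\<Sum>c\<in>D. \<Sum>k\<in>?I. (ip n (u c) (v k))\<^sup>2)"
    by (rule sum.swap)
  also have "\<dots> \<le> (\<Sum>c\<in>D. B)"
    by (intro sum_mono order_trans[OF bessel u]) auto
  finally show ?thesis by (simp add: algebra_simps)
qed

end

text \<open>Jacobi iterates for \<open>(I + \<rho> L) f = y\<close>; their limit shows that the solution is measurable.\<close>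

primrec jacobi :: "nat \<Rightarrow> (nat \<Rightarrow> nat \<Rightarrow> real) \<Rightarrow> real \<Rightarrow> (nat \<Rightarrow> real) \<Rightarrow> nat \<Rightarrow> nat \<Rightarrow> real" where
  "jacobi n W \<rho> y 0 i = 0"
| "jacobi n W \<rho> y (Suc t) i =
     (y i + \<rho> * (\<Sum>j<n. W i j * jacobi n W \<rho> y t j)) / (1 + \<rho> * (\<Sum>j<n. W i j))"

text \<open>The iteration is a contraction in the sup norm: row \<open>i\<close> has the factor
  \<open>\<rho> deg / (1 + \<rho> deg)\<close> with \<open>deg\<close> its row sum, and each of
  these is at most \<open>q = S / (1 + S)\<close> because \<open>S\<close> dominates every
  \<open>\<rho> deg\<close>.\<close>

lemma jacobi_tendsto:
  assumes \<rho>: "0 \<le> \<rho>" and W: "\<And>i j. i < n \<Longrightarrow> j < n \<Longrightarrow> 0 \<le> W i j"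
    and f: "\<And>i. i < n \<Longrightarrow> f i + \<rho> * (\<Sum>j<n. laplacian_matrix n W i j * f j) = y i"
    and i: "i < n"
  shows "(\<lambda>t. jacobi n W \<rho> y t i) \<longlonglongrightarrow> f i"
proof -
  define S where "S = \<rho> * (\<Sum>i<n. \<Sum>j<n. W i j)"
  define q where "q = S / (1 + S)"
  define B where "B = (\<Sum>i<n. \<bar>f i\<bar>)"
  have S: "0 \<le> S" unfolding S_def using \<rho> by (intro mult_nonneg_nonneg sum_nonneg W) auto
  have q: "0 \<le> q" "q < 1" using S by (auto simp: q_def)
  have fix_eq: "f i = (y i + \<rho> * (\<Sum>j<n. W i j * f j)) / (1 + \<rho> * (\<Sum>j<n. W i j))"
    and pos: "0 < 1 + \<rho> * (\<Sum>j<n. W i j)"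
    and qi: "\<rho> * (\<Sum>j<n. W i j) / (1 + \<rho> * (\<Sum>j<n. W i j)) \<le> q" if i: "i < n" for i
  proof -
    have nn: "0 \<le> \<rho> * (\<Sum>j<n. W i j)" using \<rho> i by (intro mult_nonneg_nonneg sum_nonneg W) auto
    then show "0 < 1 + \<rho> * (\<Sum>j<n. W i j)" by simp
    have "(\<Sum>j<n. laplacian_matrix n W i j * f j) = (\<Sum>j<n. (if i = j then (\<Sum>k<n. W i k) * f j else 0) - W i j * f j)"
      by (intro sum.cong) (auto simp: laplacian_matrix_def degree_matrix_def left_diff_distrib)
    also have "\<dots> = (\<Sum>k<n. W i k) * f i - (\<Sum>j<n. W i j * f j)"
      using i by (simp add: sum_subtractf)
    finally have eq: "(\<Sum>j<n. laplacian_matrix n W i j * f j) = (\<Sum>k<n. W i k) * f i - (\<Sum>j<n. W i j * f j)" .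
    have "f i * (1 + \<rho> * (\<Sum>j<n. W i j)) = y i + \<rho> * (\<Sum>j<n. W i j * f j)"
      using f[OF i] unfolding eq by (simp add: algebra_simps)
    then show "f i = (y i + \<rho> * (\<Sum>j<n. W i j * f j)) / (1 + \<rho> * (\<Sum>j<n. W i j))"
      using nn by (simp add: eq_divide_eq)
    have "\<rho> * (\<Sum>j<n. W i j) \<le> S"
      unfolding S_def using W i \<rho>
      by (intro mult_left_mono member_le_sum[of i "{..<n}" "\<lambda>i. \<Sum>j<n. W i j"]) (auto intro!: sum_nonneg)
    then show "\<rho> * (\<Sum>j<n. W i j) / (1 + \<rho> * (\<Sum>j<n. W i j)) \<le> q"
      using nn S unfolding q_def by (simp add: divide_simps algebra_simps)
  qed
  have err: "\<bar>jacobi n W \<rho> y t i - f i\<bar> \<le> q ^ t * B" if "i < n" for t i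
    using that
  proof (induction t arbitrary: i)
    case 0
    then show ?case by (simp add: B_def member_le_sum[of i "{..<n}" "\<lambda>i. \<bar>f i\<bar>"])
  next
    case (Suc t)
    let ?D = "\<Sum>j<n. W i j"
    have B: "0 \<le> q ^ t * B" using q by (simp add: B_def sum_nonneg)
    have "\<bar>(\<Sum>j<n. W i j * jacobi n W \<rho> y t j) - (\<Sum>j<n. W i j * f j)\<bar>
        = \<bar>\<Sum>j<n. W i j * (jacobi n W \<rho> y t j - f j)\<bar>"
      by (simp add: sum_subtractf right_diff_distrib)
    also have "\<dots> \<le> (\<Sum>j<n. W i j * (q ^ t * B))"
      using Suc W by (intro order_trans[OF sum_abs] sum_mono) (simp add: abs_mult mult_left_mono)
    also have "\<dots> = ?D * (q ^ t * B)" by (simp add: sum_distrib_right)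
    finally have le: "\<bar>(\<Sum>j<n. W i j * jacobi n W \<rho> y t j) - (\<Sum>j<n. W i j * f j)\<bar> \<le> ?D * (q ^ t * B)" .
    have "jacobi n W \<rho> y (Suc t) i - f i =
       \<rho> * ((\<Sum>j<n. W i j * jacobi n W \<rho> y t j) - (\<Sum>j<n. W i j * f j)) / (1 + \<rho> * ?D)"
      by (subst fix_eq[OF Suc.prems]) (simp add: diff_divide_distrib[symmetric] algebra_simps)
    then have "\<bar>jacobi n W \<rho> y (Suc t) i - f i\<bar> =
       \<rho> * \<bar>(\<Sum>j<n. W i j * jacobi n W \<rho> y t j) - (\<Sum>j<n. W i j * f j)\<bar> / (1 + \<rho> * ?D)"
      using pos[OF Suc.prems] \<rho> by (simp add: abs_mult)
    also have "\<dots> \<le> \<rho> * (?D * (q ^ t * B)) / (1 + \<rho> * ?D)"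
      using pos[OF Suc.prems] \<rho> le by (intro divide_right_mono mult_left_mono) auto
    also have "\<dots> = \<rho> * ?D / (1 + \<rho> * ?D) * (q ^ t * B)" by simp
    also have "\<dots> \<le> q * (q ^ t * B)"
      by (intro mult_right_mono qi Suc.prems B)
    finally show ?case by simp
  qed
  have "(\<lambda>t. q ^ t * B) \<longlonglongrightarrow> 0"
    using q by (auto intro!: tendsto_mult_left_zero LIMSEQ_power_zero)
  then have "(\<lambda>t. jacobi n W \<rho> y t i - f i) \<longlonglongrightarrow> 0"
    by (rule Lim_null_comparison[rotated]) (use err[OF i] in auto)
  then show ?thesis by (rule LIM_zero_cancel)
qed

section \<open>Lipschitz domains\<close>

text \<open>Near the frontier, \<open>q0\<close> is reached from \<open>z\<close> by moving
  \<open>\<kappa> s\<close> along the vertical axis \<open>u\<close> of a chart. On the way from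
  \<open>x\<close> to \<open>q\<close> the fraction \<open>t\<close> of the segment moves sideways
  by at most \<open>3 s t\<close>, so the graph rises by at most \<open>3 L s t\<close>, while the
  height grows by at least \<open>(\<kappa> - 3) s t\<close>. The two balance for
  \<open>\<kappa> = 3 (1 + L)\<close>, so the strict inequality at \<open>x\<close> survives along
  the segment.\<close>

lemma lipschitz_boundary_escape:
  fixes X :: "'a::euclidean_space set"
  assumes "lipschitz_boundary X"
  obtains \<kappa> s0 :: real where "0 \<le> \<kappa>" "0 < s0"
    "\<And>z s. z \<in> X \<Longrightarrow> 0 < s \<Longrightarrow> s \<le> s0 \<Longrightarrow>
       \<exists>q0. dist z q0 \<le> \<kappa> * s \<and> (\<forall>x\<in>X \<inter> ball z (2 * s). \<forall>q\<in>ball q0 s. closed_segment x q \<subseteq> X)"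
proof -
  obtain \<epsilon> L0 where \<epsilon>: "0 < \<epsilon>" and lip: "\<And>b. b \<in> frontier X \<Longrightarrow> \<exists>u \<phi>. norm u = 1 \<and>
      L0-lipschitz_on {z. z \<bullet> u = 0} \<phi> \<and>
      X \<inter> ball b \<epsilon> = {y \<in> ball b \<epsilon>. \<phi> (y - (y \<bullet> u) *\<^sub>R u) < y \<bullet> u}"
    using assms unfolding lipschitz_boundary_def by blast
  \<comment> \<open>With an empty frontier \<open>L0\<close> is an arbitrary real;
    \<open>max\<close> restores the sign.\<close>
  define L where "L = max L0 0"
  define \<kappa> where "\<kappa> = 3 * (1 + L)"
  \<comment> \<open>Segments stay within \<open>(\<kappa> + 2) s\<close> of \<open>z\<close>, and
    the frontier point \<open>b\<close> is within \<open>4 s\<close>, so everything happens in the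
    chart ball of radius \<open>\<epsilon>\<close>.\<close>
  define s0 where "s0 = \<epsilon> / (\<kappa> + 6)"
  have L: "0 \<le> L" by (simp add: L_def)
  have \<kappa>: "3 \<le> \<kappa>" using L by (simp add: \<kappa>_def)
  have s0: "0 < s0" using \<epsilon> \<kappa> by (simp add: s0_def)
  show thesis
  proof (rule that[of \<kappa> s0])
    fix z s assume z: "z \<in> X" and s: "0 < s" "s \<le> s0"
    show "\<exists>q0. dist z q0 \<le> \<kappa> * s \<and> (\<forall>x\<in>X \<inter> ball z (2 * s). \<forall>q\<in>ball q0 s. closed_segment x q \<subseteq> X)"
    proof (cases "ball z (4 * s) \<subseteq> X")
      case True
      have "closed_segment x q \<subseteq> X" if "x \<in> ball z (2 * s)" "q \<in> ball z s" for x q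
      proof -
        have "x \<in> ball z (4 * s)" "q \<in> ball z (4 * s)" using that s by auto
        then show ?thesis
          using True closed_segment_subset[OF _ _ convex_ball] by blast
      qed
      then show ?thesis using s \<kappa> by (intro exI[of _ z]) auto
    next
      case False
      have "ball z (4 * s) \<inter> frontier X \<noteq> {}"
      proof (rule connected_Int_frontier)
        have "z \<in> ball z (4 * s) \<inter> X" using z s by simp
        then show "ball z (4 * s) \<inter> X \<noteq> {}" by blast
      qed (use False in auto)
      then obtain b where b: "b \<in> frontier X" "dist z b < 4 * s" by auto
      from lip[OF b(1)] obtain u \<phi> where u: "norm u = 1"
        and \<phi>: "L0-lipschitz_on {z. z \<bullet> u = 0} \<phi>"
        and Xb: "X \<inter> ball b \<epsilon> = {y \<in> ball b \<epsilon>. \<phi> (y - (y \<bullet> u) *\<^sub>R u) < y \<bullet> u}" by blast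
      define pr where "pr y = y - (y \<bullet> u) *\<^sub>R u" for y
      have uu: "u \<bullet> u = 1" using u by (simp add: norm_eq_1)
      have prH: "pr y \<in> {z. z \<bullet> u = 0}" for y by (simp add: pr_def inner_diff_left uu)
      have pr_add: "pr (x + t *\<^sub>R y) = pr x + t *\<^sub>R pr y" for x t y
        by (simp add: pr_def inner_add_left algebra_simps)
      have pr_u: "pr u = 0" by (simp add: pr_def uu)
      have norm_pr: "norm (pr y) \<le> norm y" for y
      proof -
        have "pr y \<bullet> pr y = y \<bullet> y - (y \<bullet> u) * (y \<bullet> u)"
          unfolding pr_def inner_diff_left inner_diff_right inner_scaleR_left inner_scaleR_right uu
            inner_commute[of u y] by simp
        then show ?thesis unfolding norm_le by simp
      qed
      define q0 where "q0 = z + (\<kappa> * s) *\<^sub>R u"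
      have "closed_segment x q \<subseteq> X" if x: "x \<in> X" "dist z x < 2 * s" and q: "dist q0 q < s" for x q
      proof
        fix y assume "y \<in> closed_segment x q"
        then obtain t where t: "0 \<le> t" "t \<le> 1" and "y = (1 - t) *\<^sub>R x + t *\<^sub>R q"
          by (auto simp: closed_segment_def)
        then have y: "y = x + t *\<^sub>R (q - x)" by (simp add: algebra_simps)
        \<comment> \<open>The deviation of \<open>q - x\<close> from the vertical push: less than
          \<open>s\<close> comes from \<open>q\<close> and less than \<open>2 s\<close> from
          \<open>x\<close>.\<close>
        define e where "e = (q - q0) - (x - z)"
        have qx: "q - x = e + (\<kappa> * s) *\<^sub>R u" by (simp add: e_def q0_def)
        have ne: "norm e \<le> 3 * s"
          using norm_triangle_ineq4[of "q - q0" "x - z"] x(2) q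
          by (simp add: e_def dist_norm norm_minus_commute)
        have "dist z q \<le> (\<kappa> + 1) * s"
        proof -
          have "dist z q0 = \<kappa> * s" using u s \<kappa> by (simp add: q0_def dist_norm)
          then show ?thesis using dist_triangle[of z q q0] q by (simp add: algebra_simps)
        qed
        moreover have "2 * s \<le> (\<kappa> + 2) * s" using s \<kappa> by (intro mult_right_mono) auto
        moreover have "(\<kappa> + 1) * s < (\<kappa> + 2) * s" using s by (intro mult_strict_right_mono) auto
        ultimately have "x \<in> ball z ((\<kappa> + 2) * s)" "q \<in> ball z ((\<kappa> + 2) * s)"
          using x(2) unfolding mem_ball by linarith+
        then have yz: "y \<in> ball z ((\<kappa> + 2) * s)"
          using closed_segment_subset[OF _ _ convex_ball] \<open>y \<in> closed_segment x q\<close> by blast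
        have "(\<kappa> + 6) * s \<le> (\<kappa> + 6) * s0"
          using s \<kappa> by (intro mult_left_mono) auto
        also have "\<dots> = \<epsilon>" using \<kappa> by (simp add: s0_def)
        finally have e6: "(\<kappa> + 6) * s \<le> \<epsilon>" .
        have yb: "y \<in> ball b \<epsilon>"
          using yz b(2) e6 dist_triangle[of b y z] by (simp add: dist_commute algebra_simps)
        have "x \<in> ball b \<epsilon>"
        proof -
          have "0 \<le> \<kappa> * s" using s \<kappa> by simp
          moreover have "\<kappa> * s + 6 * s \<le> \<epsilon>" using e6 by (simp add: algebra_simps)
          moreover have "dist b x \<le> dist z x + dist z b"
            using dist_triangle[of b x z] by (simp add: dist_commute)
          ultimately show ?thesis using x(2) b(2) s unfolding mem_ball by linarith
        qed
        then have xphi: "\<phi> (pr x) < x \<bullet> u"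
          using Xb x(1) unfolding pr_def by blast
        have "pr (q - x) = pr e"
          using pr_add[of e "\<kappa> * s" u] by (simp add: qx pr_u)
        then have pry: "pr y = pr x + t *\<^sub>R pr e"
          by (simp add: y pr_add)
        have "\<bar>\<phi> (pr y) - \<phi> (pr x)\<bar> \<le> L0 * norm (pr y - pr x)"
          using lipschitz_onD[OF \<phi> prH prH] by (simp add: dist_norm)
        also have "\<dots> \<le> L * norm (pr y - pr x)"
          by (intro mult_right_mono) (auto simp: L_def)
        also have "norm (pr y - pr x) \<le> t * (3 * s)"
          using t ne norm_pr[of e] by (simp add: pry mult_left_mono)
        finally have "\<phi> (pr y) \<le> \<phi> (pr x) + L * (t * (3 * s))"
          using L by (simp add: mult_left_mono)
        also have "\<dots> < x \<bullet> u + L * (t * (3 * s))" using xphi by simp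
        also have "\<dots> = x \<bullet> u + t * (\<kappa> * s - 3 * s)" by (simp add: \<kappa>_def algebra_simps)
        also have "\<dots> \<le> x \<bullet> u + t * (e \<bullet> u + \<kappa> * s)"
        proof -
          have "\<bar>e \<bullet> u\<bar> \<le> 3 * s" using Cauchy_Schwarz_ineq2[of e u] ne u by simp
          then show ?thesis using t by (intro add_left_mono mult_left_mono) auto
        qed
        also have "\<dots> = y \<bullet> u" by (simp add: y qx inner_add_left uu)
        finally show "y \<in> X" using Xb yb unfolding pr_def by blast
      qed
      moreover have "dist z q0 \<le> \<kappa> * s" using u s \<kappa> by (simp add: q0_def dist_norm)
      ultimately show ?thesis by (intro exI[of _ q0]) auto
    qed
  qed (use \<kappa> s0 in auto)
qed

section \<open>Packing, nets and volume in Lipschitz domains\<close>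

lemma emeasure_bounded_less_top:
  "bounded A \<Longrightarrow> emeasure lborel (A :: 'a::euclidean_space set) < top"
  using emeasure_bounded_finite[of A] by simp

definition separated :: "real \<Rightarrow> 'a::metric_space set \<Rightarrow> bool" where
  "separated s Z \<longleftrightarrow> (\<forall>x\<in>Z. \<forall>y\<in>Z. x \<noteq> y \<longrightarrow> s \<le> dist x y)"

text \<open>Balls of radius \<open>s / 2\<close> around separated points are disjoint, so their
  parts in \<open>Y\<close> have total volume at most that of \<open>T\<close>. With
  \<open>Y = UNIV\<close> this bounds the overlap of cells, with \<open>Y = X\<close> the size of
  nets.\<close>

lemma packing_bound:
  fixes Z :: "'a::euclidean_space set" and m :: real
  assumes Z: "finite Z" "separated s Z" and Y: "Y \<in> sets lborel" and T: "T \<in> sets lborel" "emeasure lborel T < \<infinity>"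
    and sub: "\<And>z. z \<in> Z \<Longrightarrow> Y \<inter> ball z (s / 2) \<subseteq> T"
    and m: "\<And>z. z \<in> Z \<Longrightarrow> m \<le> measure lborel (Y \<inter> ball z (s / 2))"
  shows "card Z * m \<le> measure lborel T"
proof -
  have disj: "disjoint_family_on (\<lambda>z. Y \<inter> ball z (s / 2)) Z"
  proof (unfold disjoint_family_on_def, intro ballI impI)
    fix x y assume "x \<in> Z" "y \<in> Z" "x \<noteq> y"
    then have s: "s \<le> dist x y" using Z by (auto simp: separated_def)
    have False if "w \<in> ball x (s / 2)" "w \<in> ball y (s / 2)" for w
      using that s dist_triangle[of x y w] by (simp add: dist_commute)
    then show "Y \<inter> ball x (s / 2) \<inter> (Y \<inter> ball y (s / 2)) = {}" by auto
  qed
  have fin: "emeasure lborel (Y \<inter> ball z (s / 2)) \<noteq> \<infinity>" if "z \<in> Z" for z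
    using emeasure_mono[OF sub[OF that] T(1)] T(2) by auto
  have "card Z * m = (\<Sum>z\<in>Z. m)" by simp
  also have "\<dots> \<le> (\<Sum>z\<in>Z. measure lborel (Y \<inter> ball z (s / 2)))" by (intro sum_mono m)
  also have "\<dots> = measure lborel (\<Union>z\<in>Z. Y \<inter> ball z (s / 2))"
    using Y fin by (intro measure_finite_Union[symmetric] Z disj) auto
  also have "\<dots> \<le> measure lborel T"
    using sub T Y Z by (intro measure_mono_fmeasurable sets.finite_UN fmeasurableI) auto
  finally show ?thesis .
qed

text \<open>The disjoint balls of radius \<open>s / 2\<close> lie in a ball of radius
  \<open>(R + 1/2) s\<close>. The resulting bound is independent of \<open>s\<close> and controls
  how many enlarged cells share a point.\<close>

lemma card_separated_ball_le:
  fixes Z :: "'a::euclidean_space set"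
  assumes "finite Z" "separated s Z" "0 < s" "0 \<le> R"
  shows "real (card {z \<in> Z. dist z x < R * s}) \<le> (2 * R + 1) ^ DIM('a)"
proof -
  let ?V = "unit_ball_vol (real DIM('a))"
  have "card {z \<in> Z. dist z x < R * s} * (?V * (s / 2) ^ DIM('a)) \<le> measure lborel (ball x ((R + 1/2) * s))"
  proof (rule packing_bound[of _ s UNIV])
    show "separated s {z \<in> Z. dist z x < R * s}" using assms by (auto simp: separated_def)
    show "UNIV \<inter> ball z (s / 2) \<subseteq> ball x ((R + 1/2) * s)" if "z \<in> {z \<in> Z. dist z x < R * s}" for z
    proof
      fix y assume "y \<in> UNIV \<inter> ball z (s / 2)"
      then show "y \<in> ball x ((R + 1/2) * s)"
        using that dist_triangle[of x y z] by (simp add: dist_commute algebra_simps)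
    qed
  qed (use assms in \<open>auto simp: content_ball emeasure_bounded_less_top\<close>)
  also have "\<dots> = ?V * ((2 * R + 1) ^ DIM('a) * (s / 2) ^ DIM('a))"
    using assms by (simp add: content_ball power_mult_distrib[symmetric] field_simps)
  finally have "card {z \<in> Z. dist z x < R * s} * (?V * (s / 2) ^ DIM('a)) \<le> (2 * R + 1) ^ DIM('a) * (?V * (s / 2) ^ DIM('a))"
    by (simp add: mult_ac)
  then show ?thesis
    by (rule mult_right_le_imp_le) (use assms unit_ball_vol_pos[of "real DIM('a)"] in simp)
qed

text \<open>The boundary enters only through \<open>escape\<close>, and finite volume takes the
  place of boundedness. Fixing \<open>\<kappa>\<close> and \<open>s0\<close> here keeps all later
  constants independent of the sample and of the scale.\<close>

locale lipschitz_domain =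
  fixes X :: "'a::euclidean_space set" and \<kappa> s0 :: real
  assumes open_X: "open X" and finite_X: "emeasure lborel X < \<infinity>"
    and \<kappa>: "0 \<le> \<kappa>" and s0: "0 < s0"
    and escape: "\<And>z s. z \<in> X \<Longrightarrow> 0 < s \<Longrightarrow> s \<le> s0 \<Longrightarrow>
       \<exists>q0. dist z q0 \<le> \<kappa> * s \<and> (\<forall>x\<in>X \<inter> ball z (2 * s). \<forall>q\<in>ball q0 s. closed_segment x q \<subseteq> X)"
begin

text \<open>The centre of the ball is irrelevant; it ties the constant to \<open>X\<close>, hence to the dimension of the type.\<close>

definition V :: real where "V = measure lborel (ball (SOME x. x \<in> X) 1)"

lemma V_eq: "V = unit_ball_vol (real DIM('a))"
  by (simp add: V_def content_ball)

lemma V_pos: "0 < V" by (simp add: V_eq)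

lemma measure_ball: "0 \<le> r \<Longrightarrow> measure lborel (ball (x :: 'a) r) = V * r ^ DIM('a)"
  by (simp add: V_eq content_ball)

definition pivot :: "real \<Rightarrow> 'a \<Rightarrow> 'a" where
  "pivot s z = (SOME q0. dist z q0 \<le> \<kappa> * s \<and>
     (\<forall>x\<in>X \<inter> ball z (2 * s). \<forall>q\<in>ball q0 s. closed_segment x q \<subseteq> X))"

lemma pivot:
  assumes "z \<in> X" "0 < s" "s \<le> s0"
  shows dist_pivot: "dist z (pivot s z) \<le> \<kappa> * s"
    and segment_pivot: "\<And>x q. x \<in> X \<Longrightarrow> dist z x < 2 * s \<Longrightarrow> dist (pivot s z) q < s \<Longrightarrow> closed_segment x q \<subseteq> X"
  using someI_ex[OF escape[OF assms]] unfolding pivot_def[symmetric] by auto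

lemma ball_pivot: "z \<in> X \<Longrightarrow> 0 < s \<Longrightarrow> s \<le> s0 \<Longrightarrow> ball (pivot s z) s \<subseteq> X"
  using segment_pivot[of z s z] ends_in_segment(2)[of z] by (auto simp: subset_iff)

definition cone_const :: real where "cone_const = V / (\<kappa> + 1) ^ DIM('a)"

lemma cone_const_pos: "0 < cone_const"
  using V_pos \<kappa> by (simp add: cone_const_def)

text \<open>An interior cone condition in terms of volume: at scale
  \<open>t / (\<kappa> + 1)\<close> the whole pivot ball fits into \<open>ball x t\<close>, which is
  also the origin of \<open>cone_const\<close>.\<close>

lemma volume_ge:
  assumes "x \<in> X" "0 < t" "t \<le> s0"
  shows "cone_const * t ^ DIM('a) \<le> measure lborel (X \<inter> ball x t)"
proof -
  define s where "s = t / (\<kappa> + 1)"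
  have "s0 \<le> s0 * (\<kappa> + 1)" using s0 \<kappa> by simp
  then have "t \<le> s0 * (\<kappa> + 1)" using assms by linarith
  then have s: "0 < s" "s \<le> s0" "(\<kappa> + 1) * s = t"
    using assms \<kappa> by (auto simp: s_def divide_le_eq)
  have "ball (pivot s x) s \<subseteq> X \<inter> ball x t"
  proof (intro Int_greatest ball_pivot assms s)
    show "ball (pivot s x) s \<subseteq> ball x t"
    proof
      fix y assume "y \<in> ball (pivot s x) s"
      then show "y \<in> ball x t"
        using dist_pivot[OF assms(1) s(1,2)] dist_triangle[of x y "pivot s x"] s(3)
        by (simp add: algebra_simps)
    qed
  qed
  then have "measure lborel (ball (pivot s x) s) \<le> measure lborel (X \<inter> ball x t)"
    using open_X by (intro measure_mono_fmeasurable fmeasurableI)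
      (auto simp: emeasure_bounded_less_top bounded_Int)
  moreover have "measure lborel (ball (pivot s x) s) = cone_const * t ^ DIM('a)"
    using s \<kappa> by (simp add: measure_ball cone_const_def s(3)[symmetric] power_mult_distrib)
  ultimately show ?thesis by simp
qed

text \<open>Packing bounds the cardinality of separated subsets, so one of greatest cardinality
  exists; it covers \<open>X\<close>, since an uncovered point could be added to it.\<close>

lemma ex_net:
  assumes s: "0 < s" "s \<le> s0"
  obtains Z where "finite Z" "Z \<subseteq> X" "separated s Z" "\<And>x. x \<in> X \<Longrightarrow> \<exists>z\<in>Z. dist z x < s"
    "real (card Z) \<le> 2 ^ DIM('a) * measure lborel X / cone_const / s ^ DIM('a)"
proof -
  define B where "B = 2 ^ DIM('a) * measure lborel X / cone_const / s ^ DIM('a)"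
  have bound: "real (card Z) \<le> B" if "finite Z" "Z \<subseteq> X" "separated s Z" for Z
  proof -
    have "card Z * (cone_const * (s / 2) ^ DIM('a)) \<le> measure lborel X"
    proof (rule packing_bound[of _ s X])
      show "cone_const * (s / 2) ^ DIM('a) \<le> measure lborel (X \<inter> ball z (s / 2))" if "z \<in> Z" for z
        using that \<open>Z \<subseteq> X\<close> s by (intro volume_ge) auto
    qed (use that open_X finite_X in auto)
    then show ?thesis
      using s cone_const_pos by (simp add: B_def field_simps)
  qed
  define P where "P k \<longleftrightarrow> (\<exists>Z. finite Z \<and> Z \<subseteq> X \<and> separated s Z \<and> card Z = k)" for k
  have "P 0" unfolding P_def by (intro exI[of _ "{}"]) (auto simp: separated_def)
  moreover have "\<forall>k. P k \<longrightarrow> k \<le> nat \<lfloor>B\<rfloor>"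
    using bound unfolding P_def by (metis le_nat_floor)
  ultimately have "P (Greatest P)" and max: "\<And>k. P k \<Longrightarrow> k \<le> Greatest P"
    by (blast intro: GreatestI_nat Greatest_le_nat)+
  then obtain Z where Z: "finite Z" "Z \<subseteq> X" "separated s Z" "card Z = Greatest P"
    by (auto simp: P_def)
  have "\<exists>z\<in>Z. dist z x < s" if x: "x \<in> X" for x
  proof (rule ccontr)
    assume "\<not> (\<exists>z\<in>Z. dist z x < s)"
    then have far: "\<And>z. z \<in> Z \<Longrightarrow> s \<le> dist z x" by force
    then have "x \<notin> Z" using s by force
    moreover have "separated s (insert x Z)"
      using Z(3) far by (auto simp: separated_def dist_commute)
    ultimately have "P (Suc (card Z))"
      unfolding P_def using Z x by (intro exI[of _ "insert x Z"]) auto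
    from max[OF this] Z(4) show False by simp
  qed
  with Z bound[of Z] show thesis by (intro that[of Z]) (auto simp: B_def)
qed

end

section \<open>A nonlocal Poincare inequality on the sample\<close>

lemma nn_integral_lborel_affine:
  fixes g :: "'a::euclidean_space \<Rightarrow> ennreal"
  assumes [measurable]: "g \<in> borel_measurable borel" and "c \<noteq> 0"
  shows "(\<integral>\<^sup>+q. g q \<partial>lborel) = ennreal (\<bar>c\<bar> ^ DIM('a)) * (\<integral>\<^sup>+h. g (t + c *\<^sub>R h) \<partial>lborel)"
  by (subst lborel_affine[OF assms(2), of t])
     (simp add: nn_integral_density nn_integral_distr nn_integral_cmult ennreal_power)

lemma nn_integral_lborel_translate:
  fixes g :: "'a::euclidean_space \<Rightarrow> ennreal"
  assumes "g \<in> borel_measurable borel"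
  shows "(\<integral>\<^sup>+h. g (t + h) \<partial>lborel) = (\<integral>\<^sup>+q. g q \<partial>lborel)"
  using nn_integral_lborel_affine[OF assms, of 1 t] by simp

text \<open>\<open>of_bool\<close> lets the integrals run over the whole space, and extended
  nonnegative values avoid integrability conditions when integrals are exchanged.\<close>

definition nonlocal_energy :: "'a::euclidean_space set \<Rightarrow> real \<Rightarrow> ('a \<Rightarrow> real) \<Rightarrow> ennreal" where
  "nonlocal_energy D \<rho> F = (\<integral>\<^sup>+x. \<integral>\<^sup>+y. ennreal (of_bool (x \<in> D \<and> y \<in> D \<and> dist x y \<le> \<rho>) * (F x - F y)\<^sup>2) \<partial>lborel \<partial>lborel)"

text \<open>
  For \<open>q = x + m h\<close> telescope \<open>F x - F q\<close> along \<open>x, x + h, \<dots>, x + m h\<close>; for fixed \<open>h\<close> each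
  summand has the same integral over \<open>x\<close>, and \<open>dq = m\<^sup>d dh\<close>.
\<close>

lemma nonlocal_path_inequality:
  fixes F :: "'a::euclidean_space \<Rightarrow> real"
  assumes F[measurable]: "F \<in> borel_measurable borel"
    and D[measurable]: "D \<in> sets borel" and Q[measurable]: "Q \<in> sets borel" and D'[measurable]: "D' \<in> sets borel"
    and m: "0 < m"
    and path: "\<And>x q t. x \<in> D \<Longrightarrow> q \<in> Q \<Longrightarrow> 0 \<le> t \<Longrightarrow> t \<le> 1 \<Longrightarrow> x + t *\<^sub>R (q - x) \<in> D'"
    and dist: "\<And>x q. x \<in> D \<Longrightarrow> q \<in> Q \<Longrightarrow> dist x q \<le> real m * \<rho>"
  shows "(\<integral>\<^sup>+x. \<integral>\<^sup>+q. ennreal (of_bool (x \<in> D \<and> q \<in> Q) * (F x - F q)\<^sup>2) \<partial>lborel \<partial>lborel)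
     \<le> ennreal (real m ^ (DIM('a) + 2)) * nonlocal_energy D' \<rho> F"
proof -
  define G where "G x q = ennreal (of_bool (x \<in> D \<and> q \<in> Q) * (F x - F q)\<^sup>2)" for x q
  define H where "H z h = of_bool (z \<in> D' \<and> z + h \<in> D' \<and> norm h \<le> \<rho>) * (F z - F (z + h))\<^sup>2" for z h
  \<comment> \<open>Cauchy-Schwarz over \<open>m\<close> increments costs one factor
    \<open>m\<close>, summing \<open>m\<close> equal integrals another, and the Jacobian is
    \<open>m ^ DIM('a)\<close>; together this is the power \<open>DIM('a) + 2\<close>.\<close>
  have GH: "G x (x + real m *\<^sub>R h) \<le> ennreal (real m) * (\<Sum>k<m. ennreal (H (x + real k *\<^sub>R h) h))" for x h
  proof (cases "x \<in> D \<and> x + real m *\<^sub>R h \<in> Q")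
    case True
    have mem: "x + real k *\<^sub>R h \<in> D'" if "k \<le> m" for k
      using path[of x "x + real m *\<^sub>R h" "real k / real m"] True that m by simp
    have "norm h \<le> \<rho>"
      using dist[of x "x + real m *\<^sub>R h"] True m by (simp add: dist_norm)
    then have H: "H (x + real k *\<^sub>R h) h = (F (x + real k *\<^sub>R h) - F (x + real (Suc k) *\<^sub>R h))\<^sup>2" if "k < m" for k
      using mem[of k] mem[of "Suc k"] that by (simp add: H_def algebra_simps)
    have "F x - F (x + real m *\<^sub>R h) = (\<Sum>k<m. F (x + real k *\<^sub>R h) - F (x + real (Suc k) *\<^sub>R h))"
      using sum_lessThan_telescope'[of "\<lambda>k. F (x + real k *\<^sub>R h)" m] by simp
    then have "(F x - F (x + real m *\<^sub>R h))\<^sup>2 \<le> (\<Sum>k<m. (F (x + real k *\<^sub>R h) - F (x + real (Suc k) *\<^sub>R h))\<^sup>2) * m"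
      using sum_squared_le_sum_of_squares[of "\<lambda>k. F (x + real k *\<^sub>R h) - F (x + real (Suc k) *\<^sub>R h)" "{..<m}"] by simp
    also have "\<dots> = real m * (\<Sum>k<m. H (x + real k *\<^sub>R h) h)"
      by (simp add: H mult.commute)
    finally have le: "(F x - F (x + real m *\<^sub>R h))\<^sup>2 \<le> real m * (\<Sum>k<m. H (x + real k *\<^sub>R h) h)" .
    have "ennreal (real m) * (\<Sum>k<m. ennreal (H (x + real k *\<^sub>R h) h)) = ennreal (real m * (\<Sum>k<m. H (x + real k *\<^sub>R h) h))"
      by (subst sum_ennreal) (auto simp: H_def ennreal_mult sum_nonneg)
    then show ?thesis
      using True le by (simp add: G_def ennreal_leI)
  qed (auto simp: G_def)
  have mG[measurable]: "case_prod G \<in> borel_measurable (lborel \<Otimes>\<^sub>M lborel)"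
    unfolding G_def by measurable
  have mH[measurable]: "(\<lambda>(z, h). ennreal (H z h)) \<in> borel_measurable (lborel \<Otimes>\<^sub>M lborel)"
    unfolding H_def by measurable
  have mH1[measurable]: "(\<lambda>z. ennreal (H z h)) \<in> borel_measurable borel" for h
    unfolding H_def by measurable
  have "(\<integral>\<^sup>+x. \<integral>\<^sup>+q. G x q \<partial>lborel \<partial>lborel) = (\<integral>\<^sup>+x. ennreal (real m ^ DIM('a)) * (\<integral>\<^sup>+h. G x (x + real m *\<^sub>R h) \<partial>lborel) \<partial>lborel)"
    using m by (intro nn_integral_cong, subst nn_integral_lborel_affine[of _ "real m"]) (auto simp: G_def)
  also have "\<dots> = ennreal (real m ^ DIM('a)) * (\<integral>\<^sup>+x. \<integral>\<^sup>+h. G x (x + real m *\<^sub>R h) \<partial>lborel \<partial>lborel)"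
    unfolding G_def by (rule nn_integral_cmult) measurable
  also have "(\<integral>\<^sup>+x. \<integral>\<^sup>+h. G x (x + real m *\<^sub>R h) \<partial>lborel \<partial>lborel) = (\<integral>\<^sup>+h. \<integral>\<^sup>+x. G x (x + real m *\<^sub>R h) \<partial>lborel \<partial>lborel)"
    unfolding G_def by (rule lborel_pair.Fubini'[symmetric]) measurable
  also have "\<dots> \<le> (\<integral>\<^sup>+h. ennreal (real m * real m) * (\<integral>\<^sup>+z. ennreal (H z h) \<partial>lborel) \<partial>lborel)"
  proof (rule nn_integral_mono)
    fix h :: 'a
    have tr: "(\<integral>\<^sup>+x. ennreal (H (x + t) h) \<partial>lborel) = (\<integral>\<^sup>+z. ennreal (H z h) \<partial>lborel)" for t
      using nn_integral_lborel_translate[OF mH1, of t h] by (simp only: add.commute[of t])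
    have "(\<integral>\<^sup>+x. G x (x + real m *\<^sub>R h) \<partial>lborel) \<le> (\<integral>\<^sup>+x. ennreal (real m) * (\<Sum>k<m. ennreal (H (x + real k *\<^sub>R h) h)) \<partial>lborel)"
      by (intro nn_integral_mono GH)
    also have "\<dots> = ennreal (real m) * (\<Sum>k<m. \<integral>\<^sup>+x. ennreal (H (x + real k *\<^sub>R h) h) \<partial>lborel)"
      by (subst nn_integral_cmult, measurable, subst nn_integral_sum) (auto simp: H_def)
    also have "\<dots> = ennreal (real m) * (\<Sum>k<m. \<integral>\<^sup>+z. ennreal (H z h) \<partial>lborel)"
      by (simp only: tr)
    finally show "(\<integral>\<^sup>+x. G x (x + real m *\<^sub>R h) \<partial>lborel) \<le> ennreal (real m * real m) * (\<integral>\<^sup>+z. ennreal (H z h) \<partial>lborel)"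
      by (simp add: ennreal_mult mult.assoc ennreal_of_nat_eq_real_of_nat[symmetric])
  qed
  also have "\<dots> = ennreal (real m * real m) * (\<integral>\<^sup>+h. \<integral>\<^sup>+z. ennreal (H z h) \<partial>lborel \<partial>lborel)"
    by (rule nn_integral_cmult) measurable
  also have "(\<integral>\<^sup>+h. \<integral>\<^sup>+z. ennreal (H z h) \<partial>lborel \<partial>lborel) = (\<integral>\<^sup>+z. \<integral>\<^sup>+h. ennreal (H z h) \<partial>lborel \<partial>lborel)"
    by (rule lborel_pair.Fubini') measurable
  also have "\<dots> = nonlocal_energy D' \<rho> F"
    unfolding nonlocal_energy_def
  proof (rule nn_integral_cong)
    fix z :: 'a
    show "(\<integral>\<^sup>+h. ennreal (H z h) \<partial>lborel) = (\<integral>\<^sup>+y. ennreal (of_bool (z \<in> D' \<and> y \<in> D' \<and> dist z y \<le> \<rho>) * (F z - F y)\<^sup>2) \<partial>lborel)"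
      using nn_integral_lborel_translate[of "\<lambda>y. ennreal (of_bool (z \<in> D' \<and> y \<in> D' \<and> dist z y \<le> \<rho>) * (F z - F y)\<^sup>2)" z]
      by (simp add: H_def dist_norm)
  qed
  finally have "(\<integral>\<^sup>+x. \<integral>\<^sup>+q. G x q \<partial>lborel \<partial>lborel)
      \<le> ennreal (real m ^ DIM('a)) * (ennreal (real m * real m) * nonlocal_energy D' \<rho> F)"
    by (simp add: mult_left_mono)
  also have "\<dots> = ennreal (real m ^ (DIM('a) + 2)) * nonlocal_energy D' \<rho> F"
    by (simp add: power_add power2_eq_square ennreal_mult mult_ac)
  finally show ?thesis
    unfolding G_def .
qed

text \<open>Jensen for the mean \<open>c\<close> of \<open>F\<close> on \<open>Q\<close>: in the
  square of \<open>(a - c) + (c - F)\<close> the cross term integrates to zero and the square of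
  \<open>c - F\<close> is dropped.\<close>

lemma variance_le_pivot_integral:
  fixes F :: "'a::euclidean_space \<Rightarrow> real"
  assumes F: "set_integrable lborel Q F" and F2: "\<And>a. set_integrable lborel Q (\<lambda>q. (a - F q)\<^sup>2)"
    and Q: "Q \<in> sets lborel" "emeasure lborel Q < \<infinity>" "0 < measure lborel Q"
  defines "c \<equiv> (LINT q:Q|lborel. F q) / measure lborel Q"
  shows "ennreal (measure lborel Q * (a - c)\<^sup>2) \<le> (\<integral>\<^sup>+q. ennreal (of_bool (q \<in> Q) * (a - F q)\<^sup>2) \<partial>lborel)"
proof -
  have const: "set_integrable lborel Q (\<lambda>_. b :: real)" for b
    using Q by (simp add: set_integrable_def)
  have "measure lborel Q * (a - c)\<^sup>2 = (LINT q:Q|lborel. (a - c)\<^sup>2)"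
    using Q by (simp add: set_lebesgue_integral_def measure_def)
  also have "\<dots> = (LINT q:Q|lborel. (a - c)\<^sup>2 + 2 * (a - c) * (c - F q))"
  proof -
    have "(LINT q:Q|lborel. c - F q) = measure lborel Q * c - (LINT q:Q|lborel. F q)"
      using Q by (subst set_integral_diff(2)[OF const F]) (simp add: set_lebesgue_integral_def measure_def)
    also have "\<dots> = 0" using Q(3) by (simp add: c_def)
    finally have 0: "(LINT q:Q|lborel. c - F q) = 0" .
    have "set_integrable lborel Q (\<lambda>q. 2 * (a - c) * (c - F q))"
      by (intro set_integrable_mult_right set_integral_diff(1)[OF const F])
    then show ?thesis
      by (subst set_integral_add(2)[OF const]) (simp_all add: 0)
  qed
  also have "\<dots> \<le> (LINT q:Q|lborel. (a - F q)\<^sup>2)"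
  proof (rule set_integral_mono)
    show "set_integrable lborel Q (\<lambda>q. (a - c)\<^sup>2 + 2 * (a - c) * (c - F q))"
      by (intro set_integral_add(1)[OF const] set_integrable_mult_right set_integral_diff(1)[OF const F])
    show "(a - c)\<^sup>2 + 2 * (a - c) * (c - F q) \<le> (a - F q)\<^sup>2" for q
      using zero_le_power2[of "c - F q"] by (simp add: power2_eq_square algebra_simps)
  qed (rule F2)
  finally have "ennreal (measure lborel Q * (a - c)\<^sup>2) \<le> ennreal (LINT q:Q|lborel. (a - F q)\<^sup>2)"
    by (rule ennreal_leI)
  also have "\<dots> = (\<integral>\<^sup>+q. ennreal (indicator Q q *\<^sub>R (a - F q)\<^sup>2) \<partial>lborel)"
    unfolding set_lebesgue_integral_def
    by (rule nn_integral_eq_integral[symmetric]) (use F2[of a] in \<open>auto simp: set_integrable_def\<close>)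
  also have "\<dots> = (\<integral>\<^sup>+q. ennreal (of_bool (q \<in> Q) * (a - F q)\<^sup>2) \<partial>lborel)"
    by (simp add: indicator_def)
  finally show ?thesis .
qed

text \<open>The difference of the means is the mean of \<open>v i - v j\<close> over
  \<open>I \<times> J\<close>, so this is Jensen on the product.\<close>

lemma mean_diff_squared_le:
  fixes v :: "'i \<Rightarrow> real"
  assumes "finite I" "finite J" "I \<noteq> {}" "J \<noteq> {}"
  shows "((\<Sum>i\<in>I. v i) / card I - (\<Sum>j\<in>J. v j) / card J)\<^sup>2
    \<le> (\<Sum>i\<in>I. \<Sum>j\<in>J. (v i - v j)\<^sup>2) / (real (card I) * real (card J))"
proof -
  define N where "N = real (card I) * real (card J)"
  have pos: "0 < real (card I)" "0 < real (card J)" using assms by (auto simp: card_gt_0_iff)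
  then have N: "0 < N" by (simp add: N_def)
  have "(\<Sum>(i, j)\<in>I \<times> J. v i - v j) = real (card J) * (\<Sum>i\<in>I. v i) - real (card I) * (\<Sum>j\<in>J. v j)"
    by (simp add: sum.cartesian_product[symmetric] sum_subtractf sum_distrib_left)
  then have "(\<Sum>i\<in>I. v i) / card I - (\<Sum>j\<in>J. v j) / card J = (\<Sum>(i, j)\<in>I \<times> J. v i - v j) / N"
    using pos by (simp add: N_def field_simps)
  then have "((\<Sum>i\<in>I. v i) / card I - (\<Sum>j\<in>J. v j) / card J)\<^sup>2 = (\<Sum>(i, j)\<in>I \<times> J. v i - v j)\<^sup>2 / N\<^sup>2"
    by (simp add: power_divide)
  also have "\<dots> \<le> ((\<Sum>(i, j)\<in>I \<times> J. (v i - v j)\<^sup>2) * N) / N\<^sup>2"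
    using sum_squared_le_sum_of_squares[of "\<lambda>(i, j). v i - v j" "I \<times> J"]
    by (intro divide_right_mono) (auto simp: N_def card_cartesian_product case_prod_unfold)
  also have "\<dots> = (\<Sum>i\<in>I. \<Sum>j\<in>J. (v i - v j)\<^sup>2) / N"
    using N by (simp add: sum.cartesian_product power2_eq_square)
  finally show ?thesis by (simp add: N_def)
qed

lemma nn_integral_indicator_sum:
  fixes a :: "'i \<Rightarrow> real"
  assumes "\<And>i. i \<in> I \<Longrightarrow> 0 \<le> a i" "\<And>i. i \<in> I \<Longrightarrow> A i \<in> sets M"
    "\<And>i. i \<in> I \<Longrightarrow> emeasure M (A i) = ennreal m" "0 \<le> m"
  shows "(\<integral>\<^sup>+y. ennreal (\<Sum>i\<in>I. a i * indicator (A i) y) \<partial>M) = ennreal (\<Sum>i\<in>I. a i * m)"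
proof -
  have "(\<integral>\<^sup>+y. ennreal (\<Sum>i\<in>I. a i * indicator (A i) y) \<partial>M) = (\<integral>\<^sup>+y. (\<Sum>i\<in>I. ennreal (a i) * indicator (A i) y) \<partial>M)"
    using assms by (intro nn_integral_cong) (simp add: sum_ennreal[symmetric] ennreal_mult ennreal_indicator)
  also have "\<dots> = (\<Sum>i\<in>I. ennreal (a i) * ennreal m)"
    using assms by (subst nn_integral_sum) (auto simp: nn_integral_cmult_indicator intro!: sum.cong)
  also have "\<dots> = ennreal (\<Sum>i\<in>I. a i * m)"
    using assms by (subst sum_ennreal[symmetric]) (auto simp: ennreal_mult)
  finally show ?thesis .
qed

text \<open>A deterministic design. The radius \<open>r / 4\<close> makes sample points near
  \<open>x\<close> and sample points near \<open>y\<close> graph neighbours whenever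
  \<open>dist x y \<le> r / 2\<close>.\<close>

locale graph_sample = lipschitz_domain X \<kappa> s0 for X :: "'a::euclidean_space set" and \<kappa> s0 +
  fixes n :: nat and r :: real and xs :: "nat \<Rightarrow> 'a" and N0 N1 :: real
  assumes r: "0 < r" "r \<le> s0" and N0_pos: "0 < N0" and N1_nonneg: "0 \<le> N1"
    and xs: "\<And>i. i < n \<Longrightarrow> xs i \<in> X"
    and lower: "\<And>x. x \<in> X \<Longrightarrow> N0 \<le> card {i. i < n \<and> dist (xs i) x < r / 4}"
    and upper: "\<And>x. x \<in> X \<Longrightarrow> card {i. i < n \<and> dist (xs i) x < r / 4} \<le> N1"
begin

definition nbr :: "'a \<Rightarrow> nat set" where "nbr x = {i. i < n \<and> dist (xs i) x < r / 4}"

text \<open>Turns a vector on the vertices into a function, so that volume arguments apply to it. It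
  jumps, which is why its energy is taken nonlocally.\<close>

definition avg :: "(nat \<Rightarrow> real) \<Rightarrow> 'a \<Rightarrow> real" where "avg v x = (\<Sum>i\<in>nbr x. v i) / card (nbr x)"

definition energy :: "(nat \<Rightarrow> real) \<Rightarrow> real" where
  "energy v = (\<Sum>i<n. \<Sum>j<n. of_bool (dist (xs i) (xs j) \<le> r) * (v i - v j)\<^sup>2)"

abbreviation "bl i \<equiv> ball (xs i) (r / 4)"

definition vb :: real where "vb = V * (r / 4) ^ DIM('a)"

lemma vb_pos: "0 < vb" using r V_pos by (simp add: vb_def)

lemma energy_nonneg: "0 \<le> energy v"
  by (simp add: energy_def sum_nonneg)

lemma nbr: "finite (nbr x)" "x \<in> X \<Longrightarrow> nbr x \<noteq> {}" "x \<in> X \<Longrightarrow> N0 \<le> card (nbr x)"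
  "x \<in> X \<Longrightarrow> card (nbr x) \<le> N1"
proof -
  show "nbr x \<noteq> {}" if "x \<in> X"
  proof
    assume "nbr x = {}"
    then have "{i. i < n \<and> dist (xs i) x < r / 4} = {}" by (simp add: nbr_def)
    with lower[OF that] N0_pos show False unfolding \<open>{i. i < n \<and> dist (xs i) x < r / 4} = {}\<close> by simp
  qed
qed (use lower[of x] upper[of x] in \<open>auto simp: nbr_def\<close>)

lemma sum_nbr: "(\<Sum>i\<in>nbr x. f i) = (\<Sum>i<n. f i * indicator (bl i) x)" for f :: "nat \<Rightarrow> real"
proof -
  have "(\<Sum>i\<in>nbr x. f i) = (\<Sum>i\<in>{i \<in> {..<n}. dist (xs i) x < r / 4}. f i)"
    by (intro sum.cong) (auto simp: nbr_def)
  also have "\<dots> = (\<Sum>i<n. if dist (xs i) x < r / 4 then f i else 0)"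
    by (rule sum.inter_filter) simp
  also have "\<dots> = (\<Sum>i<n. f i * indicator (bl i) x)"
    by (intro sum.cong) (auto simp: indicator_def)
  finally show ?thesis .
qed

lemma card_nbr: "real (card (nbr x)) = (\<Sum>i<n. indicator (bl i) x)"
  using sum_nbr[of "\<lambda>_. 1" x] by simp

lemma measurable_indicator_bl[measurable]: "indicat_real (bl i) \<in> borel_measurable borel"
  by (rule borel_measurable_indicator) simp

lemma measurable_card_nbr[measurable]: "(\<lambda>x. real (card (nbr x))) \<in> borel_measurable borel"
  unfolding card_nbr by (intro borel_measurable_sum borel_measurable_indicator) auto

lemma measurable_avg[measurable]: "avg v \<in> borel_measurable borel"
  unfolding avg_def sum_nbr
  by (intro borel_measurable_divide borel_measurable_sum borel_measurable_times borel_measurable_indicator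
      measurable_card_nbr) auto

lemma emeasure_bl: "emeasure lborel (bl i) = ennreal vb"
  using r measure_ball[of "r / 4" "xs i"]
  by (subst emeasure_eq_ennreal_measure) (auto simp: emeasure_bounded_less_top less_imp_neq vb_def)

lemma abs_avg_le: "\<bar>avg v x\<bar> \<le> (\<Sum>i<n. \<bar>v i\<bar>)"
proof (cases "nbr x = {}")
  case False
  have "\<bar>avg v x\<bar> = \<bar>\<Sum>i\<in>nbr x. v i\<bar> / card (nbr x)" by (simp add: avg_def)
  also have "\<dots> \<le> \<bar>\<Sum>i\<in>nbr x. v i\<bar> / 1"
    using False nbr(1) by (intro divide_left_mono) (auto simp: Suc_le_eq card_gt_0_iff)
  also have "\<dots> \<le> (\<Sum>i\<in>nbr x. \<bar>v i\<bar>)" by simp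
  also have "\<dots> \<le> (\<Sum>i<n. \<bar>v i\<bar>)" by (intro sum_mono2) (auto simp: nbr_def)
  finally show ?thesis .
qed (simp add: avg_def sum_nonneg)

text \<open>Jensen bounds the squared difference of two averages by a sum over pairs of vertices at
  distance at most \<open>r\<close>, with weight at most \<open>1 / N0^2\<close>. Integrating over
  \<open>x\<close> and over \<open>y\<close> gives each pair the factor \<open>vb\<close>
  twice.\<close>

lemma nonlocal_energy_avg:
  "nonlocal_energy X (r / 2) (avg v) \<le> ennreal ((vb / N0)\<^sup>2 * energy v)"
proof -
  define w where "w i j = of_bool (dist (xs i) (xs j) \<le> r) * (v i - v j)\<^sup>2 / N0\<^sup>2" for i j
  have w: "0 \<le> w i j" for i j by (simp add: w_def)
  have le: "of_bool (x \<in> X \<and> y \<in> X \<and> dist x y \<le> r / 2) * (avg v x - avg v y)\<^sup>2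
      \<le> (\<Sum>j<n. (\<Sum>i<n. w i j * indicator (bl i) x) * indicator (bl j) y)" for x y
  proof (cases "x \<in> X \<and> y \<in> X \<and> dist x y \<le> r / 2")
    case True
    have "(avg v x - avg v y)\<^sup>2 \<le> (\<Sum>i\<in>nbr x. \<Sum>j\<in>nbr y. (v i - v j)\<^sup>2) / (real (card (nbr x)) * real (card (nbr y)))"
      unfolding avg_def using nbr True by (intro mean_diff_squared_le) auto
    also have "\<dots> \<le> (\<Sum>i\<in>nbr x. \<Sum>j\<in>nbr y. (v i - v j)\<^sup>2) / N0\<^sup>2"
      unfolding power2_eq_square[of "N0"]
      using nbr[of x] nbr[of y] True N0_pos by (intro divide_left_mono mult_mono mult_pos_pos sum_nonneg) auto
    also have "\<dots> = (\<Sum>i\<in>nbr x. \<Sum>j\<in>nbr y. w i j)"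
    proof -
      have near: "dist (xs i) (xs j) \<le> r" if "i \<in> nbr x" "j \<in> nbr y" for i j
      proof -
        have "dist (xs i) (xs j) \<le> dist (xs i) x + dist x y + dist (xs j) y"
          using dist_triangle[of "xs i" "xs j" x] dist_triangle[of x "xs j" y] by (simp add: dist_commute)
        then show ?thesis using that True by (simp add: nbr_def)
      qed
      show ?thesis
        unfolding sum_divide_distrib by (intro sum.cong) (auto simp: w_def near)
    qed
    also have "\<dots> = (\<Sum>j<n. (\<Sum>i<n. w i j * indicator (bl i) x) * indicator (bl j) y)"
      by (subst sum.swap) (simp add: sum_nbr)
    finally show ?thesis using True by simp
  qed (auto intro!: sum_nonneg mult_nonneg_nonneg w)
  have "nonlocal_energy X (r / 2) (avg v)
     \<le> (\<integral>\<^sup>+x. \<integral>\<^sup>+y. ennreal (\<Sum>j<n. (\<Sum>i<n. w i j * indicator (bl i) x) * indicator (bl j) y) \<partial>lborel \<partial>lborel)"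
    unfolding nonlocal_energy_def by (intro nn_integral_mono ennreal_leI le)
  also have "\<dots> = (\<integral>\<^sup>+x. ennreal (\<Sum>i<n. (\<Sum>j<n. w i j * vb) * indicator (bl i) x) \<partial>lborel)"
  proof (rule nn_integral_cong)
    fix x
    have "(\<integral>\<^sup>+y. ennreal (\<Sum>j<n. (\<Sum>i<n. w i j * indicator (bl i) x) * indicator (bl j) y) \<partial>lborel)
      = ennreal (\<Sum>j<n. (\<Sum>i<n. w i j * indicator (bl i) x) * vb)"
      using vb_pos by (intro nn_integral_indicator_sum sum_nonneg mult_nonneg_nonneg w emeasure_bl) auto
    also have "(\<Sum>j<n. (\<Sum>i<n. w i j * indicator (bl i) x) * vb) = (\<Sum>i<n. (\<Sum>j<n. w i j * vb) * indicator (bl i) x)"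
      unfolding sum_distrib_right by (subst sum.swap) (simp add: mult_ac)
    finally show "(\<integral>\<^sup>+y. ennreal (\<Sum>j<n. (\<Sum>i<n. w i j * indicator (bl i) x) * indicator (bl j) y) \<partial>lborel)
      = ennreal (\<Sum>i<n. (\<Sum>j<n. w i j * vb) * indicator (bl i) x)" .
  qed
  also have "\<dots> = ennreal (\<Sum>i<n. (\<Sum>j<n. w i j * vb) * vb)"
    using vb_pos by (intro nn_integral_indicator_sum sum_nonneg mult_nonneg_nonneg w emeasure_bl) auto
  also have "(\<Sum>i<n. (\<Sum>j<n. w i j * vb) * vb) = (vb / N0)\<^sup>2 * energy v"
    unfolding energy_def sum_distrib_left sum_distrib_right w_def
    by (intro sum.cong refl) (simp add: power2_eq_square)
  finally show ?thesis .
qed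

text \<open>Each \<open>v i\<close> is spread over \<open>X \<inter> bl i\<close>, whose volume is
  bounded below even at the boundary, and compared there with \<open>avg v x\<close>. The deviation
  costs energy by Jensen; the square of the average is counted once for each of the at most
  \<open>N1\<close> vertices near \<open>x\<close>.\<close>

lemma square_norm_le_avg:
  "ennreal (cone_const * (r / 4) ^ DIM('a) * (\<Sum>i<n. (v i)\<^sup>2))
    \<le> ennreal (2 * vb / N0 * energy v)
      + ennreal (2 * N1) * (\<integral>\<^sup>+x. ennreal (of_bool (x \<in> X) * (avg v x)\<^sup>2) \<partial>lborel)"
proof -
  let ?F = "avg v"
  have sX[measurable]: "X \<in> sets borel" using open_X by simp
  have 1: "ennreal (cone_const * (r / 4) ^ DIM('a) * (v i)\<^sup>2)
     \<le> (\<integral>\<^sup>+x. ennreal (of_bool (x \<in> X) * ((v i)\<^sup>2 * indicator (bl i) x)) \<partial>lborel)" if "i < n" for i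
  proof -
    have fin: "emeasure lborel (X \<inter> bl i) < top"
      by (intro emeasure_bounded_less_top) (simp add: bounded_Int)
    have "cone_const * (r / 4) ^ DIM('a) \<le> measure lborel (X \<inter> bl i)"
      using r s0 by (intro volume_ge xs that) auto
    then have "ennreal (cone_const * (r / 4) ^ DIM('a) * (v i)\<^sup>2) \<le> ennreal ((v i)\<^sup>2 * measure lborel (X \<inter> bl i))"
      by (intro ennreal_leI) (subst mult.commute, intro mult_left_mono, auto)
    also have "\<dots> = ennreal ((v i)\<^sup>2) * emeasure lborel (X \<inter> bl i)"
      using fin by (subst emeasure_eq_ennreal_measure) (auto simp: ennreal_mult)
    also have "\<dots> = (\<integral>\<^sup>+x. ennreal ((v i)\<^sup>2) * indicator (X \<inter> bl i) x \<partial>lborel)"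
      by (rule nn_integral_cmult_indicator[symmetric]) simp
    also have "\<dots> = (\<integral>\<^sup>+x. ennreal (of_bool (x \<in> X) * ((v i)\<^sup>2 * indicator (bl i) x)) \<partial>lborel)"
      by (intro nn_integral_cong) (auto simp: indicator_def)
    finally show ?thesis .
  qed
  have 2: "of_bool (x \<in> X) * (\<Sum>i<n. (v i)\<^sup>2 * indicator (bl i) x)
     \<le> (\<Sum>i<n. (2 / N0 * (\<Sum>j<n. of_bool (dist (xs i) (xs j) \<le> r) * (v i - v j)\<^sup>2)) * indicator (bl i) x)
       + 2 * N1 * (of_bool (x \<in> X) * (?F x)\<^sup>2)" for x
  proof (cases "x \<in> X")
    case True
    have dev: "(v i - ?F x)\<^sup>2 \<le> 1 / N0 * (\<Sum>j<n. of_bool (dist (xs i) (xs j) \<le> r) * (v i - v j)\<^sup>2)"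
      if i: "i \<in> nbr x" for i
    proof -
      have "(v i - ?F x)\<^sup>2 \<le> (\<Sum>j\<in>nbr x. (v i - v j)\<^sup>2) / real (card (nbr x))"
        using mean_diff_squared_le[of "{i}" "nbr x" v] nbr[of x] True by (simp add: avg_def)
      also have "\<dots> \<le> (\<Sum>j\<in>nbr x. (v i - v j)\<^sup>2) / N0"
        using nbr[of x] True N0_pos by (intro divide_left_mono mult_pos_pos sum_nonneg) auto
      also have "(\<Sum>j\<in>nbr x. (v i - v j)\<^sup>2) = (\<Sum>j\<in>nbr x. of_bool (dist (xs i) (xs j) \<le> r) * (v i - v j)\<^sup>2)"
      proof (intro sum.cong refl)
        fix j assume "j \<in> nbr x"
        then have "dist (xs i) (xs j) \<le> r"
          using i dist_triangle[of "xs i" "xs j" x] r by (simp add: nbr_def dist_commute)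
        then show "(v i - v j)\<^sup>2 = of_bool (dist (xs i) (xs j) \<le> r) * (v i - v j)\<^sup>2" by simp
      qed
      also have "\<dots> \<le> (\<Sum>j<n. of_bool (dist (xs i) (xs j) \<le> r) * (v i - v j)\<^sup>2)"
        by (intro sum_mono2) (auto simp: nbr_def)
      finally show ?thesis using N0_pos by (simp add: divide_right_mono)
    qed
    have "(\<Sum>i<n. (v i)\<^sup>2 * indicator (bl i) x) = (\<Sum>i\<in>nbr x. (v i)\<^sup>2)" by (simp add: sum_nbr)
    also have "\<dots> \<le> (\<Sum>i\<in>nbr x. 2 * (v i - ?F x)\<^sup>2 + 2 * (?F x)\<^sup>2)"
    proof (rule sum_mono)
      fix i show "(v i)\<^sup>2 \<le> 2 * (v i - ?F x)\<^sup>2 + 2 * (?F x)\<^sup>2"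
        using square_diff_le[of "v i - ?F x" "- ?F x"] by simp
    qed
    also have "\<dots> = (\<Sum>i\<in>nbr x. 2 * (v i - ?F x)\<^sup>2) + card (nbr x) * (2 * (?F x)\<^sup>2)"
      by (simp add: sum.distrib)
    also have "\<dots> \<le> (\<Sum>i\<in>nbr x. 2 / N0 * (\<Sum>j<n. of_bool (dist (xs i) (xs j) \<le> r) * (v i - v j)\<^sup>2))
        + N1 * (2 * (?F x)\<^sup>2)"
      using nbr[of x] True by (intro add_mono sum_mono mult_right_mono) (auto dest: dev)
    finally show ?thesis using True by (simp add: sum_nbr mult_ac)
  qed (use N0_pos in \<open>auto intro!: sum_nonneg mult_nonneg_nonneg divide_nonneg_nonneg simp: less_imp_le\<close>)
  have "ennreal (cone_const * (r / 4) ^ DIM('a) * (\<Sum>i<n. (v i)\<^sup>2)) = (\<Sum>i<n. ennreal (cone_const * (r / 4) ^ DIM('a) * (v i)\<^sup>2))"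
    using cone_const_pos r by (subst sum_ennreal) (auto simp: sum_distrib_left intro!: mult_nonneg_nonneg)
  also have "\<dots> \<le> (\<Sum>i<n. (\<integral>\<^sup>+x. ennreal (of_bool (x \<in> X) * ((v i)\<^sup>2 * indicator (bl i) x)) \<partial>lborel))"
    by (intro sum_mono 1) simp
  also have "\<dots> = (\<integral>\<^sup>+x. ennreal (of_bool (x \<in> X) * (\<Sum>i<n. (v i)\<^sup>2 * indicator (bl i) x)) \<partial>lborel)"
    by (subst nn_integral_sum[symmetric], measurable) (auto simp: sum_distrib_left intro!: nn_integral_cong sum_ennreal)
  also have "\<dots> \<le> (\<integral>\<^sup>+x. ennreal (\<Sum>i<n. (2 / N0 * (\<Sum>j<n. of_bool (dist (xs i) (xs j) \<le> r) * (v i - v j)\<^sup>2)) * indicator (bl i) x)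
       + ennreal (2 * N1) * ennreal (of_bool (x \<in> X) * (?F x)\<^sup>2) \<partial>lborel)"
  proof (rule nn_integral_mono)
    fix x
    show "ennreal (of_bool (x \<in> X) * (\<Sum>i<n. (v i)\<^sup>2 * indicator (bl i) x))
      \<le> ennreal (\<Sum>i<n. (2 / N0 * (\<Sum>j<n. of_bool (dist (xs i) (xs j) \<le> r) * (v i - v j)\<^sup>2)) * indicator (bl i) x)
       + ennreal (2 * N1) * ennreal (of_bool (x \<in> X) * (?F x)\<^sup>2)"
      using ennreal_leI[OF 2[of x]] N1_nonneg r N0_pos
      by (subst (asm) ennreal_plus)
         (auto intro!: sum_nonneg mult_nonneg_nonneg divide_nonneg_nonneg simp: less_imp_le ennreal_mult simp del: ennreal_plus)
  qed
  also have "\<dots> = (\<integral>\<^sup>+x. ennreal (\<Sum>i<n. (2 / N0 * (\<Sum>j<n. of_bool (dist (xs i) (xs j) \<le> r) * (v i - v j)\<^sup>2)) * indicator (bl i) x) \<partial>lborel)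
       + ennreal (2 * N1) * (\<integral>\<^sup>+x. ennreal (of_bool (x \<in> X) * (?F x)\<^sup>2) \<partial>lborel)"
    by (subst nn_integral_add, measurable, subst nn_integral_cmult, measurable)
  also have "(\<integral>\<^sup>+x. ennreal (\<Sum>i<n. (2 / N0 * (\<Sum>j<n. of_bool (dist (xs i) (xs j) \<le> r) * (v i - v j)\<^sup>2)) * indicator (bl i) x) \<partial>lborel)
      = ennreal (\<Sum>i<n. (2 / N0 * (\<Sum>j<n. of_bool (dist (xs i) (xs j) \<le> r) * (v i - v j)\<^sup>2)) * vb)"
    using vb_pos N0_pos
    by (intro nn_integral_indicator_sum sum_nonneg mult_nonneg_nonneg divide_nonneg_nonneg emeasure_bl) (auto simp: less_imp_le)
  also have "(\<Sum>i<n. (2 / N0 * (\<Sum>j<n. of_bool (dist (xs i) (xs j) \<le> r) * (v i - v j)\<^sup>2)) * vb) = 2 * vb / N0 * energy v"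
    unfolding energy_def sum_distrib_left by (intro sum.cong refl) (simp add: sum_distrib_left mult_ac)
  finally show ?thesis .
qed

end

section \<open>Cells, pivot balls and coarse functionals\<close>

lemma ball_in_sets_borel[measurable]: "ball c R \<in> sets borel"
  by simp

context lipschitz_domain
begin

abbreviation piv :: "real \<Rightarrow> 'a \<Rightarrow> 'a set" where "piv s z \<equiv> ball (pivot s z) s"

abbreviation cell :: "real \<Rightarrow> 'a \<Rightarrow> 'a set" where "cell s z \<equiv> X \<inter> ball z (2 * s)"

abbreviation cell' :: "real \<Rightarrow> 'a \<Rightarrow> 'a set" where "cell' s z \<equiv> X \<inter> ball z ((\<kappa> + 2) * s)"

text \<open>Points of the pivot ball are within \<open>(\<kappa> + 1) s\<close> of \<open>z\<close>
  and points of the cell within \<open>2 s\<close>, so both lie in the convex ball of radius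
  \<open>(\<kappa> + 2) s\<close>; visibility from the cell keeps the segment in
  \<open>X\<close>.\<close>

lemma cell_path:
  assumes z: "z \<in> X" "0 < s" "s \<le> s0" and x: "x \<in> cell s z" and q: "q \<in> piv s z"
  shows "0 \<le> t \<Longrightarrow> t \<le> 1 \<Longrightarrow> x + t *\<^sub>R (q - x) \<in> cell' s z" and "dist x q \<le> (\<kappa> + 3) * s"
proof -
  have zq: "dist z q < (\<kappa> + 1) * s"
    using dist_triangle[of z q "pivot s z"] dist_pivot[OF z] q by (simp add: algebra_simps)
  show "dist x q \<le> (\<kappa> + 3) * s"
    using zq x dist_triangle[of x q z] by (simp add: dist_commute algebra_simps)
  assume t: "0 \<le> t" "t \<le> 1"
  have "x + t *\<^sub>R (q - x) = (1 - t) *\<^sub>R x + t *\<^sub>R q" by (simp add: algebra_simps)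
  then have seg: "x + t *\<^sub>R (q - x) \<in> closed_segment x q"
    using t by (auto simp: closed_segment_def)
  have "2 * s \<le> (\<kappa> + 2) * s" "(\<kappa> + 1) * s \<le> (\<kappa> + 2) * s"
    using z \<kappa> by (auto intro!: mult_right_mono)
  then have "x \<in> ball z ((\<kappa> + 2) * s)" "q \<in> ball z ((\<kappa> + 2) * s)"
    using zq x unfolding mem_ball Int_iff by linarith+
  then have "closed_segment x q \<subseteq> ball z ((\<kappa> + 2) * s)"
    by (intro closed_segment_subset convex_ball)
  moreover have "closed_segment x q \<subseteq> X"
    using x q by (intro segment_pivot[OF z]) auto
  ultimately show "x + t *\<^sub>R (q - x) \<in> cell' s z" using seg by auto
qed

end

context graph_sample
begin

text \<open>The vector representing the functional that sends \<open>v\<close> to the mean of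
  \<open>avg v\<close> over the pivot ball, as \<open>ip_coarse\<close> shows. These functionals are
  the finitely many directions that the energy does not control.\<close>

definition coarse :: "real \<Rightarrow> 'a \<Rightarrow> nat \<Rightarrow> real" where
  "coarse s z i = (LINT q:piv s z|lborel. indicator (bl i) q / card (nbr q)) / measure lborel (piv s z)"

lemma integrable_on_piv:
  fixes f :: "'a \<Rightarrow> real"
  assumes "f \<in> borel_measurable borel" "\<And>q. \<bar>f q\<bar> \<le> B"
  shows "set_integrable lborel (piv s z) f"
  unfolding set_integrable_def
  by (rule integrableI_bounded_set_indicator[where B=B])
     (use assms in \<open>auto simp: emeasure_bounded_less_top\<close>)

lemma measurable_coarse_kernel[measurable]: "(\<lambda>q. indicat_real (bl i) q / card (nbr q)) \<in> borel_measurable borel"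
  by measurable

lemma coarse_kernel_bounds: "0 \<le> indicat_real (bl i) q / card (nbr q)" "indicat_real (bl i) q / card (nbr q) \<le> 1"
proof -
  show "indicat_real (bl i) q / card (nbr q) \<le> 1"
  proof (cases "card (nbr q) = 0")
    case False
    then have "indicat_real (bl i) q \<le> real (card (nbr q))"
      by (auto simp: indicator_def)
    then show ?thesis using False by simp
  qed simp
qed simp

lemma integrable_coarse_kernel: "set_integrable lborel (piv s z) (\<lambda>q. indicat_real (bl i) q / card (nbr q))"
  by (rule integrable_on_piv[where B=1]) (use coarse_kernel_bounds[of i] in \<open>auto simp: abs_le_iff intro: order_trans[of _ 0]\<close>)

lemma ip_coarse: "(LINT q:piv s z|lborel. avg v q) / measure lborel (piv s z) = ip n v (coarse s z)"
proof -
  have "avg v q = (\<Sum>i<n. v i * (indicator (bl i) q / card (nbr q)))" for q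
    unfolding avg_def sum_nbr sum_divide_distrib by (simp only: times_divide_eq_right)
  then have "(LINT q:piv s z|lborel. avg v q)
      = (LINT q|lborel. (\<Sum>i<n. v i * (indicator (piv s z) q *\<^sub>R (indicator (bl i) q / card (nbr q)))))"
    unfolding set_lebesgue_integral_def
    by (intro Bochner_Integration.integral_cong) (auto simp: sum_distrib_left mult_ac)
  also have "\<dots> = (\<Sum>i<n. LINT q|lborel. v i * (indicator (piv s z) q *\<^sub>R (indicator (bl i) q / card (nbr q))))"
    using integrable_coarse_kernel[of s z] unfolding set_integrable_def
    by (intro Bochner_Integration.integral_sum integrable_mult_right)
  finally have "(LINT q:piv s z|lborel. avg v q)
      = (\<Sum>i<n. LINT q|lborel. v i * (indicator (piv s z) q *\<^sub>R (indicator (bl i) q / card (nbr q))))" .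
  then show ?thesis
    unfolding ip_def coarse_def set_lebesgue_integral_def integral_mult_right_zero
    by (simp add: sum_divide_distrib)
qed

lemma measure_piv: "0 \<le> s \<Longrightarrow> measure lborel (piv s z) = V * s ^ DIM('a)"
  by (rule measure_ball)

lemma coarse_nonneg: "0 \<le> coarse s z i"
  unfolding coarse_def set_lebesgue_integral_def
  by (intro divide_nonneg_nonneg integral_nonneg) auto

lemma coarse_le:
  assumes "z \<in> X" "0 < s" "s \<le> s0"
  shows "coarse s z i \<le> vb / N0 / (V * s ^ DIM('a))"
proof -
  have "(LINT q:piv s z|lborel. indicator (bl i) q / card (nbr q)) \<le> (LINT q|lborel. indicator (bl i) q / N0)"
    unfolding set_lebesgue_integral_def
  proof (rule integral_mono)
    show "integrable lborel (\<lambda>q. indicat_real (bl i) q / N0)"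
      using emeasure_bl[of i] by (intro integrable_divide integrable_real_indicator) auto
    fix q
    show "indicat_real (piv s z) q *\<^sub>R (indicator (bl i) q / real (card (nbr q))) \<le> indicator (bl i) q / N0"
    proof (cases "q \<in> piv s z \<and> q \<in> bl i")
      case True
      then have "q \<in> X" using ball_pivot[OF assms] by auto
      then show ?thesis
        using True nbr(3)[of q] N0_pos by (simp add: frac_le)
    qed (use N0_pos in \<open>auto simp: indicator_def\<close>)
  qed (use integrable_coarse_kernel in \<open>simp add: set_integrable_def\<close>)
  also have "\<dots> = vb / N0"
    using emeasure_bl[of i] vb_pos by (simp add: measure_def)
  finally show ?thesis
    unfolding coarse_def measure_piv[OF less_imp_le[OF assms(2)]]
    by (rule divide_right_mono) (use assms V_pos in auto)
qed

lemma sum_coarse: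
  assumes "z \<in> X" "0 < s" "s \<le> s0"
  shows "(\<Sum>i<n. coarse s z i) = 1"
proof -
  have "avg (\<lambda>_. 1) q = 1" if "q \<in> piv s z" for q
    using nbr[of q] ball_pivot[OF assms] that by (auto simp: avg_def)
  then have "(LINT q:piv s z|lborel. avg (\<lambda>_. 1) q) = (LINT q:piv s z|lborel. 1)"
    by (intro set_lebesgue_integral_cong) auto
  also have "\<dots> = measure lborel (piv s z)"
    by (simp add: set_lebesgue_integral_def)
  finally show ?thesis
    using ip_coarse[where v="\<lambda>_. 1" and s=s and z=z] assms V_pos by (simp add: ip_def measure_piv)
qed

text \<open>\<open>coarse s z\<close> is a probability vector, so its squared norm is at most its
  largest entry. That entry is of order \<open>1 / (n s ^ d)\<close> once \<open>N0\<close> is of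
  order \<open>n r ^ d\<close>, with \<open>d\<close> the dimension.\<close>

lemma sum_coarse_squared:
  assumes "z \<in> X" "0 < s" "s \<le> s0"
  shows "(\<Sum>i<n. (coarse s z i)\<^sup>2) \<le> vb / N0 / (V * s ^ DIM('a))"
proof -
  have "(\<Sum>i<n. (coarse s z i)\<^sup>2) \<le> (\<Sum>i<n. vb / N0 / (V * s ^ DIM('a)) * coarse s z i)"
    unfolding power2_eq_square by (intro sum_mono mult_right_mono coarse_le assms coarse_nonneg)
  then show ?thesis
    unfolding sum_distrib_left[symmetric] sum_coarse[OF assms] by simp
qed

text \<open>\<open>avg v\<close> is split into its mean over the pivot ball and the deviation from
  it. Jensen turns the deviation into an average over paths to the pivot ball, cut into
  \<open>m\<close> steps of length at most \<open>r / 2\<close>, the range that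
  \<open>nonlocal_energy_avg\<close> can handle.\<close>

lemma cell_energy:
  assumes z: "z \<in> X" "0 < s" "s \<le> s0" and m: "0 < m" "(\<kappa> + 3) * s \<le> real m * (r / 2)"
  shows "(\<integral>\<^sup>+x. ennreal (of_bool (x \<in> cell s z) * (avg v x)\<^sup>2) \<partial>lborel)
    \<le> ennreal (2 * V * (2 * s) ^ DIM('a) * (ip n v (coarse s z))\<^sup>2)
      + ennreal (2 * real m ^ (DIM('a) + 2) / (V * s ^ DIM('a))) * nonlocal_energy (cell' s z) (r / 2) (avg v)"
proof -
  let ?F = "avg v" and ?Q = "piv s z"
  define c where "c = ip n v (coarse s z)"
  define vQ where "vQ = V * s ^ DIM('a)"
  have [measurable]: "X \<in> sets borel" using open_X by simp
  have mQ: "measure lborel ?Q = vQ" and vQ: "0 < vQ" using z V_pos by (simp_all add: measure_piv vQ_def)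
  let ?J = "\<lambda>x. \<integral>\<^sup>+q. ennreal (of_bool (x \<in> cell s z \<and> q \<in> ?Q) * (?F x - ?F q)\<^sup>2) \<partial>lborel"
  let ?B = "\<Sum>i<n. \<bar>v i\<bar>"
  have int2: "set_integrable lborel ?Q (\<lambda>q. (a - ?F q)\<^sup>2)" for a
  proof (rule integrable_on_piv[where B="(\<bar>a\<bar> + ?B)\<^sup>2"])
    fix q
    have "\<bar>a - ?F q\<bar> \<le> \<bar>a\<bar> + ?B" using abs_avg_le[of v q] by linarith
    then have "\<bar>a - ?F q\<bar>\<^sup>2 \<le> (\<bar>a\<bar> + ?B)\<^sup>2" by (rule power_mono) simp
    then show "\<bar>(a - ?F q)\<^sup>2\<bar> \<le> (\<bar>a\<bar> + ?B)\<^sup>2" by simp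
  qed measurable
  have pw: "ennreal (of_bool (x \<in> cell s z) * (?F x)\<^sup>2)
     \<le> ennreal (2 * c\<^sup>2) * indicator (ball z (2 * s)) x + ennreal (2 / vQ) * ?J x" for x
  proof (cases "x \<in> cell s z")
    case True
    have "ennreal (measure lborel ?Q * (?F x - (LINT q:?Q|lborel. ?F q) / measure lborel ?Q)\<^sup>2)
       \<le> (\<integral>\<^sup>+q. ennreal (of_bool (q \<in> ?Q) * (?F x - ?F q)\<^sup>2) \<partial>lborel)"
      using vQ abs_avg_le
      by (intro variance_le_pivot_integral integrable_on_piv[where B="?B"] int2)
         (auto simp: mQ emeasure_bounded_less_top)
    then have var: "ennreal (vQ * (?F x - c)\<^sup>2) \<le> ?J x"
      using True ip_coarse[of s z v] unfolding mQ c_def by simp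
    have "(?F x)\<^sup>2 \<le> 2 * c\<^sup>2 + (2 / vQ) * (vQ * (?F x - c)\<^sup>2)"
      using square_diff_le[of "?F x - c" "- c"] vQ by simp
    then have "ennreal ((?F x)\<^sup>2) \<le> ennreal (2 * c\<^sup>2 + (2 / vQ) * (vQ * (?F x - c)\<^sup>2))"
      by (rule ennreal_leI)
    also have "\<dots> = ennreal (2 * c\<^sup>2) + ennreal (2 / vQ) * ennreal (vQ * (?F x - c)\<^sup>2)"
      using vQ by (subst ennreal_plus) (auto simp: ennreal_mult[symmetric])
    also have "\<dots> \<le> ennreal (2 * c\<^sup>2) + ennreal (2 / vQ) * ?J x"
      by (intro add_left_mono mult_left_mono var) simp
    finally show ?thesis using True by simp
  qed auto
  have "(\<integral>\<^sup>+x. ennreal (of_bool (x \<in> cell s z) * (?F x)\<^sup>2) \<partial>lborel)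
    \<le> (\<integral>\<^sup>+x. ennreal (2 * c\<^sup>2) * indicator (ball z (2 * s)) x + ennreal (2 / vQ) * ?J x \<partial>lborel)"
    by (intro nn_integral_mono pw)
  also have "\<dots> = ennreal (2 * c\<^sup>2) * emeasure lborel (ball z (2 * s)) + ennreal (2 / vQ) * (\<integral>\<^sup>+x. ?J x \<partial>lborel)"
    by (subst nn_integral_add, measurable, subst nn_integral_cmult, measurable, subst nn_integral_cmult_indicator) auto
  also have "emeasure lborel (ball z (2 * s)) = ennreal (V * (2 * s) ^ DIM('a))"
    using z measure_ball[of "2 * s" z]
    by (subst emeasure_eq_ennreal_measure) (auto simp: emeasure_bounded_less_top less_imp_neq)
  also have "ennreal (2 * c\<^sup>2) * ennreal (V * (2 * s) ^ DIM('a)) = ennreal (2 * V * (2 * s) ^ DIM('a) * c\<^sup>2)"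
    using V_pos z by (subst ennreal_mult[symmetric]) (auto simp: mult_ac)
  also have "(\<integral>\<^sup>+x. ?J x \<partial>lborel) \<le> ennreal (real m ^ (DIM('a) + 2)) * nonlocal_energy (cell' s z) (r / 2) ?F"
  proof (rule nonlocal_path_inequality)
    show "dist x q \<le> real m * (r / 2)" if "x \<in> cell s z" "q \<in> ?Q" for x q
      using cell_path(2)[OF z that] m by linarith
  qed (use cell_path(1)[OF z] m open_X in auto)
  finally have "(\<integral>\<^sup>+x. ennreal (of_bool (x \<in> cell s z) * (?F x)\<^sup>2) \<partial>lborel)
    \<le> ennreal (2 * V * (2 * s) ^ DIM('a) * c\<^sup>2) + ennreal (2 / vQ) * (ennreal (real m ^ (DIM('a) + 2)) * nonlocal_energy (cell' s z) (r / 2) ?F)"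
    by (simp add: mult_left_mono)
  also have "ennreal (2 / vQ) * (ennreal (real m ^ (DIM('a) + 2)) * nonlocal_energy (cell' s z) (r / 2) ?F)
      = ennreal (2 * real m ^ (DIM('a) + 2) / vQ) * nonlocal_energy (cell' s z) (r / 2) ?F"
    using vQ by (subst mult.assoc[symmetric], subst ennreal_mult[symmetric]) auto
  finally show ?thesis by (simp add: c_def vQ_def)
qed

text \<open>Enlarged cells have radius \<open>(\<kappa> + 2) s\<close>, so at every scale a point
  lies in at most \<open>(2 * \<kappa> + 5) ^ DIM('a)\<close> of them.\<close>

lemma sum_nonlocal_energy_cells:
  assumes Z: "finite Z" "separated s Z" "0 < s" and [measurable]: "F \<in> borel_measurable borel"
  shows "(\<Sum>z\<in>Z. nonlocal_energy (cell' s z) \<rho> F) \<le> ennreal ((2 * \<kappa> + 5) ^ DIM('a)) * nonlocal_energy X \<rho> F"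
proof -
  have [measurable]: "X \<in> sets borel" using open_X by simp
  have "(\<Sum>z\<in>Z. nonlocal_energy (cell' s z) \<rho> F)
    = (\<integral>\<^sup>+x. \<integral>\<^sup>+y. (\<Sum>z\<in>Z. ennreal (of_bool (x \<in> cell' s z \<and> y \<in> cell' s z \<and> dist x y \<le> \<rho>) * (F x - F y)\<^sup>2)) \<partial>lborel \<partial>lborel)"
    unfolding nonlocal_energy_def
    by (subst nn_integral_sum[symmetric], measurable) (intro nn_integral_cong nn_integral_sum[symmetric], measurable)
  also have "\<dots> \<le> (\<integral>\<^sup>+x. \<integral>\<^sup>+y. ennreal ((2 * \<kappa> + 5) ^ DIM('a)) * ennreal (of_bool (x \<in> X \<and> y \<in> X \<and> dist x y \<le> \<rho>) * (F x - F y)\<^sup>2) \<partial>lborel \<partial>lborel)"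
  proof (intro nn_integral_mono)
    fix x y
    have "(\<Sum>z\<in>Z. of_bool (x \<in> cell' s z \<and> y \<in> cell' s z \<and> dist x y \<le> \<rho>) * (F x - F y)\<^sup>2)
      \<le> (\<Sum>z\<in>Z. of_bool (dist z x < (\<kappa> + 2) * s) * (of_bool (x \<in> X \<and> y \<in> X \<and> dist x y \<le> \<rho>) * (F x - F y)\<^sup>2))"
      by (intro sum_mono) auto
    also have "\<dots> = card {z \<in> Z. dist z x < (\<kappa> + 2) * s} * (of_bool (x \<in> X \<and> y \<in> X \<and> dist x y \<le> \<rho>) * (F x - F y)\<^sup>2)"
      using Z(1) by (simp add: sum_distrib_right[symmetric] Int_def conj_commute)
    also have "\<dots> \<le> (2 * \<kappa> + 5) ^ DIM('a) * (of_bool (x \<in> X \<and> y \<in> X \<and> dist x y \<le> \<rho>) * (F x - F y)\<^sup>2)"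
      using card_separated_ball_le[OF Z, of "\<kappa> + 2" x] \<kappa> by (intro mult_right_mono) (auto simp: algebra_simps)
    finally show "(\<Sum>z\<in>Z. ennreal (of_bool (x \<in> cell' s z \<and> y \<in> cell' s z \<and> dist x y \<le> \<rho>) * (F x - F y)\<^sup>2))
      \<le> ennreal ((2 * \<kappa> + 5) ^ DIM('a)) * ennreal (of_bool (x \<in> X \<and> y \<in> X \<and> dist x y \<le> \<rho>) * (F x - F y)\<^sup>2)"
      using \<kappa> by (subst sum_ennreal) (auto simp: ennreal_mult[symmetric] intro!: ennreal_leI)
  qed
  also have "\<dots> = ennreal ((2 * \<kappa> + 5) ^ DIM('a)) * nonlocal_energy X \<rho> F"
    unfolding nonlocal_energy_def
    by (subst nn_integral_cmult, measurable, subst nn_integral_cmult, measurable)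
  finally show ?thesis .
qed

text \<open>The cell estimates are summed over a net and inserted into
  \<open>square_norm_le_avg\<close>. Crossing a cell takes \<open>m\<close> of order
  \<open>s / r\<close> steps, and \<open>m ^ (d + 2) / s ^ d\<close> is of order
  \<open>(s / r)^2 / r ^ d\<close>; this is the origin of the factor \<open>(s / r)^2\<close>, the
  usual scaling of a Poincare constant. \<open>K\<close> undoes the volume factor in front of the
  squared norm.\<close>

lemma discrete_poincare:
  assumes s: "r \<le> s" "s \<le> s0"
  defines "K \<equiv> 4 ^ DIM('a) / (cone_const * r ^ DIM('a))"
  defines "A \<equiv> 2 * vb / N0 + 4 * N1 * (2 * \<kappa> + 7) ^ (DIM('a) + 2) * (2 * \<kappa> + 5) ^ DIM('a) * (vb / N0)\<^sup>2 / (V * r ^ DIM('a))"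
  obtains Z :: "'a set" and U where "finite Z" "real (card Z) \<le> 2 ^ DIM('a) * measure lborel X / cone_const / s ^ DIM('a)"
    "\<And>z. z \<in> Z \<Longrightarrow> (\<Sum>i<n. (U z i)\<^sup>2) \<le> K * 4 * N1 * 2 ^ DIM('a) * vb / N0"
    "\<And>v. (\<Sum>i<n. (v i)\<^sup>2) \<le> (\<Sum>z\<in>Z. (ip n v (U z))\<^sup>2) + K * A * (s / r)\<^sup>2 * energy v"
proof -
  have s_pos: "0 < s" using s r by simp
  obtain Z where Z: "finite Z" "Z \<subseteq> X" "separated s Z" "\<And>x. x \<in> X \<Longrightarrow> \<exists>z\<in>Z. dist z x < s"
    and cardZ: "real (card Z) \<le> 2 ^ DIM('a) * measure lborel X / cone_const / s ^ DIM('a)"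
    using ex_net[OF s_pos s(2)] by metis
  \<comment> \<open>The number of steps of length \<open>r / 2\<close> that cover the distance
    \<open>(\<kappa> + 3) s\<close>.\<close>
  define m where "m = nat \<lceil>2 * (\<kappa> + 3) * s / r\<rceil>"
  have arg: "0 < 2 * (\<kappa> + 3) * s / r" using \<kappa> s_pos r by simp
  then have m: "0 < m" "2 * (\<kappa> + 3) * s / r \<le> real m" "real m \<le> 2 * (\<kappa> + 3) * s / r + 1"
    unfolding m_def by linarith+
  have m1: "(\<kappa> + 3) * s \<le> real m * (r / 2)" using m(2) r by (simp add: field_simps)
  \<comment> \<open>As \<open>r \<le> s\<close>, the rounding up is absorbed into the constant:
    \<open>2 * (\<kappa> + 3) + 1\<close>.\<close>
  have m2: "real m \<le> (2 * \<kappa> + 7) * (s / r)"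
  proof -
    have "1 \<le> s / r" using s r by simp
    moreover have "2 * (\<kappa> + 3) * s / r + s / r = (2 * \<kappa> + 7) * (s / r)"
      by (simp add: algebra_simps add_divide_distrib[symmetric])
    ultimately show ?thesis using m(3) by linarith
  qed
  have K: "0 < K" using cone_const_pos r by (simp add: K_def)
  \<comment> \<open>Chosen so that the mean terms of the cells, multiplied by \<open>K\<close> and
    \<open>2 * N1\<close>, become squared inner products with \<open>U z\<close>.\<close>
  define b where "b = K * 4 * N1 * V * (2 * s) ^ DIM('a)"
  have b: "0 \<le> b" using K N1_nonneg V_pos s_pos by (simp add: b_def)
  define U where "U z i = sqrt b * coarse s z i" for z i
  have U2: "(\<Sum>i<n. (U z i)\<^sup>2) \<le> K * 4 * N1 * 2 ^ DIM('a) * vb / N0" if "z \<in> Z" for z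
  proof -
    have "(\<Sum>i<n. (U z i)\<^sup>2) = b * (\<Sum>i<n. (coarse s z i)\<^sup>2)"
      using b by (simp add: U_def power_mult_distrib sum_distrib_left)
    also have "\<dots> \<le> b * (vb / N0 / (V * s ^ DIM('a)))"
      using that Z(2) b s s_pos by (intro mult_left_mono sum_coarse_squared) auto
    also have "\<dots> = K * 4 * N1 * 2 ^ DIM('a) * vb / N0"
      using V_pos s_pos by (simp add: b_def power_mult_distrib)
    finally show ?thesis .
  qed
  have P: "(\<Sum>i<n. (v i)\<^sup>2) \<le> (\<Sum>z\<in>Z. (ip n v (U z))\<^sup>2) + K * A * (s / r)\<^sup>2 * energy v" for v
  proof -
    let ?F = "avg v"
    have [measurable]: "X \<in> sets borel" using open_X by simp
    define p where "p = 2 * real m ^ (DIM('a) + 2) / (V * s ^ DIM('a))"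
    have p: "0 \<le> p" using V_pos s_pos by (simp add: p_def)
    define S where "S = (\<Sum>z\<in>Z. 2 * V * (2 * s) ^ DIM('a) * (ip n v (coarse s z))\<^sup>2)"
    define R where "R = p * ((2 * \<kappa> + 5) ^ DIM('a) * ((vb / N0)\<^sup>2 * energy v))"
    have S: "0 \<le> S" using V_pos s_pos by (auto simp: S_def intro!: sum_nonneg mult_nonneg_nonneg)
    have R: "0 \<le> R" using p \<kappa> energy_nonneg[of v] by (auto simp: R_def intro!: mult_nonneg_nonneg)
    have "(\<integral>\<^sup>+x. ennreal (of_bool (x \<in> X) * (?F x)\<^sup>2) \<partial>lborel)
      \<le> (\<integral>\<^sup>+x. (\<Sum>z\<in>Z. ennreal (of_bool (x \<in> cell s z) * (?F x)\<^sup>2)) \<partial>lborel)"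
    proof (rule nn_integral_mono)
      fix x
      show "ennreal (of_bool (x \<in> X) * (?F x)\<^sup>2) \<le> (\<Sum>z\<in>Z. ennreal (of_bool (x \<in> cell s z) * (?F x)\<^sup>2))"
      proof (cases "x \<in> X")
        case True
        then obtain z where z: "z \<in> Z" "dist z x < s" using Z(4) by blast
        then have "ennreal (of_bool (x \<in> X) * (?F x)\<^sup>2) = ennreal (of_bool (x \<in> cell s z) * (?F x)\<^sup>2)"
          using True s_pos by simp
        also have "\<dots> \<le> (\<Sum>z\<in>Z. ennreal (of_bool (x \<in> cell s z) * (?F x)\<^sup>2))"
          using z(1) Z(1) by (intro member_le_sum) auto
        finally show ?thesis .
      qed simp
    qed
    also have "\<dots> = (\<Sum>z\<in>Z. \<integral>\<^sup>+x. ennreal (of_bool (x \<in> cell s z) * (?F x)\<^sup>2) \<partial>lborel)"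
      by (rule nn_integral_sum) measurable
    also have "\<dots> \<le> (\<Sum>z\<in>Z. ennreal (2 * V * (2 * s) ^ DIM('a) * (ip n v (coarse s z))\<^sup>2)
        + ennreal p * nonlocal_energy (cell' s z) (r / 2) ?F)"
      unfolding p_def using Z(2) s s_pos m m1 by (intro sum_mono cell_energy) auto
    also have "\<dots> = ennreal S + ennreal p * (\<Sum>z\<in>Z. nonlocal_energy (cell' s z) (r / 2) ?F)"
      unfolding S_def using V_pos s_pos by (subst sum_ennreal[symmetric]) (auto simp: sum.distrib sum_distrib_left)
    also have "\<dots> \<le> ennreal S + ennreal p * (ennreal ((2 * \<kappa> + 5) ^ DIM('a)) * ennreal ((vb / N0)\<^sup>2 * energy v))"
      by (intro add_left_mono mult_left_mono order_trans[OF sum_nonlocal_energy_cells[OF Z(1,3) s_pos]] nonlocal_energy_avg) auto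
    also have "\<dots> = ennreal (S + R)"
      using S R p \<kappa> energy_nonneg[of v] by (simp add: R_def ennreal_mult)
    finally have X: "(\<integral>\<^sup>+x. ennreal (of_bool (x \<in> X) * (?F x)\<^sup>2) \<partial>lborel) \<le> ennreal (S + R)" .
    have "ennreal (cone_const * (r / 4) ^ DIM('a) * (\<Sum>i<n. (v i)\<^sup>2))
      \<le> ennreal (2 * vb / N0 * energy v) + ennreal (2 * N1) * ennreal (S + R)"
      by (rule order_trans[OF square_norm_le_avg]) (intro add_left_mono mult_left_mono X, simp)
    also have "\<dots> = ennreal (2 * vb / N0 * energy v + 2 * N1 * (S + R))"
      using S R N1_nonneg vb_pos N0_pos energy_nonneg[of v] by (simp add: ennreal_mult)
    finally have "cone_const * (r / 4) ^ DIM('a) * (\<Sum>i<n. (v i)\<^sup>2) \<le> 2 * vb / N0 * energy v + 2 * N1 * (S + R)"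
      using S R N1_nonneg vb_pos N0_pos energy_nonneg[of v] by (subst (asm) ennreal_le_iff) auto
    then have "K * (cone_const * (r / 4) ^ DIM('a) * (\<Sum>i<n. (v i)\<^sup>2)) \<le> K * (2 * vb / N0 * energy v + 2 * N1 * (S + R))"
      using K by (intro mult_left_mono) auto
    moreover have "K * (cone_const * (r / 4) ^ DIM('a) * (\<Sum>i<n. (v i)\<^sup>2)) = (\<Sum>i<n. (v i)\<^sup>2)"
      using cone_const_pos r by (simp add: K_def power_divide)
    moreover have "K * (2 * N1 * S) = (\<Sum>z\<in>Z. (ip n v (U z))\<^sup>2)"
    proof -
      have "ip n v (U z) = sqrt b * ip n v (coarse s z)" for z
        by (simp add: ip_def U_def sum_distrib_left mult_ac)
      then have "(ip n v (U z))\<^sup>2 = b * (ip n v (coarse s z))\<^sup>2" for z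
        using b by (simp add: power_mult_distrib)
      then show ?thesis by (simp add: S_def b_def sum_distrib_left mult_ac)
    qed
    moreover have "2 * vb / N0 * energy v + 2 * N1 * R \<le> A * (s / r)\<^sup>2 * energy v"
    proof -
      have alg: "(x + 4 * N1 * a * b * t / w) * q * e = x * q * e + 2 * N1 * (2 * a * q / w * (b * (t * e)))"
        for x a b t w q e :: real by (simp add: algebra_simps)
      have sr: "1 \<le> s / r" using s r by simp
      have "real m ^ (DIM('a) + 2) \<le> ((2 * \<kappa> + 7) * (s / r)) ^ (DIM('a) + 2)"
        using m2 by (intro power_mono) auto
      also have "\<dots> = (2 * \<kappa> + 7) ^ (DIM('a) + 2) * (s / r)\<^sup>2 * s ^ DIM('a) / r ^ DIM('a)"
        by (simp add: power_mult_distrib power_add power_divide power2_eq_square mult_ac)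
      finally have "p \<le> 2 * ((2 * \<kappa> + 7) ^ (DIM('a) + 2) * (s / r)\<^sup>2 * s ^ DIM('a) / r ^ DIM('a)) / (V * s ^ DIM('a))"
        unfolding p_def using V_pos s_pos by (intro divide_right_mono mult_left_mono) auto
      also have "\<dots> = 2 * (2 * \<kappa> + 7) ^ (DIM('a) + 2) * (s / r)\<^sup>2 / (V * r ^ DIM('a))"
        using s_pos by (simp add: mult_ac)
      finally have pp: "p \<le> 2 * (2 * \<kappa> + 7) ^ (DIM('a) + 2) * (s / r)\<^sup>2 / (V * r ^ DIM('a))" .
      have "2 * N1 * R \<le> 2 * N1 * (2 * (2 * \<kappa> + 7) ^ (DIM('a) + 2) * (s / r)\<^sup>2 / (V * r ^ DIM('a)) * ((2 * \<kappa> + 5) ^ DIM('a) * ((vb / N0)\<^sup>2 * energy v)))"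
        unfolding R_def using N1_nonneg \<kappa> energy_nonneg[of v] by (intro mult_left_mono mult_right_mono pp) auto
      moreover have "2 * vb / N0 * energy v \<le> 2 * vb / N0 * (s / r)\<^sup>2 * energy v"
      proof -
        have "2 * vb / N0 * 1 \<le> 2 * vb / N0 * (s / r)\<^sup>2"
          using vb_pos N0_pos by (intro mult_left_mono one_le_power sr) auto
        then show ?thesis using energy_nonneg[of v] by (intro mult_right_mono) auto
      qed
      moreover have "A * (s / r)\<^sup>2 * energy v = 2 * vb / N0 * (s / r)\<^sup>2 * energy v
         + 2 * N1 * (2 * (2 * \<kappa> + 7) ^ (DIM('a) + 2) * (s / r)\<^sup>2 / (V * r ^ DIM('a)) * ((2 * \<kappa> + 5) ^ DIM('a) * ((vb / N0)\<^sup>2 * energy v)))"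
        unfolding A_def by (rule alg)
      ultimately show ?thesis by linarith
    qed
    then have "K * (2 * vb / N0 * energy v + 2 * N1 * R) \<le> K * (A * (s / r)\<^sup>2 * energy v)"
      using K by (intro mult_left_mono) auto
    moreover have "K * (2 * vb / N0 * energy v + 2 * N1 * (S + R)) = K * (2 * vb / N0 * energy v + 2 * N1 * R) + K * (2 * N1 * S)"
      by (simp add: algebra_simps)
    moreover have "K * (A * (s / r)\<^sup>2 * energy v) = K * A * (s / r)\<^sup>2 * energy v"
      by simp
    ultimately show ?thesis by linarith
  qed
  show thesis using Z(1) cardZ U2 P by (rule that[of Z U])
qed

end

section \<open>Smooth bumps and weak gradients\<close>

text \<open>One-variable \<open>C^k\<close> with an existential derivative: closure under sums,
  products and affine substitution then only requires exhibiting the derivative.\<close>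

primrec ck1 :: "nat \<Rightarrow> (real \<Rightarrow> real) \<Rightarrow> bool" where
  "ck1 0 u \<longleftrightarrow> continuous_on UNIV u"
| "ck1 (Suc k) u \<longleftrightarrow> (\<exists>u'. (\<forall>t. (u has_real_derivative u' t) (at t)) \<and> ck1 k u')"

lemma ck1_Suc_imp: "ck1 (Suc k) u \<Longrightarrow> ck1 k u"
proof (induction k arbitrary: u)
  case 0
  then show ?case
    by (auto intro!: continuous_at_imp_continuous_on intro: DERIV_isCont)
next
  case (Suc k)
  then obtain u' where "\<And>t. (u has_real_derivative u' t) (at t)" "ck1 (Suc k) u'"
    by (metis ck1.simps(2))
  with Suc.IH show ?case by auto
qed

lemma ck1_add: "ck1 k u \<Longrightarrow> ck1 k v \<Longrightarrow> ck1 k (\<lambda>t. u t + v t)"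
proof (induction k arbitrary: u v)
  case (Suc k)
  then obtain u' v' where "\<And>t. (u has_real_derivative u' t) (at t)" "ck1 k u'"
    "\<And>t. (v has_real_derivative v' t) (at t)" "ck1 k v'" by auto
  with Suc.IH show ?case by (auto intro!: exI[of _ "\<lambda>t. u' t + v' t"] DERIV_add)
qed (auto intro: continuous_on_add)

lemma ck1_mult: "ck1 k u \<Longrightarrow> ck1 k v \<Longrightarrow> ck1 k (\<lambda>t. u t * v t)"
proof (induction k arbitrary: u v)
  case (Suc k)
  then obtain u' v' where d: "\<And>t. (u has_real_derivative u' t) (at t)" "ck1 k u'"
    "\<And>t. (v has_real_derivative v' t) (at t)" "ck1 k v'" by auto
  have "ck1 k (\<lambda>t. u' t * v t + v' t * u t)"
    using Suc d ck1_Suc_imp by (intro ck1_add Suc.IH) blast+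
  then show ?case using d by (auto intro!: exI[of _ "\<lambda>t. u' t * v t + v' t * u t"] DERIV_mult)
qed (auto intro: continuous_on_mult)

lemma ck1_affine: "ck1 k u \<Longrightarrow> ck1 k (\<lambda>t. a * u (c * t + d))"
proof (induction k arbitrary: u a)
  case 0
  then show ?case
    by (auto intro!: continuous_intros continuous_on_compose2[of UNIV u])
next
  case (Suc k)
  then obtain u' where d: "\<And>t. (u has_real_derivative u' t) (at t)" "ck1 k u'" by auto
  have "((\<lambda>t. a * u (c * t + d)) has_real_derivative (a * c) * u' (c * t + d)) (at t)" for t
    by (auto intro!: derivative_eq_intros DERIV_chain2[OF d(1)])
  then show ?case
    using Suc.IH[OF d(2), of "a * c"] by (auto intro!: exI[of _ "\<lambda>t. (a * c) * u' (c * t + d)"])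
qed

text \<open>
  Functions \<open>q(1/t) e\<^sup>-\<^sup>1\<^sup>/\<^sup>t\<close> on \<open>t > 0\<close> are closed under differentiation, hence smooth on the line.
\<close>

definition flat :: "real poly \<Rightarrow> real \<Rightarrow> real" where
  "flat q t = (if 0 < t then poly q (1 / t) * exp (- (1 / t)) else 0)"

lemma poly_times_exp_tendsto_0: "((\<lambda>x. poly q x * exp (- x)) \<longlongrightarrow> (0 :: real)) at_top"
proof -
  have "((\<lambda>x. \<Sum>i\<le>degree q. coeff q i * (x ^ i / exp x)) \<longlongrightarrow> (\<Sum>i\<le>degree q. coeff q i * 0)) at_top"
    by (intro tendsto_sum tendsto_mult tendsto_const tendsto_power_div_exp_0)
  moreover have "poly q x * exp (- x) = (\<Sum>i\<le>degree q. coeff q i * (x ^ i / exp x))" for x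
    by (simp add: poly_altdef exp_minus sum_distrib_right divide_inverse mult.assoc)
  ultimately show ?thesis by simp
qed

text \<open>With \<open>x = 1 / t\<close>, differentiation for \<open>t > 0\<close> replaces the
  polynomial \<open>q\<close> by \<open>x^2\<close> times \<open>q\<close> minus its derivative. At
  0 the right difference quotient is \<open>x\<close> times \<open>q\<close> at \<open>x\<close>
  times \<open>exp (- x)\<close>, which tends to 0 as \<open>x\<close> grows.\<close>

lemma flat_has_derivative: "(flat q has_real_derivative flat (monom 1 2 * (q - pderiv q)) t) (at t)"
proof (cases "t = 0")
  case True
  have "((\<lambda>h. poly (pCons 0 q) (1 / h) * exp (- (1 / h))) \<longlongrightarrow> 0) (at_right 0)"
    using filterlim_compose[OF poly_times_exp_tendsto_0[of "pCons 0 q"] filterlim_inverse_at_top_right]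
    by (simp add: divide_inverse)
  then have r: "((\<lambda>h. (flat q (0 + h) - flat q 0) / h) \<longlongrightarrow> 0) (at_right 0)"
    by (rule Lim_transform_eventually) (auto simp: eventually_at_right_less flat_def eventually_at_filter)
  have l: "((\<lambda>h. (flat q (0 + h) - flat q 0) / h) \<longlongrightarrow> 0) (at_left 0)"
    by (rule Lim_transform_eventually[OF tendsto_const]) (auto simp: flat_def eventually_at_filter)
  show ?thesis
    unfolding True DERIV_def using filterlim_split_at_real[OF l r] by (simp add: flat_def)
next
  case False
  show ?thesis
  proof (cases "0 < t")
    case True
    have "((\<lambda>t. poly q (1 / t) * exp (- (1 / t))) has_real_derivative
        poly (monom 1 2 * (q - pderiv q)) (1 / t) * exp (- (1 / t))) (at t)"
      using True
      by (auto intro!: derivative_eq_intros DERIV_chain2[OF poly_DERIV]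
          simp: poly_monom power2_eq_square field_simps)
    then have "(flat q has_real_derivative poly (monom 1 2 * (q - pderiv q)) (1 / t) * exp (- (1 / t))) (at t)"
      by (rule has_field_derivative_transform_within_open[of _ _ _ "{0<..}"]) (use True in \<open>auto simp: flat_def\<close>)
    then show ?thesis using True by (simp add: flat_def)
  next
    case neg: False
    have "((\<lambda>t :: real. 0) has_real_derivative 0) (at t)" by simp
    then have "(flat q has_real_derivative 0) (at t)"
      by (rule has_field_derivative_transform_within_open[of _ _ _ "{..<0}"]) (use False neg in \<open>auto simp: flat_def\<close>)
    then show ?thesis using neg by (simp add: flat_def)
  qed
qed

lemma ck1_flat: "ck1 k (flat q)"
proof (induction k arbitrary: q)
  case 0
  then show ?case
    by (auto intro!: continuous_at_imp_continuous_on DERIV_isCont[OF flat_has_derivative])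
next
  case (Suc k)
  then show ?case using flat_has_derivative by (auto intro!: exI[of _ "flat (monom 1 2 * (q - pderiv q))"])
qed

text \<open>\<open>m\<close> is a sharpness parameter: inside the interval both exponents tend to 0
  as \<open>m\<close> grows, so the bumps converge to the indicator of the open interval, while they
  vanish outside it for every \<open>m > 0\<close>.\<close>

definition smooth_bump :: "real \<Rightarrow> real \<Rightarrow> real \<Rightarrow> real \<Rightarrow> real" where
  "smooth_bump m a b t = flat 1 (m * (t - a)) * flat 1 (m * (b - t))"

lemma ck1_smooth_bump: "ck1 k (smooth_bump m a b)"
proof -
  have "ck1 k (\<lambda>t. (1 * flat 1 (m * t + (- m * a))) * (1 * flat 1 ((- m) * t + m * b)))"
    by (intro ck1_mult ck1_affine ck1_flat)
  also have "(\<lambda>t. (1 * flat 1 (m * t + (- m * a))) * (1 * flat 1 ((- m) * t + m * b))) = smooth_bump m a b"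
    by (auto simp: smooth_bump_def algebra_simps)
  finally show ?thesis .
qed

lemma smooth_bump_bounds: "0 \<le> smooth_bump m a b t" "smooth_bump m a b t \<le> 1"
  by (auto simp: smooth_bump_def flat_def intro!: mult_le_one)

lemma smooth_bump_eq_0: "0 < m \<Longrightarrow> t \<notin> {a<..<b} \<Longrightarrow> smooth_bump m a b t = 0"
  by (auto simp: smooth_bump_def flat_def zero_less_mult_iff)

lemma smooth_bump_tendsto: "(\<lambda>k. smooth_bump (real (Suc k)) a b t) \<longlonglongrightarrow> indicator {a<..<b} t"
proof (cases "t \<in> {a<..<b}")
  case True
  have e: "(\<lambda>k. exp (- (1 / (real (Suc k) * c)))) \<longlonglongrightarrow> 1" if "0 < c" for c :: real
  proof -
    have "(\<lambda>k. exp (- (inverse (real (Suc k)) * (1 / c)))) \<longlonglongrightarrow> exp (- (0 * (1 / c)))"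
      by (intro tendsto_intros LIMSEQ_inverse_real_of_nat)
    then show ?thesis by (simp add: divide_inverse)
  qed
  have "(\<lambda>k. exp (- (1 / (real (Suc k) * (t - a)))) * exp (- (1 / (real (Suc k) * (b - t))))) \<longlonglongrightarrow> 1 * 1"
    using True by (intro tendsto_mult e) auto
  moreover have "smooth_bump (real (Suc k)) a b t = exp (- (1 / (real (Suc k) * (t - a)))) * exp (- (1 / (real (Suc k) * (b - t))))" for k
  proof -
    have "0 < real (Suc k) * (t - a)" "0 < real (Suc k) * (b - t)" using True by auto
    then show ?thesis unfolding smooth_bump_def flat_def by simp
  qed
  ultimately show ?thesis using True by simp
next
  case False
  then show ?thesis by (simp add: smooth_bump_eq_0 del: of_nat_Suc)
qed

section \<open>Products of bumps as test functions\<close>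

definition prod_fun :: "('a::euclidean_space \<Rightarrow> real \<Rightarrow> real) \<Rightarrow> 'a \<Rightarrow> real" where
  "prod_fun u x = (\<Prod>i\<in>Basis. u i (x \<bullet> i))"

lemma prod_fun_has_derivative:
  assumes "\<And>i. i \<in> Basis \<Longrightarrow> (u i has_real_derivative u' i (x \<bullet> i)) (at (x \<bullet> i))"
  shows "(prod_fun u has_derivative (\<lambda>y. \<Sum>i\<in>Basis. (y \<bullet> i) * prod_fun (u(i := u' i)) x)) (at x)"
proof -
  have "((\<lambda>x. \<Prod>i\<in>Basis. u i (x \<bullet> i)) has_derivative
      (\<lambda>y. \<Sum>i\<in>Basis. (y \<bullet> i) * u' i (x \<bullet> i) * (\<Prod>j\<in>Basis - {i}. u j (x \<bullet> j)))) (at x)"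
  proof (rule has_derivative_prod)
    fix i :: 'a assume i: "i \<in> Basis"
    show "((\<lambda>x. u i (x \<bullet> i)) has_derivative (\<lambda>y. (y \<bullet> i) * u' i (x \<bullet> i))) (at x)"
    proof -
      have "((\<lambda>x. x \<bullet> i) has_derivative (\<lambda>y. y \<bullet> i)) (at x)"
        by (rule has_derivative_inner_left[OF has_derivative_ident])
      from has_derivative_compose[OF this assms[OF i, unfolded has_field_derivative_def]]
      show ?thesis by (simp add: mult.commute)
    qed
  qed
  moreover have "prod_fun (u(i := u' i)) x = u' i (x \<bullet> i) * (\<Prod>j\<in>Basis - {i}. u j (x \<bullet> j))" if "i \<in> Basis" for i
    unfolding prod_fun_def using that by (subst prod.remove[of _ i]) (auto intro!: prod.cong)
  ultimately show ?thesis
    by (simp add: prod_fun_def[abs_def] mult.assoc cong: sum.cong)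
qed

lemma prod_fun_frechet_derivative:
  assumes "\<And>i. i \<in> Basis \<Longrightarrow> (u i has_real_derivative u' i (x \<bullet> i)) (at (x \<bullet> i))" "j \<in> Basis"
  shows "frechet_derivative (prod_fun u) (at x) j = prod_fun (u(j := u' j)) x"
proof -
  have "frechet_derivative (prod_fun u) (at x) = (\<lambda>y. \<Sum>i\<in>Basis. (y \<bullet> i) * prod_fun (u(i := u' i)) x)"
    using frechet_derivative_at[OF prod_fun_has_derivative[of u u' x, OF assms(1)]] by simp
  then show ?thesis
    using assms(2) by (simp add: inner_Basis if_distrib[of "\<lambda>x. x * _"] cong: if_cong)
qed

lemma continuous_on_prod_fun:
  "(\<And>i. i \<in> Basis \<Longrightarrow> continuous_on UNIV (u i)) \<Longrightarrow> continuous_on UNIV (prod_fun u)"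
  unfolding prod_fun_def[abs_def]
proof (rule continuous_on_prod)
  fix i :: 'a assume "i \<in> Basis" "\<And>i. i \<in> Basis \<Longrightarrow> continuous_on UNIV (u i)"
  then show "continuous_on UNIV (\<lambda>x :: 'a. u i (x \<bullet> i))"
    by (intro continuous_on_compose2[of UNIV "u i" UNIV "\<lambda>x. x \<bullet> i"] continuous_intros) auto
qed

text \<open>A partial derivative replaces one factor by its derivative, so the class of products is
  closed under differentiation and the induction runs with \<open>u\<close> arbitrary.\<close>

lemma ck_function_prod_fun:
  "(\<And>i. i \<in> Basis \<Longrightarrow> ck1 k (u i)) \<Longrightarrow> ck_function k (prod_fun u)"
proof (induction k arbitrary: u)
  case 0
  then show ?case by (simp add: continuous_on_prod_fun)
next
  case (Suc k)
  then have "\<forall>i. \<exists>u'. i \<in> Basis \<longrightarrow> (\<forall>t. (u i has_real_derivative u' t) (at t)) \<and> ck1 k u'" by auto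
  then obtain u' where u': "\<And>i t. i \<in> Basis \<Longrightarrow> (u i has_real_derivative u' i t) (at t)"
    "\<And>i. i \<in> Basis \<Longrightarrow> ck1 k (u' i)" by metis
  have "prod_fun u differentiable at x" for x
    using prod_fun_has_derivative[of u u' x, OF u'(1)] unfolding differentiable_def by blast
  moreover have "ck_function k (\<lambda>x. frechet_derivative (prod_fun u) (at x) j)" if j: "j \<in> Basis" for j
  proof -
    have "(\<lambda>x. frechet_derivative (prod_fun u) (at x) j) = prod_fun (u(j := u' j))"
      using prod_fun_frechet_derivative[of u u' _ j, OF u'(1) j] by auto
    then show ?thesis
      using u'(2) Suc.prems ck1_Suc_imp j by (auto intro!: Suc.IH)
  qed
  ultimately show ?case by simp
qed

lemma prod_fun_supported:
  assumes "\<And>i t. i \<in> Basis \<Longrightarrow> t \<notin> {a \<bullet> i..b \<bullet> i} \<Longrightarrow> u i t = 0" "x \<notin> cbox a b"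
  shows "prod_fun u x = 0"
proof -
  obtain i where "i \<in> Basis" "x \<bullet> i \<notin> {a \<bullet> i..b \<bullet> i}" using assms(2) by (auto simp: mem_box)
  then show ?thesis unfolding prod_fun_def using assms(1) by (intro prod_zero) auto
qed

lemma prod_fun_bounded:
  assumes "\<And>i t. i \<in> Basis \<Longrightarrow> t \<notin> {a \<bullet> i..b \<bullet> i} \<Longrightarrow> u i t = 0"
    and "\<And>i. i \<in> Basis \<Longrightarrow> continuous_on UNIV (u i)"
  obtains B where "\<And>x. \<bar>prod_fun u x\<bar> \<le> B"
proof -
  have "bounded (prod_fun u ` cbox a b)"
    by (intro compact_imp_bounded compact_continuous_image compact_cbox
        continuous_on_subset[OF continuous_on_prod_fun] assms(2)) auto
  then obtain B where B: "\<And>x. x \<in> cbox a b \<Longrightarrow> \<bar>prod_fun u x\<bar> \<le> B" by (auto simp: bounded_iff)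
  have "\<bar>prod_fun u x\<bar> \<le> max B 0" for x
    using B[of x] prod_fun_supported[of a b u x, OF assms(1)] by (cases "x \<in> cbox a b") auto
  then show thesis by (rule that)
qed

lemma derivative_supported:
  assumes "\<And>t. (u has_real_derivative u' t) (at t)" "\<And>t. t \<notin> {a..b} \<Longrightarrow> u t = 0" "t \<notin> {a..b}"
  shows "u' t = (0 :: real)"
proof -
  have "((\<lambda>t :: real. 0 :: real) has_real_derivative 0) (at t)" by simp
  then have "(u has_real_derivative 0) (at t)"
    by (rule has_field_derivative_transform_within_open[of _ _ _ "- {a..b}"]) (use assms in auto)
  then show ?thesis using assms(1) DERIV_unique by blast
qed

section \<open>Weak gradients along translations\<close>

lemma integrable_mult_bounded:
  fixes f \<psi> :: "'a \<Rightarrow> real"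
  assumes "integrable M f" "\<psi> \<in> borel_measurable M" "\<And>x. \<bar>\<psi> x\<bar> \<le> B"
  shows "integrable M (\<lambda>x. f x * \<psi> x)"
proof (rule Bochner_Integration.integrable_bound[of _ "\<lambda>x. B * f x"])
  show "AE x in M. norm (f x * \<psi> x) \<le> norm (B * f x)"
  proof (intro AE_I2)
    fix x
    have "\<bar>\<psi> x\<bar> \<le> \<bar>B\<bar>" using assms(3)[of x] by linarith
    then show "norm (f x * \<psi> x) \<le> norm (B * f x)" by (simp add: abs_mult mult.commute mult_right_mono)
  qed
qed (use assms in auto)

text \<open>Dominated convergence of the difference quotients: the mean value theorem bounds them by
  \<open>C\<close>, so \<open>C * norm (f x)\<close> dominates.\<close>

lemma has_real_derivative_integral:
  fixes f :: "'a \<Rightarrow> real" and \<psi> D :: "'a \<Rightarrow> real \<Rightarrow> real"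
  assumes f: "integrable M f"
    and \<psi>: "\<And>t. (\<lambda>x. \<psi> x t) \<in> borel_measurable M" "\<And>x t. \<bar>\<psi> x t\<bar> \<le> B"
    and D: "\<And>t. (\<lambda>x. D x t) \<in> borel_measurable M" "\<And>x t. \<bar>D x t\<bar> \<le> C"
    and deriv: "\<And>x t. (\<psi> x has_real_derivative D x t) (at t)"
  shows "((\<lambda>t. LINT x|M. f x * \<psi> x t) has_real_derivative (LINT x|M. f x * D x t)) (at t)"
  unfolding DERIV_def tendsto_at_iff_sequentially comp_def
proof (intro allI impI)
  fix Y :: "nat \<Rightarrow> real" assume Y: "\<forall>i. Y i \<in> UNIV - {0}" "Y \<longlonglongrightarrow> 0"
  have int: "integrable M (\<lambda>x. f x * \<psi> x t)" for t
    by (rule integrable_mult_bounded[OF f \<psi>])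
  have quot: "((LINT x|M. f x * \<psi> x (t + Y i)) - (LINT x|M. f x * \<psi> x t)) / Y i
      = (LINT x|M. f x * ((\<psi> x (t + Y i) - \<psi> x t) / Y i))" for i
  proof -
    have "((LINT x|M. f x * \<psi> x (t + Y i)) - (LINT x|M. f x * \<psi> x t)) / Y i
       = (LINT x|M. (f x * \<psi> x (t + Y i) - f x * \<psi> x t) / Y i)"
      by (simp add: int)
    then show ?thesis by (simp add: right_diff_distrib)
  qed
  have "(\<lambda>i. LINT x|M. f x * ((\<psi> x (t + Y i) - \<psi> x t) / Y i)) \<longlonglongrightarrow> (LINT x|M. f x * D x t)"
  proof (rule integral_dominated_convergence[where w="\<lambda>x. C * norm (f x)"])
    show "AE x in M. (\<lambda>i. f x * ((\<psi> x (t + Y i) - \<psi> x t) / Y i)) \<longlonglongrightarrow> f x * D x t"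
    proof (intro AE_I2 tendsto_mult tendsto_const)
      fix x
      show "(\<lambda>i. (\<psi> x (t + Y i) - \<psi> x t) / Y i) \<longlonglongrightarrow> D x t"
        using deriv[of x t] Y unfolding DERIV_def tendsto_at_iff_sequentially comp_def by blast
    qed
    show "AE x in M. norm (f x * ((\<psi> x (t + Y i) - \<psi> x t) / Y i)) \<le> C * norm (f x)" for i
    proof (intro AE_I2)
      fix x
      have "norm (\<psi> x (t + Y i) - \<psi> x t) \<le> C * norm (t + Y i - t)"
        by (rule field_differentiable_bound[of UNIV "\<psi> x" "D x"]) (use deriv D in auto)
      moreover have "Y i \<noteq> 0" using Y by auto
      ultimately have "\<bar>(\<psi> x (t + Y i) - \<psi> x t) / Y i\<bar> \<le> C"
        by (simp add: divide_le_eq)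
      then have "\<bar>(\<psi> x (t + Y i) - \<psi> x t) / Y i\<bar> * \<bar>f x\<bar> \<le> C * \<bar>f x\<bar>"
        by (rule mult_right_mono) simp
      then show "norm (f x * ((\<psi> x (t + Y i) - \<psi> x t) / Y i)) \<le> C * norm (f x)"
        by (simp only: real_norm_def abs_mult mult.commute[of "\<bar>f x\<bar>"])
    qed
  qed (use f \<psi>(1) D(1) in auto)
  then show "(\<lambda>i. ((LINT x|M. f x * \<psi> x (t + Y i)) - (LINT x|M. f x * \<psi> x t)) / Y i)
      \<longlonglongrightarrow> (LINT x|M. f x * D x t)"
    unfolding quot .
qed

text \<open>The derivatives obtained for different \<open>k\<close> coincide by uniqueness, so one
  function serves all orders.\<close>

lemma smooth_derivative:
  assumes "\<And>k. ck1 k u"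
  obtains u' where "\<And>t. (u has_real_derivative u' t) (at t)" "\<And>k. ck1 k u'"
proof -
  obtain u' where u': "\<And>t. (u has_real_derivative u' t) (at t)"
    using assms[of "Suc 0"] by auto
  have "ck1 k u'" for k
  proof -
    obtain w where w: "\<And>t. (u has_real_derivative w t) (at t)" "ck1 k w"
      using assms[of "Suc k"] by auto
    have "w = u'" using DERIV_unique[OF w(1) u'] by auto
    then show ?thesis using w by simp
  qed
  with u' show thesis by (rule that)
qed

lemma ck1_shift: "ck1 k u \<Longrightarrow> ck1 k (\<lambda>s. u (s + d))"
  using ck1_affine[of k u 1 1 d] by simp

lemma test_function_prod_fun:
  fixes u :: "'a::euclidean_space \<Rightarrow> real \<Rightarrow> real"
  assumes "\<And>i k. i \<in> Basis \<Longrightarrow> ck1 k (u i)"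
    and "\<And>i t. i \<in> Basis \<Longrightarrow> t \<notin> {a \<bullet> i..b \<bullet> i} \<Longrightarrow> u i t = 0"
    and "cbox a b \<subseteq> X"
  shows "test_function X (prod_fun u)"
proof -
  have "{x. prod_fun u x \<noteq> 0} \<subseteq> cbox a b"
    using prod_fun_supported[of a b u] assms(2) by blast
  then have "closure {x. prod_fun u x \<noteq> 0} \<subseteq> cbox a b"
    by (intro closure_minimal closed_cbox)
  moreover from this have "compact (closure {x. prod_fun u x \<noteq> 0})"
    unfolding compact_eq_bounded_closed using bounded_subset[OF bounded_cbox] by blast
  ultimately show ?thesis
    unfolding test_function_def using assms by (auto intro!: ck_function_prod_fun)
qed

text \<open>The translation is put on the bump, so \<open>f\<close> is never mollified. The
  \<open>t\<close>-derivative of the pairing of \<open>f\<close> with the bump moved by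
  \<open>t *\<^sub>R h\<close> is given by the weak gradient, because the moved bump is still
  supported in \<open>X\<close>; integration over \<open>t\<close> in \<open>[0, 1]\<close> gives
  the claim.\<close>

lemma weak_gradient_translate:
  fixes f :: "'a::euclidean_space \<Rightarrow> real" and g :: "'a \<Rightarrow> 'a" and u :: "'a \<Rightarrow> real \<Rightarrow> real"
  assumes f: "integrable lborel f" and g: "integrable lborel g"
    and W: "\<And>\<phi> i. test_function X \<phi> \<Longrightarrow> i \<in> Basis \<Longrightarrow>
       (LINT x|lborel. f x * frechet_derivative \<phi> (at x) i) = - (LINT x|lborel. (g x \<bullet> i) * \<phi> x)"
    and u: "\<And>i k. i \<in> Basis \<Longrightarrow> ck1 k (u i)"
    and supp: "\<And>i t. i \<in> Basis \<Longrightarrow> t \<notin> {a \<bullet> i..b \<bullet> i} \<Longrightarrow> u i t = 0"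
    and seg: "\<And>x t. x \<in> cbox a b \<Longrightarrow> 0 \<le> t \<Longrightarrow> t \<le> 1 \<Longrightarrow> x + t *\<^sub>R h \<in> X"
  shows "(LINT x|lborel. f x * prod_fun u (x - h)) - (LINT x|lborel. f x * prod_fun u x)
     = (LINT t:{0..1}|lborel. LINT x|lborel. (g x \<bullet> h) * prod_fun u (x - t *\<^sub>R h))"
proof -
  have "\<forall>i. \<exists>u'. i \<in> Basis \<longrightarrow> (\<forall>t. (u i has_real_derivative u' t) (at t)) \<and> (\<forall>k. ck1 k u')"
    using smooth_derivative[OF u] by metis
  then obtain u' where u': "\<And>i t. i \<in> Basis \<Longrightarrow> (u i has_real_derivative u' i t) (at t)"
    "\<And>i k. i \<in> Basis \<Longrightarrow> ck1 k (u' i)" by metis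
  have supp': "u' i t = 0" if "i \<in> Basis" "t \<notin> {a \<bullet> i..b \<bullet> i}" for i t
    by (rule derivative_supported[OF u'(1)[OF that(1)] supp[OF that(1)] that(2)])
  define \<psi> where "\<psi> = prod_fun u"
  define P where "P i = prod_fun (u(i := u' i))" for i
  have cont_u: "continuous_on UNIV (u i)" "continuous_on UNIV (u' i)" if "i \<in> Basis" for i
    using u[OF that, of 0] u'(2)[OF that, of 0] by auto
  have cont\<psi>: "continuous_on UNIV \<psi>" unfolding \<psi>_def by (intro continuous_on_prod_fun cont_u)
  have contP: "continuous_on UNIV (P i)" if "i \<in> Basis" for i
    unfolding P_def using cont_u that by (intro continuous_on_prod_fun) auto
  have [measurable]: "\<psi> \<in> borel_measurable borel"
    using cont\<psi> by (rule borel_measurable_continuous_onI)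
  have [measurable]: "i \<in> Basis \<Longrightarrow> P i \<in> borel_measurable borel" for i
    using contP by (rule borel_measurable_continuous_onI)
  obtain B where B: "\<And>x. \<bar>\<psi> x\<bar> \<le> B"
    unfolding \<psi>_def using prod_fun_bounded[of a b u] supp cont_u(1) by blast
  have "\<exists>C. \<forall>x. \<bar>P i x\<bar> \<le> C" if i: "i \<in> Basis" for i
  proof -
    have "(u(i := u' i)) j t = 0" if "j \<in> Basis" "t \<notin> {a \<bullet> j..b \<bullet> j}" for j t
      using supp[OF that] supp'[OF that] by auto
    moreover have "continuous_on UNIV ((u(i := u' i)) j)" if "j \<in> Basis" for j
      using cont_u[OF that] by auto
    ultimately show ?thesis
      unfolding P_def using prod_fun_bounded[of a b "u(i := u' i)"] by metis
  qed
  then obtain Cf where Cf: "\<And>i x. i \<in> Basis \<Longrightarrow> \<bar>P i x\<bar> \<le> Cf i" by metis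
  define D where "D z = (\<Sum>i\<in>Basis. (h \<bullet> i) * P i z)" for z
  have [measurable]: "D \<in> borel_measurable borel" unfolding D_def by measurable
  have Dbound: "\<bar>D z\<bar> \<le> (\<Sum>i\<in>Basis. \<bar>h \<bullet> i\<bar> * Cf i)" for z
    unfolding D_def
    by (intro order_trans[OF sum_abs] sum_mono) (simp add: abs_mult mult_left_mono Cf)
  have deriv: "((\<lambda>t. \<psi> (x - t *\<^sub>R h)) has_real_derivative - D (x - t *\<^sub>R h)) (at t)" for x t
  proof -
    have 1: "((\<lambda>t. x - t *\<^sub>R h) has_derivative (\<lambda>s. - (s *\<^sub>R h))) (at t)"
      by (auto intro!: derivative_eq_intros)
    have 2: "(\<psi> has_derivative (\<lambda>y. \<Sum>i\<in>Basis. (y \<bullet> i) * P i (x - t *\<^sub>R h))) (at (x - t *\<^sub>R h))"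
      unfolding \<psi>_def P_def by (intro prod_fun_has_derivative u'(1))
    have "((\<lambda>t. \<psi> (x - t *\<^sub>R h)) has_derivative (\<lambda>s. \<Sum>i\<in>Basis. (- (s *\<^sub>R h) \<bullet> i) * P i (x - t *\<^sub>R h))) (at t)"
      using has_derivative_compose[OF 1 2] .
    moreover have "(\<lambda>s. \<Sum>i\<in>Basis. (- (s *\<^sub>R h) \<bullet> i) * P i (x - t *\<^sub>R h)) = (*) (- D (x - t *\<^sub>R h))"
      by (auto simp: D_def sum_distrib_left sum_negf mult_ac)
    ultimately show ?thesis unfolding has_field_derivative_def by simp
  qed
  have G: "((\<lambda>t. LINT x|lborel. f x * \<psi> (x - t *\<^sub>R h)) has_real_derivative (LINT x|lborel. f x * - D (x - t *\<^sub>R h))) (at t)" for t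
    by (rule has_real_derivative_integral[OF f _ _ _ _ deriv, where B=B and C="\<Sum>i\<in>Basis. \<bar>h \<bullet> i\<bar> * Cf i"])
       (use B Dbound in auto)
  have G': "(LINT x|lborel. f x * - D (x - t *\<^sub>R h)) = (LINT x|lborel. (g x \<bullet> h) * \<psi> (x - t *\<^sub>R h))"
    if t: "0 \<le> t" "t \<le> 1" for t
  proof -
    define w where "w = (\<lambda>i s. u i (s + (- (t * (h \<bullet> i)))))"
    define w' where "w' = (\<lambda>i s. u' i (s + (- (t * (h \<bullet> i)))))"
    have w: "prod_fun w = (\<lambda>x. \<psi> (x - t *\<^sub>R h))"
      by (auto simp: prod_fun_def w_def \<psi>_def inner_diff_left)
    have test: "test_function X (prod_fun w)"
    proof (rule test_function_prod_fun[of _ "a + t *\<^sub>R h" "b + t *\<^sub>R h"])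
      show "ck1 k (w i)" if "i \<in> Basis" for i k
        unfolding w_def by (intro ck1_shift u that)
      show "w i s = 0" if "i \<in> Basis" "s \<notin> {(a + t *\<^sub>R h) \<bullet> i..(b + t *\<^sub>R h) \<bullet> i}" for i s
        unfolding w_def using that by (intro supp) (auto simp: inner_add_left)
      show "cbox (a + t *\<^sub>R h) (b + t *\<^sub>R h) \<subseteq> X"
      proof
        fix x assume "x \<in> cbox (a + t *\<^sub>R h) (b + t *\<^sub>R h)"
        then have "x - t *\<^sub>R h \<in> cbox a b" by (auto simp: mem_box inner_add_left inner_diff_left)
        from seg[OF this t] show "x \<in> X" by simp
      qed
    qed
    have fd: "frechet_derivative (prod_fun w) (at x) i = P i (x - t *\<^sub>R h)" if i: "i \<in> Basis" for i x
    proof -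
      have "frechet_derivative (prod_fun w) (at x) i = prod_fun (w(i := w' i)) x"
      proof (rule prod_fun_frechet_derivative[OF _ i])
        fix j :: 'a assume "j \<in> Basis"
        then show "(w j has_real_derivative w' j (x \<bullet> j)) (at (x \<bullet> j))"
          unfolding w_def w'_def by (intro DERIV_shift[THEN iffD1] u'(1))
      qed
      also have "\<dots> = P i (x - t *\<^sub>R h)"
        unfolding P_def prod_fun_def by (intro prod.cong) (auto simp: w_def w'_def inner_diff_left)
      finally show ?thesis .
    qed
    have Wt: "(LINT x|lborel. f x * P i (x - t *\<^sub>R h)) = - (LINT x|lborel. (g x \<bullet> i) * \<psi> (x - t *\<^sub>R h))"
      if "i \<in> Basis" for i
      using W[OF test that] fd[OF that] by (simp add: w)
    have int1: "integrable lborel (\<lambda>x. f x * P i (x - t *\<^sub>R h))" if "i \<in> Basis" for i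
      using that Cf[OF that] by (intro integrable_mult_bounded[OF f, where B="Cf i"]) auto
    have int2: "integrable lborel (\<lambda>x. (g x \<bullet> i) * \<psi> (x - t *\<^sub>R h))" for i
      using B g by (intro integrable_mult_bounded[where B=B]) auto
    have "(LINT x|lborel. f x * - D (x - t *\<^sub>R h)) = (LINT x|lborel. (\<Sum>i\<in>Basis. - (h \<bullet> i) * (f x * P i (x - t *\<^sub>R h))))"
      by (simp add: D_def sum_distrib_left sum_negf mult_ac)
    also have "\<dots> = (\<Sum>i\<in>Basis. - (h \<bullet> i) * (LINT x|lborel. f x * P i (x - t *\<^sub>R h)))"
      by (subst Bochner_Integration.integral_sum) (auto intro!: int1)
    also have "\<dots> = (\<Sum>i\<in>Basis. (h \<bullet> i) * (LINT x|lborel. (g x \<bullet> i) * \<psi> (x - t *\<^sub>R h)))"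
      by (simp add: Wt)
    also have "\<dots> = (LINT x|lborel. (\<Sum>i\<in>Basis. (h \<bullet> i) * ((g x \<bullet> i) * \<psi> (x - t *\<^sub>R h))))"
      by (subst Bochner_Integration.integral_sum) (auto intro!: int2)
    also have "\<dots> = (LINT x|lborel. (g x \<bullet> h) * \<psi> (x - t *\<^sub>R h))"
      by (intro Bochner_Integration.integral_cong refl, subst euclidean_inner[of "g _" h],
          subst sum_distrib_right, intro sum.cong refl) simp
    finally show ?thesis .
  qed
  let ?G' = "\<lambda>t. LINT x|lborel. (g x \<bullet> h) * \<psi> (x - t *\<^sub>R h)"
  have "(?G' has_integral (LINT x|lborel. f x * \<psi> (x - 1 *\<^sub>R h)) - (LINT x|lborel. f x * \<psi> (x - 0 *\<^sub>R h))) {0..1}"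
  proof (rule fundamental_theorem_of_calculus)
    fix t :: real assume "t \<in> {0..1}"
    then show "((\<lambda>t. LINT x|lborel. f x * \<psi> (x - t *\<^sub>R h)) has_vector_derivative ?G' t) (at t within {0..1})"
      using G[of t] G'[of t] by (auto simp: has_real_derivative_iff_has_vector_derivative intro: has_vector_derivative_at_within)
  qed simp
  \<comment> \<open>The fundamental theorem yields a gauge integral; boundedness of
    \<open>?G'\<close> makes it a Lebesgue integral.\<close>
  moreover have "set_integrable lborel {0..1} ?G'"
    unfolding set_integrable_def
  proof (rule integrableI_bounded_set_indicator[where B="LINT x|lborel. B * \<bar>g x \<bullet> h\<bar>"])
    show "?G' \<in> borel_measurable lborel" using g by measurable
    have "\<bar>?G' t\<bar> \<le> (LINT x|lborel. B * \<bar>g x \<bullet> h\<bar>)" for t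
    proof -
      have "\<bar>?G' t\<bar> \<le> (LINT x|lborel. \<bar>(g x \<bullet> h) * \<psi> (x - t *\<^sub>R h)\<bar>)" by (rule integral_abs_bound)
      also have "\<dots> \<le> (LINT x|lborel. B * \<bar>g x \<bullet> h\<bar>)"
      proof (rule integral_mono)
        show "integrable lborel (\<lambda>x. \<bar>(g x \<bullet> h) * \<psi> (x - t *\<^sub>R h)\<bar>)"
          using B g by (intro integrable_abs integrable_mult_bounded[where B=B]) auto
        show "\<bar>(g x \<bullet> h) * \<psi> (x - t *\<^sub>R h)\<bar> \<le> B * \<bar>g x \<bullet> h\<bar>" for x
          unfolding abs_mult by (subst mult.commute) (intro mult_right_mono B abs_ge_zero)
      qed (use g in auto)
      finally show ?thesis .
    qed
    then show "AE t in lborel. t \<in> {0..1} \<longrightarrow> norm (?G' t) \<le> (LINT x|lborel. B * \<bar>g x \<bullet> h\<bar>)" by simp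
  qed auto
  ultimately show ?thesis
    using set_borel_integral_eq_integral(2)[of "{0..1}" ?G'] by (simp add: \<psi>_def integral_unique)
qed

lemma
  fixes F :: "'a::euclidean_space \<Rightarrow> real"
  assumes [measurable]: "F \<in> borel_measurable borel"
  shows lborel_integral_translate: "(LINT x|lborel. F (x + c)) = (LINT x|lborel. F x)"
    and lborel_integrable_translate: "integrable lborel (\<lambda>x. F (x + c)) \<longleftrightarrow> integrable lborel F"
proof -
  have "(LINT x|lborel. F x) = (LINT x|distr lborel borel ((+) c). F x)"
    by (simp add: lborel_distr_plus)
  also have "\<dots> = (LINT x|lborel. F (x + c))"
    by (subst integral_distr) (auto simp: add.commute)
  finally show "(LINT x|lborel. F (x + c)) = (LINT x|lborel. F x)" by simp
  have "integrable lborel F \<longleftrightarrow> integrable (distr lborel borel ((+) c)) F"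
    by (simp add: lborel_distr_plus)
  also have "\<dots> \<longleftrightarrow> integrable lborel (\<lambda>x. F (x + c))"
    by (subst integrable_distr_eq) (auto simp: add.commute)
  finally show "integrable lborel (\<lambda>x. F (x + c)) \<longleftrightarrow> integrable lborel F" by simp
qed

text \<open>The positive and the negative part define measures that agree on boxes, an
  intersection-stable generator; equal measures have almost everywhere equal densities.\<close>

lemma AE_zero_if_box_integrals_zero:
  fixes H :: "'a::euclidean_space \<Rightarrow> real"
  assumes H: "integrable lborel H"
    and box: "\<And>c d. (LINT x|lborel. indicator (box c d) x * H x) = 0"
  shows "AE x in lborel. H x = 0"
proof -
  have [measurable]: "H \<in> borel_measurable borel" using H by auto
  define P where "P x = max (H x) 0" for x
  define N where "N x = max (- H x) 0" for x
  have int: "integrable lborel P" "integrable lborel N"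
    unfolding P_def N_def using H by (auto intro!: Bochner_Integration.integrable_bound[OF H])
  have nn: "0 \<le> P x" "0 \<le> N x" "H x = P x - N x" for x by (auto simp: P_def N_def)
  have [measurable]: "P \<in> borel_measurable borel" "N \<in> borel_measurable borel"
    unfolding P_def N_def by measurable
  have e: "emeasure (density lborel (\<lambda>x. ennreal (Q x))) (box c d) = ennreal (LINT x|lborel. indicator (box c d) x * Q x)"
    if Q: "integrable lborel Q" "\<And>x. 0 \<le> Q x" "Q \<in> borel_measurable borel" for Q and c d :: 'a
  proof -
    have "integrable lborel (\<lambda>x. indicator (box c d) x * Q x)"
      using integrable_mult_indicator[of "box c d" lborel Q] Q(1) by simp
    then have "(\<integral>\<^sup>+x. ennreal (indicator (box c d) x * Q x) \<partial>lborel) = ennreal (LINT x|lborel. indicator (box c d) x * Q x)"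
      using Q(2) by (intro nn_integral_eq_integral) auto
    moreover have "emeasure (density lborel (\<lambda>x. ennreal (Q x))) (box c d) = (\<integral>\<^sup>+x. ennreal (indicator (box c d) x * Q x) \<partial>lborel)"
      using Q(3) by (subst emeasure_density) (auto intro!: nn_integral_cong simp: indicator_def)
    ultimately show ?thesis by simp
  qed
  have "density lborel (\<lambda>x. ennreal (P x)) = density lborel (\<lambda>x. ennreal (N x))"
  proof (rule measure_eqI_generator_eq[where E="range (\<lambda>(a, b). box a b :: 'a set)" and \<Omega>=UNIV
        and A="\<lambda>n. box (- (real n *\<^sub>R One)) (real n *\<^sub>R One)"])
    show "Int_stable (range (\<lambda>(a, b). box a b :: 'a set))"
      by (auto simp: Int_stable_def box_Int_box)
    show "sets (density lborel (\<lambda>x. ennreal (P x))) = sigma_sets UNIV (range (\<lambda>(a, b). box a b))"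
      "sets (density lborel (\<lambda>x. ennreal (N x))) = sigma_sets UNIV (range (\<lambda>(a, b). box a b))"
      by (simp_all add: borel_eq_box)
    show "(\<Union>n. box (- (real n *\<^sub>R One)) (real n *\<^sub>R One) :: 'a set) = UNIV"
      by (rule UN_box_eq_UNIV)
    fix Y :: "'a set" assume "Y \<in> range (\<lambda>(a, b). box a b)"
    then obtain c d where Y: "Y = box c d" by auto
    have i: "integrable lborel (\<lambda>x. indicator (box c d) x * P x)" "integrable lborel (\<lambda>x. indicator (box c d) x * N x)"
      using integrable_mult_indicator[of "box c d" lborel P] integrable_mult_indicator[of "box c d" lborel N] int
      by simp_all
    have "(LINT x|lborel. indicator (box c d) x * P x) - (LINT x|lborel. indicator (box c d) x * N x) = 0"
      using box[of c d] unfolding nn(3) right_diff_distrib by (simp add: i)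
    then show "emeasure (density lborel (\<lambda>x. ennreal (P x))) Y = emeasure (density lborel (\<lambda>x. ennreal (N x))) Y"
      unfolding Y using int nn by (simp add: e)
  qed (auto simp: e[OF int(1) nn(1)])
  then have "AE x in lborel. ennreal (P x) = ennreal (N x)"
    by (intro sigma_finite_measure.density_unique[OF sigma_finite_lborel]) auto
  then show ?thesis
    by eventually_elim (use nn in auto)
qed

text \<open>
  The fundamental theorem of calculus along a translation: both sides have the same integral
  against product bumps, hence against indicators of boxes.
\<close>

lemma weak_ftc_box:
  fixes f :: "'a::euclidean_space \<Rightarrow> real" and g :: "'a \<Rightarrow> 'a"
  assumes f: "integrable lborel f" and g: "integrable lborel g"
    and W: "\<And>\<phi> i. test_function X \<phi> \<Longrightarrow> i \<in> Basis \<Longrightarrow>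
       (LINT x|lborel. f x * frechet_derivative \<phi> (at x) i) = - (LINT x|lborel. (g x \<bullet> i) * \<phi> x)"
    and seg: "\<And>x t. x \<in> cbox a b \<Longrightarrow> 0 \<le> t \<Longrightarrow> t \<le> 1 \<Longrightarrow> x + t *\<^sub>R h \<in> X"
  shows "AE x in lborel. x \<in> box a b \<longrightarrow> f (x + h) - f x = (LINT t:{0..1}|lborel. g (x + t *\<^sub>R h) \<bullet> h)"
proof -
  have [measurable]: "f \<in> borel_measurable borel" "g \<in> borel_measurable borel" using f g by auto
  define \<Phi> where "\<Phi> t x = indicator {0..1 :: real} t * (g (x + t *\<^sub>R h) \<bullet> h)" for t x
  define A where "A x = (LINT t:{0..1}|lborel. g (x + t *\<^sub>R h) \<bullet> h)" for x
  have A: "A x = (LINT t|lborel. \<Phi> t x)" for x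
    by (simp add: A_def \<Phi>_def set_lebesgue_integral_def)
  have gh: "integrable lborel (\<lambda>x. g x \<bullet> h)" using g by auto
  \<comment> \<open>Joint integrability for Fubini: by translation invariance every slice with
    \<open>t\<close> in \<open>[0, 1]\<close> has the same \<open>L^1\<close> norm.\<close>
  have intPhi: "integrable (lborel \<Otimes>\<^sub>M lborel) (\<lambda>(t, x). \<Phi> t x)"
  proof (rule integrableI_bounded)
    show [measurable]: "(\<lambda>(t, x). \<Phi> t x) \<in> borel_measurable (lborel \<Otimes>\<^sub>M lborel)"
      unfolding \<Phi>_def by measurable
    have "(\<integral>\<^sup>+z. ennreal (norm (case z of (t, x) \<Rightarrow> \<Phi> t x)) \<partial>(lborel \<Otimes>\<^sub>M lborel))
       = (\<integral>\<^sup>+t. \<integral>\<^sup>+x. ennreal \<bar>\<Phi> t x\<bar> \<partial>lborel \<partial>lborel)"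
      by (subst lborel.nn_integral_fst[symmetric]) (auto simp: case_prod_unfold)
    also have "\<dots> = (\<integral>\<^sup>+t. indicator {0..1 :: real} t * (\<integral>\<^sup>+x. ennreal \<bar>g x \<bullet> h\<bar> \<partial>lborel) \<partial>lborel)"
    proof (rule nn_integral_cong)
      fix t :: real
      have "(\<integral>\<^sup>+x. ennreal \<bar>g (t *\<^sub>R h + x) \<bullet> h\<bar> \<partial>lborel) = (\<integral>\<^sup>+x. ennreal \<bar>g x \<bullet> h\<bar> \<partial>lborel)"
        by (rule nn_integral_lborel_translate) measurable
      then show "(\<integral>\<^sup>+x. ennreal \<bar>\<Phi> t x\<bar> \<partial>lborel) = indicator {0..1} t * (\<integral>\<^sup>+x. ennreal \<bar>g x \<bullet> h\<bar> \<partial>lborel)"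
        by (auto simp: \<Phi>_def indicator_def add.commute)
    qed
    also have "\<dots> = (\<integral>\<^sup>+x. ennreal \<bar>g x \<bullet> h\<bar> \<partial>lborel)"
      by (subst nn_integral_multc) auto
    also have "\<dots> < \<infinity>" using gh by (auto simp: integrable_iff_bounded)
    finally show "(\<integral>\<^sup>+z. ennreal (norm (case z of (t, x) \<Rightarrow> \<Phi> t x)) \<partial>(lborel \<Otimes>\<^sub>M lborel)) < \<infinity>" .
  qed
  have intA: "integrable lborel A"
    unfolding A[abs_def] using lborel_pair.integrable_snd[OF intPhi] .
  have intf: "integrable lborel (\<lambda>x. f (x + h))"
    using f by (simp add: lborel_integrable_translate)
  define H where "H x = f (x + h) - f x - A x" for x
  have intH: "integrable lborel H" unfolding H_def using intf f intA by auto
  have bump: "(LINT x|lborel. H x * prod_fun u x) = 0"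
    if u: "\<And>i k. i \<in> Basis \<Longrightarrow> ck1 k (u i)"
      and supp: "\<And>i t. i \<in> Basis \<Longrightarrow> t \<notin> {a \<bullet> i..b \<bullet> i} \<Longrightarrow> u i t = 0" for u
  proof -
    have cont: "continuous_on UNIV (u i)" if "i \<in> Basis" for i using u[OF that, of 0] by simp
    have [measurable]: "prod_fun u \<in> borel_measurable borel"
      by (intro borel_measurable_continuous_onI continuous_on_prod_fun cont)
    obtain B where B: "\<And>x. \<bar>prod_fun u x\<bar> \<le> B"
      using prod_fun_bounded[of a b u] supp cont by blast
    have i: "integrable lborel (\<lambda>x. F x * prod_fun u x)" if "integrable lborel F" for F
      using that B by (intro integrable_mult_bounded[where B=B]) auto
    have 1: "(LINT x|lborel. f x * prod_fun u (x - h)) = (LINT x|lborel. f (x + h) * prod_fun u x)"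
      using lborel_integral_translate[of "\<lambda>x. f x * prod_fun u (x - h)" h] by simp
    have "(LINT t:{0..1}|lborel. LINT x|lborel. (g x \<bullet> h) * prod_fun u (x - t *\<^sub>R h))
       = (LINT t|lborel. LINT x|lborel. \<Phi> t x * prod_fun u x)"
      unfolding set_lebesgue_integral_def
    proof (rule Bochner_Integration.integral_cong[OF refl])
      fix t :: real
      have "(LINT x|lborel. (g x \<bullet> h) * prod_fun u (x - t *\<^sub>R h)) = (LINT x|lborel. (g (x + t *\<^sub>R h) \<bullet> h) * prod_fun u x)"
        using lborel_integral_translate[of "\<lambda>x. (g x \<bullet> h) * prod_fun u (x - t *\<^sub>R h)" "t *\<^sub>R h"] by simp
      then show "indicator {0..1} t *\<^sub>R (LINT x|lborel. (g x \<bullet> h) * prod_fun u (x - t *\<^sub>R h)) = (LINT x|lborel. \<Phi> t x * prod_fun u x)"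
        by (auto simp: \<Phi>_def indicator_def)
    qed
    also have "\<dots> = (LINT x|lborel. LINT t|lborel. \<Phi> t x * prod_fun u x)"
    proof (rule lborel_pair.Fubini_integral[symmetric])
      have "integrable (lborel \<Otimes>\<^sub>M lborel) (\<lambda>z. (case z of (t, x) \<Rightarrow> \<Phi> t x) * prod_fun u (snd z))"
        using B by (intro integrable_mult_bounded[OF intPhi, where B=B]) auto
      then show "integrable (lborel \<Otimes>\<^sub>M lborel) (\<lambda>(t, x). \<Phi> t x * prod_fun u x)"
        by (simp add: case_prod_unfold)
    qed
    also have "\<dots> = (LINT x|lborel. A x * prod_fun u x)"
      by (simp add: A)
    moreover have "(LINT x|lborel. f x * prod_fun u (x - h)) - (LINT x|lborel. f x * prod_fun u x)
       = (LINT t:{0..1}|lborel. LINT x|lborel. (g x \<bullet> h) * prod_fun u (x - t *\<^sub>R h))"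
      by (rule weak_gradient_translate[OF f g W u supp seg])
    ultimately show ?thesis
      using 1 by (simp add: H_def left_diff_distrib i f intf intA)
  qed
  have "AE x in lborel. indicator (box a b) x * H x = 0"
  proof (rule AE_zero_if_box_integrals_zero)
    show "integrable lborel (\<lambda>x. indicator (box a b) x * H x)"
      using integrable_mult_indicator[of "box a b" lborel H] intH by simp
    fix c d :: 'a
    \<comment> \<open>Bumps for the intersection of both boxes. They are supported in
      \<open>cbox a b\<close>, so \<open>bump\<close> applies; an empty interval gives the zero
      bump.\<close>
    define u where "u k i = smooth_bump (real (Suc k)) (max (a \<bullet> i) (c \<bullet> i)) (min (b \<bullet> i) (d \<bullet> i))" for k :: nat and i
    have lim: "(\<lambda>k. prod_fun (u k) x) \<longlonglongrightarrow> indicator (box a b \<inter> box c d) x" for x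
    proof -
      have "(\<lambda>k. prod_fun (u k) x) \<longlonglongrightarrow> (\<Prod>i\<in>Basis. indicator {max (a \<bullet> i) (c \<bullet> i)<..<min (b \<bullet> i) (d \<bullet> i)} (x \<bullet> i))"
        unfolding prod_fun_def u_def by (intro tendsto_prod smooth_bump_tendsto)
      also have "(\<Prod>i\<in>Basis. indicator {max (a \<bullet> i) (c \<bullet> i)<..<min (b \<bullet> i) (d \<bullet> i)} (x \<bullet> i)) = (indicator (box a b \<inter> box c d) x :: real)"
      proof (cases "x \<in> box a b \<inter> box c d")
        case True
        then show ?thesis by (auto simp: mem_box)
      next
        case False
        then obtain i where "i \<in> Basis" "x \<bullet> i \<notin> {max (a \<bullet> i) (c \<bullet> i)<..<min (b \<bullet> i) (d \<bullet> i)}"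
          by (auto simp: mem_box)
        then have "(\<Prod>i\<in>Basis. indicator {max (a \<bullet> i) (c \<bullet> i)<..<min (b \<bullet> i) (d \<bullet> i)} (x \<bullet> i)) = (0 :: real)"
          by (intro prod_zero finite_Basis bexI[of _ i]) auto
        then show ?thesis using False by simp
      qed
      finally show ?thesis .
    qed
    have bound: "\<bar>prod_fun (u k) x\<bar> \<le> 1" for k x
      unfolding prod_fun_def u_def
      by (subst abs_of_nonneg) (auto intro!: prod_nonneg prod_le_1 smooth_bump_bounds)
    have cu: "continuous_on UNIV (u k i)" for k i
      using ck1_smooth_bump[of 0] by (simp add: u_def)
    have [measurable]: "prod_fun (u k) \<in> borel_measurable borel" for k
      by (intro borel_measurable_continuous_onI continuous_on_prod_fun cu)
    have [measurable]: "H \<in> borel_measurable borel" using intH by auto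
    have "(\<lambda>k. LINT x|lborel. H x * prod_fun (u k) x) \<longlonglongrightarrow> (LINT x|lborel. H x * indicator (box a b \<inter> box c d) x)"
    proof (rule integral_dominated_convergence[where w="\<lambda>x. norm (H x)"])
      show "AE x in lborel. norm (H x * prod_fun (u k) x) \<le> norm (H x)" for k
        using bound by (intro AE_I2) (simp add: abs_mult mult_left_le)
    qed (use intH lim in \<open>auto intro!: tendsto_mult\<close>)
    moreover have "(LINT x|lborel. H x * prod_fun (u k) x) = 0" for k
    proof (rule bump)
      show "ck1 j (u k i)" for i j unfolding u_def by (rule ck1_smooth_bump)
      show "u k i t = 0" if "i \<in> Basis" "t \<notin> {a \<bullet> i..b \<bullet> i}" for i t
        unfolding u_def using that by (intro smooth_bump_eq_0) auto
    qed
    ultimately have "(LINT x|lborel. H x * indicator (box a b \<inter> box c d) x) = 0"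
      using LIMSEQ_unique[of "\<lambda>_. 0"] by auto
    then show "(LINT x|lborel. indicator (box c d) x * (indicator (box a b) x * H x)) = 0"
      by (simp add: indicator_inter_arith mult_ac)
  qed
  then show ?thesis
    by eventually_elim (auto simp: H_def A_def)
qed

text \<open>Cauchy-Schwarz on an interval of length one, from
  \<open>(\<phi> t - c)^2 \<ge> 0\<close>. No integrability is assumed: otherwise the right side is
  infinite or the Bochner integral on the left is 0.\<close>

lemma square_integral_unit_interval_le:
  fixes \<phi> :: "real \<Rightarrow> real"
  assumes [measurable]: "\<phi> \<in> borel_measurable borel"
  shows "ennreal ((LINT t:{0..1}|lborel. \<phi> t)\<^sup>2) \<le> (\<integral>\<^sup>+t. ennreal (of_bool (t \<in> {0..1}) * (\<phi> t)\<^sup>2) \<partial>lborel)"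
proof (cases "(\<integral>\<^sup>+t. ennreal (of_bool (t \<in> {0..1}) * (\<phi> t)\<^sup>2) \<partial>lborel) < \<infinity> \<and> set_integrable lborel {0..1 :: real} \<phi>")
  case True
  define c where "c = (LINT t:{0..1}|lborel. \<phi> t)"
  have i2: "integrable lborel (\<lambda>t :: real. of_bool (t \<in> {0..1}) * (\<phi> t)\<^sup>2)"
    using True by (intro integrableI_bounded) auto
  have i1: "integrable lborel (\<lambda>t. indicator {0..1} t * \<phi> t)"
    using True by (simp add: set_integrable_def)
  have i0: "integrable lborel (indicat_real {0..1 :: real})" by simp
  have "c\<^sup>2 = (LINT t|lborel. 2 * c * (indicator {0..1} t * \<phi> t) - c\<^sup>2 * indicat_real {0..1} t)"
    using i1 i0 by (simp add: c_def set_lebesgue_integral_def power2_eq_square)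
  also have "\<dots> \<le> (LINT t|lborel. of_bool (t \<in> {0..1}) * (\<phi> t)\<^sup>2)"
  proof (rule integral_mono[OF _ i2])
    show "2 * c * (indicator {0..1} t * \<phi> t) - c\<^sup>2 * indicat_real {0..1} t \<le> of_bool (t \<in> {0..1}) * (\<phi> t)\<^sup>2" for t
      using zero_le_power2[of "\<phi> t - c"] by (auto simp: indicator_def power2_eq_square algebra_simps)
  qed (use i1 i0 in auto)
  finally have "ennreal (c\<^sup>2) \<le> ennreal (LINT t|lborel. of_bool (t \<in> {0..1}) * (\<phi> t)\<^sup>2)" by (rule ennreal_leI)
  also have "\<dots> = (\<integral>\<^sup>+t. ennreal (of_bool (t \<in> {0..1}) * (\<phi> t)\<^sup>2) \<partial>lborel)"
    by (rule nn_integral_eq_integral[OF i2, symmetric]) auto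
  finally show ?thesis by (simp add: c_def)
next
  case False
  then show ?thesis
    by (auto simp: set_integrable_def set_lebesgue_integral_def not_integrable_integral_eq less_top[symmetric])
qed

section \<open>Nonlocal energy of Sobolev functions\<close>

text \<open>An open set is a countable union of closed boxes, whose frontiers are null sets, so the
  exceptional sets of the boxes add up to a null set.\<close>

lemma weak_ftc_open:
  fixes f :: "'a::euclidean_space \<Rightarrow> real" and g :: "'a \<Rightarrow> 'a"
  assumes f: "integrable lborel f" and g: "integrable lborel g"
    and W: "\<And>\<phi> i. test_function X \<phi> \<Longrightarrow> i \<in> Basis \<Longrightarrow>
       (LINT x|lborel. f x * frechet_derivative \<phi> (at x) i) = - (LINT x|lborel. (g x \<bullet> i) * \<phi> x)"
    and U: "open U" and seg: "\<And>x t. x \<in> U \<Longrightarrow> 0 \<le> t \<Longrightarrow> t \<le> 1 \<Longrightarrow> x + t *\<^sub>R h \<in> X"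
  shows "AE x in lborel. x \<in> U \<longrightarrow> f (x + h) - f x = (LINT t:{0..1}|lborel. g (x + t *\<^sub>R h) \<bullet> h)"
proof -
  obtain \<D> where \<D>: "countable \<D>" "\<D> \<subseteq> Pow U" "\<And>Y. Y \<in> \<D> \<Longrightarrow> \<exists>a b. Y = cbox a b" "\<Union>\<D> = U"
    using open_countable_Union_open_cbox[OF U] by metis
  have "AE x in lborel. \<forall>Y\<in>\<D>. x \<in> Y \<longrightarrow> f (x + h) - f x = (LINT t:{0..1}|lborel. g (x + t *\<^sub>R h) \<bullet> h)"
  proof (rule AE_ball_countable[THEN iffD2, OF \<D>(1)], intro ballI)
    fix Y assume Y: "Y \<in> \<D>"
    then obtain a b where ab: "Y = cbox a b" using \<D>(3) by blast
    have "cbox a b - box a b \<in> null_sets lborel"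
      using negligible_frontier_interval[of a b]
      by (simp add: negligible_iff_null_sets null_sets_completion_iff)
    then have "AE x in lborel. x \<notin> cbox a b - box a b" by (rule AE_not_in)
    moreover have "AE x in lborel. x \<in> box a b \<longrightarrow> f (x + h) - f x = (LINT t:{0..1}|lborel. g (x + t *\<^sub>R h) \<bullet> h)"
      by (rule weak_ftc_box[OF f g W]) (use seg \<D>(2) Y ab in auto)
    ultimately show "AE x in lborel. x \<in> Y \<longrightarrow> f (x + h) - f x = (LINT t:{0..1}|lborel. g (x + t *\<^sub>R h) \<bullet> h)"
      by eventually_elim (auto simp: ab)
  qed
  then show ?thesis
    by eventually_elim (use \<D>(4) in blast)
qed

definition sq_int :: "'a::euclidean_space set \<Rightarrow> ('a \<Rightarrow> 'a) \<Rightarrow> ennreal" where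
  "sq_int D g = (\<integral>\<^sup>+x. ennreal (of_bool (x \<in> D) * (norm (g x))\<^sup>2) \<partial>lborel)"

text \<open>The fundamental theorem is squared, Cauchy-Schwarz applied in \<open>t\<close> and the
  integrals exchanged; each translate contributes at most the integral over \<open>D\<close>. A set
  \<open>D\<close> smaller than \<open>X\<close> is what allows summation over cells.\<close>

lemma sobolev_translate:
  fixes f :: "'a::euclidean_space \<Rightarrow> real" and g :: "'a \<Rightarrow> 'a"
  assumes f: "integrable lborel f" and g: "integrable lborel g"
    and W: "\<And>\<phi> i. test_function X \<phi> \<Longrightarrow> i \<in> Basis \<Longrightarrow>
       (LINT x|lborel. f x * frechet_derivative \<phi> (at x) i) = - (LINT x|lborel. (g x \<bullet> i) * \<phi> x)"
    and U: "open U" and D[measurable]: "D \<in> sets borel" and DX: "D \<subseteq> X"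
    and seg: "\<And>x t. x \<in> U \<Longrightarrow> 0 \<le> t \<Longrightarrow> t \<le> 1 \<Longrightarrow> x + t *\<^sub>R h \<in> D"
  shows "(\<integral>\<^sup>+x. ennreal (of_bool (x \<in> U) * (f (x + h) - f x)\<^sup>2) \<partial>lborel) \<le> ennreal ((norm h)\<^sup>2) * sq_int D g"
proof -
  have [measurable]: "f \<in> borel_measurable borel" "g \<in> borel_measurable borel" "U \<in> sets borel" using f g U by auto
  define R where "R t x = ennreal (of_bool (t \<in> {0..1 :: real} \<and> x + t *\<^sub>R h \<in> D) * ((norm h)\<^sup>2 * (norm (g (x + t *\<^sub>R h)))\<^sup>2))" for t x
  have [measurable]: "(\<lambda>(t, x). R t x) \<in> borel_measurable (lborel \<Otimes>\<^sub>M lborel)"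
    unfolding R_def by measurable
  have [measurable]: "(\<lambda>(x, t). R t x) \<in> borel_measurable (lborel \<Otimes>\<^sub>M lborel)"
    unfolding R_def by measurable
  have "AE x in lborel. x \<in> U \<longrightarrow> f (x + h) - f x = (LINT t:{0..1}|lborel. g (x + t *\<^sub>R h) \<bullet> h)"
    by (rule weak_ftc_open[OF f g W U]) (use seg DX in auto)
  then have "(\<integral>\<^sup>+x. ennreal (of_bool (x \<in> U) * (f (x + h) - f x)\<^sup>2) \<partial>lborel) \<le> (\<integral>\<^sup>+x. \<integral>\<^sup>+t. R t x \<partial>lborel \<partial>lborel)"
  proof (intro nn_integral_mono_AE, eventually_elim)
    fix x assume eq: "x \<in> U \<longrightarrow> f (x + h) - f x = (LINT t:{0..1}|lborel. g (x + t *\<^sub>R h) \<bullet> h)"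
    show "ennreal (of_bool (x \<in> U) * (f (x + h) - f x)\<^sup>2) \<le> (\<integral>\<^sup>+t. R t x \<partial>lborel)"
    proof (cases "x \<in> U")
      case True
      have "ennreal (of_bool (x \<in> U) * (f (x + h) - f x)\<^sup>2) = ennreal ((LINT t:{0..1}|lborel. g (x + t *\<^sub>R h) \<bullet> h)\<^sup>2)"
        using True eq by simp
      also have "\<dots> \<le> (\<integral>\<^sup>+t. ennreal (of_bool (t \<in> {0..1}) * (g (x + t *\<^sub>R h) \<bullet> h)\<^sup>2) \<partial>lborel)"
        by (rule square_integral_unit_interval_le) measurable
      also have "\<dots> \<le> (\<integral>\<^sup>+t. R t x \<partial>lborel)"
      proof (rule nn_integral_mono)
        fix t :: real
        have "(g (x + t *\<^sub>R h) \<bullet> h)\<^sup>2 \<le> (norm h)\<^sup>2 * (norm (g (x + t *\<^sub>R h)))\<^sup>2"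
          using Cauchy_Schwarz_ineq2[of "g (x + t *\<^sub>R h)" h]
          by (simp add: abs_le_square_iff[symmetric] power_mult_distrib[symmetric] abs_mult mult.commute)
        then show "ennreal (of_bool (t \<in> {0..1}) * (g (x + t *\<^sub>R h) \<bullet> h)\<^sup>2) \<le> R t x"
          unfolding R_def using seg[OF True] by (intro ennreal_leI) auto
      qed
      finally show ?thesis .
    qed simp
  qed
  also have "\<dots> = (\<integral>\<^sup>+t. \<integral>\<^sup>+x. R t x \<partial>lborel \<partial>lborel)"
    by (rule lborel_pair.Fubini') measurable
  also have "\<dots> = (\<integral>\<^sup>+t. (ennreal ((norm h)\<^sup>2) * sq_int D g) * indicator {0..1 :: real} t \<partial>lborel)"
  proof (rule nn_integral_cong)
    fix t :: real
    have "(\<integral>\<^sup>+x. ennreal ((norm h)\<^sup>2) * ennreal (of_bool (t *\<^sub>R h + x \<in> D) * (norm (g (t *\<^sub>R h + x)))\<^sup>2) \<partial>lborel)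
      = ennreal ((norm h)\<^sup>2) * sq_int D g"
      unfolding sq_int_def
      by (subst nn_integral_lborel_translate[of "\<lambda>x. ennreal ((norm h)\<^sup>2) * ennreal (of_bool (x \<in> D) * (norm (g x))\<^sup>2)"])
         (auto intro!: nn_integral_cmult)
    then show "(\<integral>\<^sup>+x. R t x \<partial>lborel) = (ennreal ((norm h)\<^sup>2) * sq_int D g) * indicator {0..1} t"
      by (auto simp: R_def indicator_def add.commute ennreal_mult[symmetric] mult_ac)
  qed
  also have "\<dots> = ennreal ((norm h)\<^sup>2) * sq_int D g"
    by (subst nn_integral_cmult_indicator) auto
  finally show ?thesis .
qed

context lipschitz_domain
begin

text \<open>Substituting \<open>q = x + h\<close> freezes the displacement, and for each
  \<open>h\<close> the admissible \<open>x\<close> form an open set to which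
  \<open>sobolev_translate\<close> applies. The displacements lie in a ball of radius
  \<open>(\<kappa> + 4) s\<close>, whose volume is the remaining factor.\<close>

lemma sobolev_cell_pivot:
  fixes f :: "'a \<Rightarrow> real" and g :: "'a \<Rightarrow> 'a"
  assumes f: "integrable lborel f" and g: "integrable lborel g"
    and W: "\<And>\<phi> i. test_function X \<phi> \<Longrightarrow> i \<in> Basis \<Longrightarrow>
       (LINT x|lborel. f x * frechet_derivative \<phi> (at x) i) = - (LINT x|lborel. (g x \<bullet> i) * \<phi> x)"
    and z: "z \<in> X" "0 < s" "s \<le> s0"
  shows "(\<integral>\<^sup>+x. \<integral>\<^sup>+q. ennreal (of_bool (x \<in> cell s z \<and> q \<in> piv s z) * (f x - f q)\<^sup>2) \<partial>lborel \<partial>lborel)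
     \<le> ennreal (((\<kappa> + 3) * s)\<^sup>2 * (V * ((\<kappa> + 4) * s) ^ DIM('a))) * sq_int (cell' s z) g"
proof -
  have [measurable]: "f \<in> borel_measurable borel" "g \<in> borel_measurable borel" "X \<in> sets borel"
    using f g open_X by auto
  define G where "G x q = ennreal (of_bool (x \<in> cell s z \<and> q \<in> piv s z) * (f x - f q)\<^sup>2)" for x q
  have "(\<integral>\<^sup>+x. \<integral>\<^sup>+q. G x q \<partial>lborel \<partial>lborel) = (\<integral>\<^sup>+x. \<integral>\<^sup>+h. G x (x + h) \<partial>lborel \<partial>lborel)"
    unfolding G_def by (intro nn_integral_cong nn_integral_lborel_translate[symmetric]) measurable
  also have "\<dots> = (\<integral>\<^sup>+h. \<integral>\<^sup>+x. G x (x + h) \<partial>lborel \<partial>lborel)"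
    unfolding G_def by (rule lborel_pair.Fubini'[symmetric]) measurable
  also have "\<dots> \<le> (\<integral>\<^sup>+h. (ennreal (((\<kappa> + 3) * s)\<^sup>2) * sq_int (cell' s z) g) * indicator (ball (0 :: 'a) ((\<kappa> + 4) * s)) h \<partial>lborel)"
  proof (rule nn_integral_mono)
    fix h :: 'a
    define U where "U = {x \<in> cell s z. x + h \<in> piv s z}"
    show "(\<integral>\<^sup>+x. G x (x + h) \<partial>lborel) \<le> (ennreal (((\<kappa> + 3) * s)\<^sup>2) * sq_int (cell' s z) g) * indicator (ball (0 :: 'a) ((\<kappa> + 4) * s)) h"
    proof (cases "U = {}")
      case True
      then have "G x (x + h) = 0" for x unfolding G_def U_def by auto
      then show ?thesis by simp
    next
      case False
      then obtain x where x: "x \<in> cell s z" "x + h \<in> piv s z" unfolding U_def by blast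
      have h: "norm h \<le> (\<kappa> + 3) * s"
        using cell_path(2)[OF z x] by (simp add: dist_norm)
      have "openin euclidean U"
      proof -
        have "U = cell s z \<inter> (\<lambda>x. x + h) -` piv s z" by (auto simp: U_def)
        moreover have "open ((\<lambda>x. x + h) -` piv s z)"
          by (intro open_vimage open_ball continuous_intros)
        ultimately show ?thesis using open_X by auto
      qed
      then have "(\<integral>\<^sup>+x. ennreal (of_bool (x \<in> U) * (f (x + h) - f x)\<^sup>2) \<partial>lborel) \<le> ennreal ((norm h)\<^sup>2) * sq_int (cell' s z) g"
      proof (intro sobolev_translate[OF f g W])
        show "x + t *\<^sub>R h \<in> cell' s z" if "x \<in> U" "0 \<le> t" "t \<le> 1" for x t
          using cell_path(1)[OF z, of x "x + h" t] that unfolding U_def by simp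
      qed (use open_X in auto)
      also have "\<dots> \<le> ennreal (((\<kappa> + 3) * s)\<^sup>2) * sq_int (cell' s z) g"
        using h by (intro mult_right_mono ennreal_leI power_mono) auto
      also have "(\<integral>\<^sup>+x. ennreal (of_bool (x \<in> U) * (f (x + h) - f x)\<^sup>2) \<partial>lborel) = (\<integral>\<^sup>+x. G x (x + h) \<partial>lborel)"
        unfolding G_def U_def by (intro nn_integral_cong) (auto simp: power2_commute)
      finally have "(\<integral>\<^sup>+x. G x (x + h) \<partial>lborel) \<le> ennreal (((\<kappa> + 3) * s)\<^sup>2) * sq_int (cell' s z) g" .
      moreover have "(\<kappa> + 3) * s < (\<kappa> + 4) * s" using z by (intro mult_strict_right_mono) auto
      then have "h \<in> ball 0 ((\<kappa> + 4) * s)" using h unfolding mem_ball dist_norm by simp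
      ultimately show ?thesis by simp
    qed
  qed
  also have "\<dots> = ennreal (((\<kappa> + 3) * s)\<^sup>2) * sq_int (cell' s z) g * emeasure lborel (ball (0 :: 'a) ((\<kappa> + 4) * s))"
    by (subst nn_integral_cmult_indicator) auto
  also have "emeasure lborel (ball (0 :: 'a) ((\<kappa> + 4) * s)) = ennreal (V * ((\<kappa> + 4) * s) ^ DIM('a))"
    using z \<kappa> measure_ball[of "(\<kappa> + 4) * s" 0]
    by (subst emeasure_eq_ennreal_measure) (auto simp: emeasure_bounded_less_top less_imp_neq)
  also have "ennreal (((\<kappa> + 3) * s)\<^sup>2) * sq_int (cell' s z) g * ennreal (V * ((\<kappa> + 4) * s) ^ DIM('a))
     = ennreal (((\<kappa> + 3) * s)\<^sup>2 * (V * ((\<kappa> + 4) * s) ^ DIM('a))) * sq_int (cell' s z) g"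
    using V_pos z \<kappa> by (subst ennreal_mult) (auto simp: mult_ac)
  finally show ?thesis unfolding G_def .
qed

text \<open>Two points of a cell may not see each other inside \<open>X\<close>, but both see the
  pivot ball, so \<open>f q\<close> is inserted and averaged over \<open>q\<close>. The constant is
  the volume ratio \<open>2 ^ DIM('a)\<close> of the two balls, times 2 for the square of a sum and
  2 for the two symmetric terms.\<close>

lemma cell_pair_le_pivot:
  fixes f :: "'a \<Rightarrow> real"
  assumes [measurable]: "f \<in> borel_measurable borel" and s: "0 < s"
  shows "(\<integral>\<^sup>+x. \<integral>\<^sup>+y. ennreal (of_bool (x \<in> cell s z \<and> y \<in> cell s z) * (f x - f y)\<^sup>2) \<partial>lborel \<partial>lborel)
     \<le> ennreal (4 * 2 ^ DIM('a)) * (\<integral>\<^sup>+x. \<integral>\<^sup>+q. ennreal (of_bool (x \<in> cell s z \<and> q \<in> piv s z) * (f x - f q)\<^sup>2) \<partial>lborel \<partial>lborel)"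
proof -
  have [measurable]: "X \<in> sets borel" using open_X by simp
  define vQ where "vQ = V * s ^ DIM('a)"
  have vQ: "0 < vQ" using V_pos s by (simp add: vQ_def)
  have eb: "emeasure lborel (ball c R) = ennreal (V * R ^ DIM('a))" if "0 \<le> R" for c :: 'a and R
    using measure_ball[OF that, of c]
    by (subst emeasure_eq_ennreal_measure) (auto simp: emeasure_bounded_less_top less_imp_neq)
  define J where "J x = (\<integral>\<^sup>+q. ennreal (of_bool (x \<in> cell s z \<and> q \<in> piv s z) * (f x - f q)\<^sup>2) \<partial>lborel)" for x
  have [measurable]: "J \<in> borel_measurable borel" unfolding J_def by measurable
  let ?B = "indicator (ball z (2 * s)) :: 'a \<Rightarrow> ennreal"
  have pw: "ennreal (of_bool (x \<in> cell s z \<and> y \<in> cell s z) * (f x - f y)\<^sup>2) \<le> ennreal (2 / vQ) * (J x * ?B y + J y * ?B x)" for x y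
  proof (cases "x \<in> cell s z \<and> y \<in> cell s z")
    case True
    have "ennreal vQ * ennreal ((f x - f y)\<^sup>2) = (\<integral>\<^sup>+q. ennreal ((f x - f y)\<^sup>2) * indicator (piv s z) q \<partial>lborel)"
      using s by (subst nn_integral_cmult_indicator) (auto simp: eb vQ_def mult.commute)
    also have "\<dots> \<le> (\<integral>\<^sup>+q. 2 * ennreal (of_bool (x \<in> cell s z \<and> q \<in> piv s z) * (f x - f q)\<^sup>2)
        + 2 * ennreal (of_bool (y \<in> cell s z \<and> q \<in> piv s z) * (f y - f q)\<^sup>2) \<partial>lborel)"
    proof (rule nn_integral_mono)
      fix q
      have "(f x - f y)\<^sup>2 \<le> 2 * (f x - f q)\<^sup>2 + 2 * (f y - f q)\<^sup>2"
        using square_diff_le[of "f x - f q" "f y - f q"] by simp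
      then have "ennreal ((f x - f y)\<^sup>2) \<le> ennreal (2 * (f x - f q)\<^sup>2 + 2 * (f y - f q)\<^sup>2)" by (rule ennreal_leI)
      also have "\<dots> = 2 * ennreal ((f x - f q)\<^sup>2) + 2 * ennreal ((f y - f q)\<^sup>2)"
        by (simp add: ennreal_mult)
      finally show "ennreal ((f x - f y)\<^sup>2) * indicator (piv s z) q \<le> 2 * ennreal (of_bool (x \<in> cell s z \<and> q \<in> piv s z) * (f x - f q)\<^sup>2)
        + 2 * ennreal (of_bool (y \<in> cell s z \<and> q \<in> piv s z) * (f y - f q)\<^sup>2)"
        using True by (auto simp: indicator_def)
    qed
    also have "\<dots> = 2 * J x + 2 * J y"
      unfolding J_def by (subst nn_integral_add, measurable, subst nn_integral_cmult, measurable, subst nn_integral_cmult, measurable)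
    finally have le: "ennreal vQ * ennreal ((f x - f y)\<^sup>2) \<le> 2 * J x + 2 * J y" .
    have "ennreal ((f x - f y)\<^sup>2) = ennreal (1 / vQ) * (ennreal vQ * ennreal ((f x - f y)\<^sup>2))"
      using vQ by (simp add: ennreal_mult[symmetric])
    also have "\<dots> \<le> ennreal (1 / vQ) * (2 * J x + 2 * J y)" by (intro mult_left_mono le) simp
    also have "\<dots> = ennreal (2 / vQ) * (J x + J y)"
    proof -
      have "ennreal (2 / vQ) = ennreal (1 / vQ) * 2" using vQ by (simp add: ennreal_mult[symmetric] flip: ennreal_numeral)
      then show ?thesis by (simp add: distrib_left mult_ac)
    qed
    finally show ?thesis using True by simp
  qed auto
  have "(\<integral>\<^sup>+x. \<integral>\<^sup>+y. ennreal (of_bool (x \<in> cell s z \<and> y \<in> cell s z) * (f x - f y)\<^sup>2) \<partial>lborel \<partial>lborel)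
     \<le> (\<integral>\<^sup>+x. \<integral>\<^sup>+y. ennreal (2 / vQ) * (J x * ?B y + J y * ?B x) \<partial>lborel \<partial>lborel)"
    by (intro nn_integral_mono pw)
  also have "\<dots> = (\<integral>\<^sup>+x. ennreal (2 / vQ) * (J x * ennreal (V * (2 * s) ^ DIM('a)) + (\<integral>\<^sup>+y. J y \<partial>lborel) * ?B x) \<partial>lborel)"
    using s by (intro nn_integral_cong)
      (subst nn_integral_cmult, measurable, subst nn_integral_add, measurable, subst nn_integral_cmult, measurable,
       subst nn_integral_multc, measurable, simp add: eb)
  also have "\<dots> = ennreal (2 / vQ) * ((\<integral>\<^sup>+x. J x \<partial>lborel) * ennreal (V * (2 * s) ^ DIM('a)) + (\<integral>\<^sup>+y. J y \<partial>lborel) * ennreal (V * (2 * s) ^ DIM('a)))"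
    using s by (subst nn_integral_cmult, measurable, subst nn_integral_add, measurable, subst nn_integral_multc, measurable,
       subst nn_integral_cmult, measurable) (simp add: eb)
  also have "\<dots> = (ennreal (2 / vQ) * ennreal (V * (2 * s) ^ DIM('a)) * 2) * (\<integral>\<^sup>+x. J x \<partial>lborel)"
  proof -
    have "a * (b * e + b * e) = (a * e * 2) * b" for a b e :: ennreal
      unfolding mult_2_right[of "b * e", symmetric] by (simp only: mult_ac)
    then show ?thesis .
  qed
  also have "ennreal (2 / vQ) * ennreal (V * (2 * s) ^ DIM('a)) * 2 = ennreal (4 * 2 ^ DIM('a))"
  proof -
    have "2 / vQ * (V * (2 * s) ^ DIM('a)) * 2 = 4 * 2 ^ DIM('a)"
      using V_pos s by (simp add: vQ_def power_mult_distrib field_simps)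
    moreover have "ennreal (2 / vQ) * ennreal (V * (2 * s) ^ DIM('a)) * 2 = ennreal (2 / vQ * (V * (2 * s) ^ DIM('a)) * 2)"
    proof -
      have "0 \<le> V * (2 * s) ^ DIM('a)" "0 \<le> 2 / vQ" using vQ V_pos s by auto
      then have "ennreal (2 / vQ * (V * (2 * s) ^ DIM('a)) * 2) = ennreal (2 / vQ) * ennreal (V * (2 * s) ^ DIM('a)) * ennreal 2"
        by (simp only: ennreal_mult mult_nonneg_nonneg zero_le_numeral)
      then show ?thesis by simp
    qed
    ultimately show ?thesis by simp
  qed
  finally show ?thesis unfolding J_def .
qed

definition sobolev_const :: real where
  "sobolev_const = 4 * 2 ^ DIM('a) * ((\<kappa> + 3)\<^sup>2 * (V * (\<kappa> + 4) ^ DIM('a))) * (2 * \<kappa> + 5) ^ DIM('a)"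

lemma sobolev_const_pos: "0 < sobolev_const"
  using V_pos \<kappa> by (simp add: sobolev_const_def)

text \<open>Points at distance at most \<open>s\<close> share a cell, since the first is within
  \<open>s\<close> of a net point and cells have radius \<open>2 s\<close>. The power of
  \<open>s\<close> is a squared displacement times the volume of the set of displacements.\<close>

lemma nonlocal_energy_le_sobolev:
  fixes f :: "'a \<Rightarrow> real" and g :: "'a \<Rightarrow> 'a"
  assumes f: "integrable lborel f" and g: "integrable lborel g"
    and W: "\<And>\<phi> i. test_function X \<phi> \<Longrightarrow> i \<in> Basis \<Longrightarrow>
       (LINT x|lborel. f x * frechet_derivative \<phi> (at x) i) = - (LINT x|lborel. (g x \<bullet> i) * \<phi> x)"
    and s: "0 < s" "s \<le> s0"
  shows "nonlocal_energy X s f \<le> ennreal (sobolev_const * s ^ (DIM('a) + 2)) * sq_int X g"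
proof -
  have [measurable]: "f \<in> borel_measurable borel" "g \<in> borel_measurable borel" "X \<in> sets borel"
    using f g open_X by auto
  obtain Z where Z: "finite Z" "Z \<subseteq> X" "separated s Z" "\<And>x. x \<in> X \<Longrightarrow> \<exists>z\<in>Z. dist z x < s"
    using ex_net[OF s] by metis
  define c where "c = ((\<kappa> + 3) * s)\<^sup>2 * (V * ((\<kappa> + 4) * s) ^ DIM('a))"
  have c: "0 \<le> c" using V_pos s \<kappa> by (simp add: c_def)
  let ?e = "\<lambda>z x y. ennreal (of_bool (x \<in> cell s z \<and> y \<in> cell s z) * (f x - f y)\<^sup>2)"
  have "nonlocal_energy X s f \<le> (\<integral>\<^sup>+x. \<integral>\<^sup>+y. (\<Sum>z\<in>Z. ?e z x y) \<partial>lborel \<partial>lborel)"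
    unfolding nonlocal_energy_def
  proof (intro nn_integral_mono)
    fix x y
    show "ennreal (of_bool (x \<in> X \<and> y \<in> X \<and> dist x y \<le> s) * (f x - f y)\<^sup>2) \<le> (\<Sum>z\<in>Z. ?e z x y)"
    proof (cases "x \<in> X \<and> y \<in> X \<and> dist x y \<le> s")
      case True
      then obtain z where z: "z \<in> Z" "dist z x < s" using Z(4) by blast
      then have "dist z y < 2 * s" "dist z x < 2 * s" using dist_triangle[of z y x] True s by auto
      then have "ennreal (of_bool (x \<in> X \<and> y \<in> X \<and> dist x y \<le> s) * (f x - f y)\<^sup>2) = ?e z x y"
        using True by simp
      also have "\<dots> \<le> (\<Sum>z\<in>Z. ?e z x y)" using z(1) Z(1) by (intro member_le_sum) auto
      finally show ?thesis .
    qed auto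
  qed
  also have "\<dots> = (\<Sum>z\<in>Z. \<integral>\<^sup>+x. \<integral>\<^sup>+y. ?e z x y \<partial>lborel \<partial>lborel)"
    by (subst nn_integral_sum[symmetric], measurable) (intro nn_integral_cong nn_integral_sum, measurable)
  also have "\<dots> \<le> (\<Sum>z\<in>Z. ennreal (4 * 2 ^ DIM('a)) * (ennreal c * sq_int (cell' s z) g))"
    using Z(2) s
    by (intro sum_mono order_trans[OF cell_pair_le_pivot] mult_left_mono order_trans[OF sobolev_cell_pivot[OF f g W]])
       (auto simp: c_def)
  also have "\<dots> = ennreal (4 * 2 ^ DIM('a)) * ennreal c * (\<Sum>z\<in>Z. sq_int (cell' s z) g)"
    by (simp add: sum_distrib_left mult.assoc)
  also have "(\<Sum>z\<in>Z. sq_int (cell' s z) g) \<le> ennreal ((2 * \<kappa> + 5) ^ DIM('a)) * sq_int X g"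
  proof -
    have "(\<Sum>z\<in>Z. sq_int (cell' s z) g) = (\<integral>\<^sup>+x. (\<Sum>z\<in>Z. ennreal (of_bool (x \<in> cell' s z) * (norm (g x))\<^sup>2)) \<partial>lborel)"
      unfolding sq_int_def by (rule nn_integral_sum[symmetric]) measurable
    also have "\<dots> \<le> (\<integral>\<^sup>+x. ennreal ((2 * \<kappa> + 5) ^ DIM('a)) * ennreal (of_bool (x \<in> X) * (norm (g x))\<^sup>2) \<partial>lborel)"
    proof (rule nn_integral_mono)
      fix x
      have "(\<Sum>z\<in>Z. of_bool (x \<in> cell' s z) * (norm (g x))\<^sup>2) = (\<Sum>z\<in>Z. of_bool (dist z x < (\<kappa> + 2) * s)) * (of_bool (x \<in> X) * (norm (g x))\<^sup>2)"
        unfolding sum_distrib_right by (intro sum.cong) auto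
      also have "(\<Sum>z\<in>Z. of_bool (dist z x < (\<kappa> + 2) * s)) = real (card {z \<in> Z. dist z x < (\<kappa> + 2) * s})"
        using Z(1) by (simp add: Int_def conj_commute)
      also have "\<dots> * (of_bool (x \<in> X) * (norm (g x))\<^sup>2) \<le> (2 * \<kappa> + 5) ^ DIM('a) * (of_bool (x \<in> X) * (norm (g x))\<^sup>2)"
        using card_separated_ball_le[OF Z(1,3) s(1), of "\<kappa> + 2" x] \<kappa> by (intro mult_right_mono) (auto simp: algebra_simps)
      finally show "(\<Sum>z\<in>Z. ennreal (of_bool (x \<in> cell' s z) * (norm (g x))\<^sup>2))
        \<le> ennreal ((2 * \<kappa> + 5) ^ DIM('a)) * ennreal (of_bool (x \<in> X) * (norm (g x))\<^sup>2)"
        using \<kappa> by (subst sum_ennreal) (auto simp: ennreal_mult[symmetric] intro!: ennreal_leI)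
    qed
    also have "\<dots> = ennreal ((2 * \<kappa> + 5) ^ DIM('a)) * sq_int X g"
      unfolding sq_int_def by (rule nn_integral_cmult) measurable
    finally show ?thesis .
  qed
  finally have "nonlocal_energy X s f \<le> ennreal (4 * 2 ^ DIM('a)) * ennreal c * (ennreal ((2 * \<kappa> + 5) ^ DIM('a)) * sq_int X g)"
    by (simp add: mult_left_mono)
  also have "\<dots> = ennreal (4 * 2 ^ DIM('a) * c * (2 * \<kappa> + 5) ^ DIM('a)) * sq_int X g"
    using c \<kappa> by (simp add: ennreal_mult mult.assoc)
  also have "4 * 2 ^ DIM('a) * c * (2 * \<kappa> + 5) ^ DIM('a) = sobolev_const * s ^ (DIM('a) + 2)"
    by (simp add: c_def sobolev_const_def power_mult_distrib power_add power2_eq_square mult_ac)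
  finally show ?thesis .
qed

end

section \<open>Borel representatives of Sobolev functions\<close>

lemma L2_borel_representative:
  fixes F :: "'a::euclidean_space \<Rightarrow> 'b::euclidean_space"
  assumes X: "open X" and F: "F \<in> L2_space X"
  obtains G where "G \<in> borel_measurable borel" "\<And>x. x \<notin> X \<Longrightarrow> G x = 0"
    "AE x in lborel. (if x \<in> X then F x else 0) = G x"
    "(\<lambda>x. if x \<in> X then F x else 0) \<in> borel_measurable lebesgue"
proof -
  have [measurable]: "X \<in> sets borel" using X by simp
  have m: "(\<lambda>x. if x \<in> X then F x else 0) \<in> borel_measurable lebesgue"
    using F X by (intro borel_measurable_if_I) (auto simp: L2_space_def)
  have "\<exists>h\<in>borel_measurable lborel. AE x in lborel. (if x \<in> X then F x else 0) \<bullet> i = h x" for i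
    using m by (intro completion_ex_borel_measurable_real) auto
  then obtain h where h: "\<And>i. h i \<in> borel_measurable borel"
    "\<And>i. AE x in lborel. (if x \<in> X then F x else 0) \<bullet> i = h i x" by (metis measurable_lborel2)
  define G where "G x = (if x \<in> X then \<Sum>i\<in>Basis. h i x *\<^sub>R i else 0)" for x
  have [measurable]: "h i \<in> borel_measurable borel" for i by (rule h)
  have "AE x in lborel. \<forall>i\<in>Basis. (if x \<in> X then F x else 0) \<bullet> i = h i x"
    using h(2) by (simp add: AE_finite_all)
  then have "AE x in lborel. (if x \<in> X then F x else 0) = G x"
  proof eventually_elim
    fix x assume eq: "\<forall>i\<in>Basis. (if x \<in> X then F x else 0) \<bullet> i = h i x"
    show "(if x \<in> X then F x else 0) = G x"
      using eq euclidean_representation[of "F x"] by (auto simp: G_def intro!: sum.cong cong: sum.cong)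
  qed
  moreover have "G \<in> borel_measurable borel" unfolding G_def by measurable
  ultimately show thesis using m by (intro that[of G]) (auto simp: G_def)
qed

lemma integral_lebesgue_on_eq_lborel:
  fixes F G :: "'a::euclidean_space \<Rightarrow> real"
  assumes X: "open X" and G: "G \<in> borel_measurable borel"
    and F: "(\<lambda>x. if x \<in> X then F x else 0) \<in> borel_measurable lebesgue"
    and eq: "AE x in lborel. (if x \<in> X then F x else 0) = G x"
  shows "integral\<^sup>L (lebesgue_on X) F = integral\<^sup>L lborel G"
proof -
  have "integral\<^sup>L (lebesgue_on X) F = (\<integral>x. indicator X x *\<^sub>R F x \<partial>lebesgue)"
    using X by (intro integral_restrict_space) auto
  also have "\<dots> = (\<integral>x. (if x \<in> X then F x else 0) \<partial>lebesgue)"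
    by (intro Bochner_Integration.integral_cong) (auto simp: indicator_def)
  also have "\<dots> = (\<integral>x. G x \<partial>lebesgue)"
    using F G AE_completion[OF eq] by (intro integral_cong_AE) (auto intro: measurable_completion)
  also have "\<dots> = integral\<^sup>L lborel G"
    using G by (intro integral_completion) auto
  finally show ?thesis .
qed

lemma nn_integral_representative:
  assumes X: "open X" and F: "F \<in> L2_space X" and G: "G \<in> borel_measurable borel"
    and eq: "AE x in lborel. (if x \<in> X then F x else 0) = G x"
  shows "(\<integral>\<^sup>+x. ennreal ((norm (G x))\<^sup>2) \<partial>lborel) = ennreal ((L2_norm_on X F)\<^sup>2)"
proof -
  have int: "integrable (lebesgue_on X) (\<lambda>x. (norm (F x))\<^sup>2)" using F by (simp add: L2_space_def)
  have "ennreal ((L2_norm_on X F)\<^sup>2) = ennreal (\<integral>x. (norm (F x))\<^sup>2 \<partial>lebesgue_on X)"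
    unfolding L2_norm_on_def by (subst real_sqrt_pow2) auto
  also have "\<dots> = (\<integral>\<^sup>+x. ennreal ((norm (F x))\<^sup>2) \<partial>lebesgue_on X)"
    by (rule nn_integral_eq_integral[symmetric, OF int]) simp
  also have "\<dots> = (\<integral>\<^sup>+x. ennreal ((norm (F x))\<^sup>2) * indicator X x \<partial>lebesgue)"
    using X by (intro nn_integral_restrict_space) auto
  also have "\<dots> = (\<integral>\<^sup>+x. ennreal ((norm (G x))\<^sup>2) \<partial>lebesgue)"
  proof (rule nn_integral_cong_AE)
    show "AE x in lebesgue. ennreal ((norm (F x))\<^sup>2) * indicator X x = ennreal ((norm (G x))\<^sup>2)"
      using AE_completion[OF eq]
    proof eventually_elim
      fix x assume "(if x \<in> X then F x else 0) = G x"
      then show "ennreal ((norm (F x))\<^sup>2) * indicator X x = ennreal ((norm (G x))\<^sup>2)"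
        by (cases "x \<in> X") auto
    qed
  qed
  also have "\<dots> = (\<integral>\<^sup>+x. ennreal ((norm (G x))\<^sup>2) \<partial>lborel)"
    by (rule nn_integral_completion)
  finally show ?thesis by simp
qed

lemma integrable_if_square_integrable:
  fixes G :: "'a::euclidean_space \<Rightarrow> 'b::euclidean_space"
  assumes X: "open X" "emeasure lborel X < \<infinity>" and G: "G \<in> borel_measurable borel" "\<And>x. x \<notin> X \<Longrightarrow> G x = 0"
    and fin: "(\<integral>\<^sup>+x. ennreal ((norm (G x))\<^sup>2) \<partial>lborel) < \<infinity>"
  shows "integrable lborel G"
proof (rule Bochner_Integration.integrable_bound)
  show "integrable lborel (\<lambda>x. indicator X x + (norm (G x))\<^sup>2)"
    using X G fin by (intro Bochner_Integration.integrable_add integrable_real_indicator integrableI_bounded) auto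
  show "AE x in lborel. norm (G x) \<le> norm (indicator X x + (norm (G x))\<^sup>2)"
  proof (intro AE_I2)
    fix x
    have "2 * norm (G x) \<le> 1 + (norm (G x))\<^sup>2"
      using zero_le_power2[of "norm (G x) - 1"] by (simp add: power2_eq_square algebra_simps)
    then have "norm (G x) \<le> 1 + (norm (G x))\<^sup>2"
      using norm_ge_zero[of "G x"] by linarith
    then show "norm (G x) \<le> norm (indicator X x + (norm (G x))\<^sup>2)"
      using G(2)[of x] by (cases "x \<in> X") auto
  qed
qed (use G in auto)

lemma ck_function_imp_measurable: "ck_function 0 \<phi> \<Longrightarrow> \<phi> \<in> borel_measurable borel"
  by (simp add: borel_measurable_continuous_onI)

text \<open>Members of the ball are only Lebesgue measurable, while Fubini on products of
  \<open>lborel\<close> needs Borel functions on the whole space. Extension by zero turns the weak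
  gradient identity into one over \<open>lborel\<close>, and finite volume makes the square
  integrable functions integrable.\<close>

lemma H1_ball_representative:
  fixes X :: "'a::euclidean_space set"
  assumes X: "open X" "emeasure lborel X < \<infinity>" and f0: "f0 \<in> H1_ball X M"
  obtains f g where "integrable lborel f" "integrable lborel g"
    "\<And>\<phi> i. test_function X \<phi> \<Longrightarrow> i \<in> Basis \<Longrightarrow>
       (LINT x|lborel. f x * frechet_derivative \<phi> (at x) i) = - (LINT x|lborel. (g x \<bullet> i) * \<phi> x)"
    "AE x in lborel. x \<in> X \<longrightarrow> f0 x = f x" "sq_int X g \<le> ennreal (M\<^sup>2)"
proof -
  define g0 where "g0 = weak_gradient X f0"
  have "\<exists>g. g \<in> L2_space X \<and> is_weak_gradient X f0 g" and f0L: "f0 \<in> L2_space X"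
    using f0 by (auto simp: H1_ball_def H1_space_def)
  from someI_ex[OF this(1)] have g0: "g0 \<in> L2_space X" "is_weak_gradient X f0 g0"
    unfolding g0_def weak_gradient_def by auto
  obtain f where f: "f \<in> borel_measurable borel" "\<And>x. x \<notin> X \<Longrightarrow> f x = 0"
    "AE x in lborel. (if x \<in> X then f0 x else 0) = f x"
    "(\<lambda>x. if x \<in> X then f0 x else 0) \<in> borel_measurable lebesgue"
    using L2_borel_representative[OF X(1) f0L] by blast
  obtain g where g: "g \<in> borel_measurable borel" "\<And>x. x \<notin> X \<Longrightarrow> g x = 0"
    "AE x in lborel. (if x \<in> X then g0 x else 0) = g x"
    "(\<lambda>x. if x \<in> X then g0 x else 0) \<in> borel_measurable lebesgue"
    using L2_borel_representative[OF X(1) g0(1)] by blast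
  have W: "(LINT x|lborel. f x * frechet_derivative \<phi> (at x) i) = - (LINT x|lborel. (g x \<bullet> i) * \<phi> x)"
    if \<phi>: "test_function X \<phi>" and i: "i \<in> Basis" for \<phi> i
  proof -
    have "ck_function 0 \<phi>" "ck_function (Suc 0) \<phi>" using \<phi> by (auto simp: test_function_def)
    then have m: "\<phi> \<in> borel_measurable borel" "(\<lambda>x. frechet_derivative \<phi> (at x) i) \<in> borel_measurable borel"
      using i by (auto intro!: ck_function_imp_measurable)
    then have ml: "\<phi> \<in> borel_measurable lebesgue" "(\<lambda>x. frechet_derivative \<phi> (at x) i) \<in> borel_measurable lebesgue"
      by (auto intro: measurable_completion)
    have "(\<integral>x. f0 x * frechet_derivative \<phi> (at x) i \<partial>lebesgue_on X) = (LINT x|lborel. f x * frechet_derivative \<phi> (at x) i)"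
    proof (rule integral_lebesgue_on_eq_lborel[OF X(1)])
      have "(\<lambda>x. (if x \<in> X then f0 x else 0) * frechet_derivative \<phi> (at x) i) \<in> borel_measurable lebesgue"
        by (intro borel_measurable_times f ml)
      then show "(\<lambda>x. if x \<in> X then f0 x * frechet_derivative \<phi> (at x) i else 0) \<in> borel_measurable lebesgue"
        by (rule measurable_cong[THEN iffD1, rotated]) auto
      show "AE x in lborel. (if x \<in> X then f0 x * frechet_derivative \<phi> (at x) i else 0) = f x * frechet_derivative \<phi> (at x) i"
        using f(3) by eventually_elim (auto split: if_splits)
    qed (use f m in auto)
    moreover have "(\<integral>x. (g0 x \<bullet> i) * \<phi> x \<partial>lebesgue_on X) = (LINT x|lborel. (g x \<bullet> i) * \<phi> x)"
    proof (rule integral_lebesgue_on_eq_lborel[OF X(1)])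
      have "(\<lambda>x. ((if x \<in> X then g0 x else 0) \<bullet> i) * \<phi> x) \<in> borel_measurable lebesgue"
        by (intro borel_measurable_times borel_measurable_inner borel_measurable_const g ml)
      then show "(\<lambda>x. if x \<in> X then g0 x \<bullet> i * \<phi> x else 0) \<in> borel_measurable lebesgue"
        by (rule measurable_cong[THEN iffD1, rotated]) auto
      show "AE x in lborel. (if x \<in> X then g0 x \<bullet> i * \<phi> x else 0) = g x \<bullet> i * \<phi> x"
        using g(3) by eventually_elim (auto split: if_splits)
    qed (use g m in auto)
    ultimately show ?thesis
      using g0(2) \<phi> i unfolding is_weak_gradient_def by auto
  qed
  have nf: "(\<integral>\<^sup>+x. ennreal ((norm (f x))\<^sup>2) \<partial>lborel) = ennreal ((L2_norm_on X f0)\<^sup>2)"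
    by (rule nn_integral_representative[OF X(1) f0L f(1,3)])
  have ng: "(\<integral>\<^sup>+x. ennreal ((norm (g x))\<^sup>2) \<partial>lborel) = ennreal ((L2_norm_on X g0)\<^sup>2)"
    by (rule nn_integral_representative[OF X(1) g0(1) g(1,3)])
  have "0 \<le> L2_norm_on X f0" "0 \<le> L2_norm_on X g0"
    by (auto simp: L2_norm_on_def intro!: integral_nonneg_AE)
  then have "(L2_norm_on X g0)\<^sup>2 \<le> (H1_norm X f0)\<^sup>2"
    unfolding H1_norm_def H1_seminorm_def g0_def[symmetric] by (intro power_mono) auto
  also have "\<dots> \<le> M\<^sup>2" using f0 by (simp add: H1_ball_def)
  finally have le: "(L2_norm_on X g0)\<^sup>2 \<le> M\<^sup>2" .
  have "sq_int X g = (\<integral>\<^sup>+x. ennreal ((norm (g x))\<^sup>2) \<partial>lborel)"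
    unfolding sq_int_def by (intro nn_integral_cong) (use g(2) in auto)
  then have "sq_int X g \<le> ennreal (M\<^sup>2)" using ng le by (simp add: ennreal_leI)
  moreover have "AE x in lborel. x \<in> X \<longrightarrow> f0 x = f x" using f(3) by eventually_elim auto
  moreover have "integrable lborel f"
    by (rule integrable_if_square_integrable[OF X f(1,2)]) (use nf in simp_all)
  moreover have "integrable lborel g"
    by (rule integrable_if_square_integrable[OF X g(1,2)]) (simp_all add: ng)
  ultimately show thesis using W by (intro that[of f g])
qed

text \<open>At the scales \<open>s = 2 ^ j * r\<close> the count \<open>B / s ^ d\<close> meets
  summands of size \<open>s ^ 4 / \<sigma> ^ 4\<close>. Their products grow geometrically with
  \<open>s\<close> because \<open>d < 4\<close>, so the largest scale, within a factor 2 of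
  \<open>min \<sigma> s0\<close>, dominates. The eigenvalues below the threshold of that scale
  contribute at most 1 each.\<close>

lemma sum_inverse_square_bound:
  fixes lam :: "nat \<Rightarrow> real" and a \<sigma> s0 r A B \<rho> :: real
  assumes lam: "\<And>k. 0 \<le> lam k" and d: "d \<le> 3" and pos: "0 < A" "0 < B" "0 < a" "0 < r" "0 < \<rho>"
    and count: "\<And>s. r \<le> s \<Longrightarrow> s \<le> s0 \<Longrightarrow> real (card {k. k < n \<and> lam k < A / s\<^sup>2}) \<le> B / s ^ d"
    and \<rho>: "\<rho> * A = a * \<sigma>\<^sup>2" and r: "r \<le> \<sigma>" "r \<le> s0" and le1: "\<sigma> \<le> 1" "s0 \<le> 1"
    and nr: "real n * r ^ 4 \<le> \<sigma> ^ (4 - d)"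
  shows "(\<Sum>k<n. 1 / (1 + \<rho> * lam k)\<^sup>2) \<le> (B * (2 / s0) ^ d + 32 * B / a\<^sup>2 + 1 / a\<^sup>2) / \<sigma> ^ d"
proof -
  have \<sigma>: "0 < \<sigma>" and s0: "0 < s0" using pos r by auto
  define g where "g k = 1 / (1 + \<rho> * lam k)\<^sup>2" for k
  have g1: "g k \<le> 1" and g0: "0 \<le> g k" for k
  proof -
    have "0 \<le> \<rho> * lam k" using lam[of k] pos by simp
    then have "1 \<le> (1 + \<rho> * lam k)\<^sup>2" by (intro one_le_power) simp
    moreover from this have "0 < (1 + \<rho> * lam k)\<^sup>2" by linarith
    ultimately show "g k \<le> 1" "0 \<le> g k" unfolding g_def by (simp_all add: divide_le_eq)
  qed
  have gs: "g k \<le> s ^ 4 / (a\<^sup>2 * \<sigma> ^ 4)" if s: "0 < s" and k: "A / s\<^sup>2 \<le> lam k" for k s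
  proof -
    have "a * \<sigma>\<^sup>2 / s\<^sup>2 = \<rho> * (A / s\<^sup>2)" using \<rho> by simp
    also have "\<dots> \<le> \<rho> * lam k" using k pos by (intro mult_left_mono) auto
    finally have "a * \<sigma>\<^sup>2 / s\<^sup>2 \<le> 1 + \<rho> * lam k" by simp
    then have "(a * \<sigma>\<^sup>2 / s\<^sup>2)\<^sup>2 \<le> (1 + \<rho> * lam k)\<^sup>2"
      using pos \<sigma> s by (intro power_mono) auto
    then have "g k \<le> 1 / (a * \<sigma>\<^sup>2 / s\<^sup>2)\<^sup>2"
      unfolding g_def using pos \<sigma> s mult_nonneg_nonneg[OF less_imp_le[OF pos(5)] lam[of k]]
      by (intro divide_left_mono) (auto intro!: mult_pos_pos zero_less_power add_pos_nonneg)
    also have "\<dots> = s ^ 4 / (a\<^sup>2 * \<sigma> ^ 4)"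
      by (simp add: power_divide power_mult_distrib flip: power_mult)
    finally show ?thesis .
  qed
  define s where "s j = 2 ^ j * r" for j :: nat
  have s_pos: "0 < s j" for j using pos by (simp add: s_def)
  have claim: "(\<Sum>k | k < n \<and> A / (s j)\<^sup>2 \<le> lam k. g k)
      \<le> 1 / (a\<^sup>2 * \<sigma> ^ d) + 32 * B / (a\<^sup>2 * \<sigma> ^ 4) * s j ^ (4 - d)" if "s j \<le> s0" for j
    using that
  proof (induction j)
    \<comment> \<open>Above the threshold of the finest scale there is no count, so all
      \<open>n\<close> eigenvalues are allowed for; the hypothesis on \<open>n * r ^ 4\<close> pays
      for them.\<close>
    case 0
    have "(\<Sum>k | k < n \<and> A / (s 0)\<^sup>2 \<le> lam k. g k) \<le> (\<Sum>k | k < n \<and> A / (s 0)\<^sup>2 \<le> lam k. s 0 ^ 4 / (a\<^sup>2 * \<sigma> ^ 4))"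
      using gs[OF s_pos] by (intro sum_mono) auto
    also have "\<dots> = real (card {k. k < n \<and> A / (s 0)\<^sup>2 \<le> lam k}) * (s 0 ^ 4 / (a\<^sup>2 * \<sigma> ^ 4))" by simp
    also have "\<dots> \<le> real n * (s 0 ^ 4 / (a\<^sup>2 * \<sigma> ^ 4))"
      using card_mono[of "{..<n}" "{k. k < n \<and> A / (s 0)\<^sup>2 \<le> lam k}"] pos \<sigma> s_pos[of 0]
      by (intro mult_right_mono) auto
    also have "\<dots> = real n * r ^ 4 / (a\<^sup>2 * \<sigma> ^ 4)" by (simp add: s_def)
    also have "\<dots> \<le> \<sigma> ^ (4 - d) / (a\<^sup>2 * \<sigma> ^ 4)"
      using nr pos \<sigma> by (intro divide_right_mono) auto
    also have "\<dots> = 1 / (a\<^sup>2 * \<sigma> ^ d)"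
      using \<sigma> d pos by (simp add: power_diff field_simps)
    also have "\<dots> \<le> 1 / (a\<^sup>2 * \<sigma> ^ d) + 32 * B / (a\<^sup>2 * \<sigma> ^ 4) * s 0 ^ (4 - d)"
      using pos \<sigma> s_pos[of 0] by simp
    finally show ?case .
  next
    case (Suc j)
    have sj: "s j \<le> s (Suc j)" using pos by (simp add: s_def)
    have rs: "r \<le> s j" using pos by (simp add: s_def)
    let ?I = "\<lambda>j. {k. k < n \<and> A / (s j)\<^sup>2 \<le> lam k}"
    let ?K = "{k. k < n \<and> lam k < A / (s j)\<^sup>2 \<and> A / (s (Suc j))\<^sup>2 \<le> lam k}"
    have fin: "finite (?I j)" "finite ?K" by auto
    have "?I (Suc j) \<subseteq> ?I j \<union> ?K" by auto
    then have "(\<Sum>k\<in>?I (Suc j). g k) \<le> (\<Sum>k\<in>?I j \<union> ?K. g k)"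
      using fin g0 by (intro sum_mono2) auto
    also have "\<dots> = (\<Sum>k\<in>?I j. g k) + (\<Sum>k\<in>?K. g k)"
      using fin by (intro sum.union_disjoint) auto
    also have "(\<Sum>k\<in>?K. g k) \<le> (\<Sum>k\<in>?K. s (Suc j) ^ 4 / (a\<^sup>2 * \<sigma> ^ 4))"
      using gs[OF s_pos] by (intro sum_mono) auto
    also have "(\<Sum>k\<in>?K. s (Suc j) ^ 4 / (a\<^sup>2 * \<sigma> ^ 4)) = real (card ?K) * (s (Suc j) ^ 4 / (a\<^sup>2 * \<sigma> ^ 4))" by simp
    also have "\<dots> \<le> B / s j ^ d * (s (Suc j) ^ 4 / (a\<^sup>2 * \<sigma> ^ 4))"
    proof (rule mult_right_mono)
      have "real (card ?K) \<le> real (card {k. k < n \<and> lam k < A / (s j)\<^sup>2})"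
        by (intro of_nat_mono card_mono) auto
      also have "\<dots> \<le> B / s j ^ d" using rs sj Suc.prems by (intro count) auto
      finally show "real (card ?K) \<le> B / s j ^ d" .
    qed (use pos \<sigma> s_pos[of "Suc j"] in auto)
    also have "B / s j ^ d * (s (Suc j) ^ 4 / (a\<^sup>2 * \<sigma> ^ 4)) = 16 * B / (a\<^sup>2 * \<sigma> ^ 4) * s j ^ (4 - d)"
    proof -
      have "s (Suc j) = 2 * s j" by (simp add: s_def)
      moreover have "s j ^ 4 = s j ^ (4 - d) * s j ^ d"
        using d by (simp flip: power_add)
      ultimately have "s (Suc j) ^ 4 = 16 * (s j ^ (4 - d) * s j ^ d)"
        by (simp add: power_mult_distrib)
      then show ?thesis using s_pos[of j] by simp
    qed
    finally have "(\<Sum>k\<in>?I (Suc j). g k) \<le> (\<Sum>k\<in>?I j. g k) + 16 * B / (a\<^sup>2 * \<sigma> ^ 4) * s j ^ (4 - d)" by simp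
    \<comment> \<open>The constant 32 reproduces itself: \<open>32 + 16 = 48 \<le> 32 * 2\<close>,
      and doubling \<open>s\<close> multiplies \<open>s ^ (4 - d)\<close> by at least 2.\<close>
    also have "\<dots> \<le> 1 / (a\<^sup>2 * \<sigma> ^ d) + 48 * B / (a\<^sup>2 * \<sigma> ^ 4) * s j ^ (4 - d)"
    proof -
      have alg: "32 * B / q * x + 16 * B / q * x = 48 * B / q * x" for q x :: real by (simp add: algebra_simps)
      moreover have "(\<Sum>k | k < n \<and> A / (s j)\<^sup>2 \<le> lam k. g k) \<le> 1 / (a\<^sup>2 * \<sigma> ^ d) + 32 * B / (a\<^sup>2 * \<sigma> ^ 4) * s j ^ (4 - d)"
        using Suc.IH sj Suc.prems by simp
      ultimately show ?thesis
        using alg[of "a\<^sup>2 * \<sigma> ^ 4" "s j ^ (4 - d)"] by linarith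
    qed
    also have "\<dots> \<le> 1 / (a\<^sup>2 * \<sigma> ^ d) + 32 * B / (a\<^sup>2 * \<sigma> ^ 4) * s (Suc j) ^ (4 - d)"
    proof -
      have "s j ^ (4 - d) * 2 \<le> s j ^ (4 - d) * 2 ^ (4 - d)"
        using d s_pos[of j] self_le_power[of 2 "4 - d"] by (intro mult_left_mono) auto
      also have "\<dots> = s (Suc j) ^ (4 - d)" by (simp add: s_def power_mult_distrib)
      finally have "48 * s j ^ (4 - d) \<le> 32 * s (Suc j) ^ (4 - d)"
        using zero_less_power[OF s_pos, of j "4 - d"] by linarith
      then have "B / (a\<^sup>2 * \<sigma> ^ 4) * (48 * s j ^ (4 - d)) \<le> B / (a\<^sup>2 * \<sigma> ^ 4) * (32 * s (Suc j) ^ (4 - d))"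
        using pos \<sigma> by (intro mult_left_mono) auto
      then show ?thesis by (simp add: mult_ac)
    qed
    finally show ?case .
  qed
  define P where "P j \<longleftrightarrow> s j \<le> min \<sigma> s0" for j
  have "P 0" using r by (simp add: P_def s_def)
  moreover obtain N :: nat where N: "\<sigma> / r < 2 ^ N" using real_arch_pow[of 2 "\<sigma> / r"] by auto
  have "\<forall>j. P j \<longrightarrow> j \<le> N"
  proof (intro allI impI)
    fix j assume "P j"
    then have "2 ^ j \<le> \<sigma> / r" using pos by (simp add: P_def s_def field_simps)
    then have "(2 :: real) ^ j < 2 ^ N" using N by linarith
    then show "j \<le> N" by simp
  qed
  ultimately have PJ: "P (Greatest P)" and max: "\<And>j. P j \<Longrightarrow> j \<le> Greatest P"
    by (blast intro: GreatestI_nat Greatest_le_nat)+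
  define t where "t = s (Greatest P)"
  have t: "t \<le> \<sigma>" "t \<le> s0" "0 < t" using PJ s_pos by (auto simp: P_def t_def)
  have "\<not> P (Suc (Greatest P))" using max[of "Suc (Greatest P)"] by auto
  then have "min \<sigma> s0 < 2 * t" by (auto simp: P_def t_def s_def)
  \<comment> \<open>Both numbers are at most 1, so their product is below the minimum; this yields
    the power of \<open>\<sigma>\<close> even when \<open>s0\<close> is the smaller one.\<close>
  moreover have "s0 * \<sigma> \<le> min \<sigma> s0" using le1 \<sigma> s0 by (simp add: mult_left_le mult_left_le_one_le)
  ultimately have t2: "s0 * \<sigma> / 2 \<le> t" by linarith
  have tr: "r \<le> t" using pos by (simp add: t_def s_def)
  have "(\<Sum>k<n. g k) \<le> (\<Sum>k\<in>{k. k < n \<and> lam k < A / t\<^sup>2} \<union> {k. k < n \<and> A / t\<^sup>2 \<le> lam k}. g k)"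
    using g0 by (intro sum_mono2) auto
  also have "\<dots> = (\<Sum>k | k < n \<and> lam k < A / t\<^sup>2. g k) + (\<Sum>k | k < n \<and> A / t\<^sup>2 \<le> lam k. g k)"
    by (intro sum.union_disjoint) auto
  also have "(\<Sum>k | k < n \<and> lam k < A / t\<^sup>2. g k) \<le> (\<Sum>k | k < n \<and> lam k < A / t\<^sup>2. 1)"
    by (intro sum_mono g1)
  also have "(\<Sum>k | k < n \<and> lam k < A / t\<^sup>2. 1) \<le> B / t ^ d"
    using count[OF tr t(2)] by simp
  also have "B / t ^ d \<le> B / (s0 * \<sigma> / 2) ^ d"
    using pos t t2 s0 \<sigma> by (intro divide_left_mono power_mono mult_pos_pos zero_less_power) auto
  also have "B / (s0 * \<sigma> / 2) ^ d = B * (2 / s0) ^ d / \<sigma> ^ d"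
    by (simp add: power_divide power_mult_distrib)
  also have "(\<Sum>k | k < n \<and> A / t\<^sup>2 \<le> lam k. g k) \<le> 1 / (a\<^sup>2 * \<sigma> ^ d) + 32 * B / (a\<^sup>2 * \<sigma> ^ 4) * t ^ (4 - d)"
    using claim t(2) unfolding t_def by simp
  also have "32 * B / (a\<^sup>2 * \<sigma> ^ 4) * t ^ (4 - d) \<le> 32 * B / (a\<^sup>2 * \<sigma> ^ 4) * \<sigma> ^ (4 - d)"
    using pos t \<sigma> by (intro mult_left_mono power_mono) auto
  also have "32 * B / (a\<^sup>2 * \<sigma> ^ 4) * \<sigma> ^ (4 - d) = 32 * B / a\<^sup>2 / \<sigma> ^ d"
    using \<sigma> d pos by (simp add: power_diff field_simps)
  finally have "(\<Sum>k<n. g k) \<le> B * (2 / s0) ^ d / \<sigma> ^ d + (1 / (a\<^sup>2 * \<sigma> ^ d) + 32 * B / a\<^sup>2 / \<sigma> ^ d)"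
    by simp
  also have "\<dots> = (B * (2 / s0) ^ d + 32 * B / a\<^sup>2 + 1 / a\<^sup>2) / \<sigma> ^ d"
    by (simp add: add_divide_distrib)
  finally show ?thesis unfolding g_def .
qed

section \<open>Gaussian regression samples\<close>

lemma product_sigma_finite_const: "prob_space P \<Longrightarrow> product_sigma_finite (\<lambda>_. P)"
  by (simp add: product_sigma_finite_def prob_space_imp_sigma_finite)

lemma prob_space_regression_law:
  assumes P: "prob_space P" and [measurable]: "f0 \<in> borel_measurable P"
  shows "prob_space (regression_law P f0)"
proof -
  interpret P: prob_space P by fact
  interpret N: prob_space std_normal_distribution by (rule prob_space_normal_density) simp
  interpret PN: pair_prob_space P std_normal_distribution ..
  show ?thesis unfolding regression_law_def by (rule PN.prob_space_distr) measurable
qed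

definition sample_of :: "nat \<Rightarrow> ('a \<Rightarrow> real) \<Rightarrow> (nat \<Rightarrow> 'a) \<times> (nat \<Rightarrow> real) \<Rightarrow> nat \<Rightarrow> 'a \<times> real" where
  "sample_of n f0 = (\<lambda>(x, e). \<lambda>i\<in>{..<n}. (x i, f0 (x i) + e i))"

abbreviation "design_noise n P \<equiv> (\<Pi>\<^sub>M i\<in>{..<n}. P) \<Otimes>\<^sub>M (\<Pi>\<^sub>M i\<in>{..<n}. std_normal_distribution)"

lemma measurable_sample_of[measurable]:
  assumes [measurable]: "f0 \<in> borel_measurable P"
  shows "sample_of n f0 \<in> design_noise n P \<rightarrow>\<^sub>M (\<Pi>\<^sub>M i\<in>{..<n}. P \<Otimes>\<^sub>M borel)"
  unfolding sample_of_def case_prod_unfold by measurable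

text \<open>Separates the design from the noise, so that conditioning on the design becomes an inner
  integral. Product sets suffice for the comparison, and on them both sides factor over the
  coordinates.\<close>

lemma regression_sample_eq_distr:
  assumes P: "prob_space P" and f0[measurable]: "f0 \<in> borel_measurable P"
  shows "regression_sample n P f0 = distr (design_noise n P) (\<Pi>\<^sub>M i\<in>{..<n}. P \<Otimes>\<^sub>M borel) (sample_of n f0)"
proof -
  let ?N = std_normal_distribution and ?I = "{..<n}"
  interpret P: prob_space P by fact
  interpret N: prob_space ?N by (rule prob_space_normal_density) simp
  interpret PP: product_sigma_finite "\<lambda>_ :: nat. P" by (rule product_sigma_finite_const[OF P])
  interpret NN: product_sigma_finite "\<lambda>_ :: nat. ?N" by (rule product_sigma_finite_const) unfold_locales
  interpret LL: product_sigma_finite "\<lambda>_ :: nat. regression_law P f0"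
    by (rule product_sigma_finite_const[OF prob_space_regression_law[OF P f0]])
  interpret PNs: prob_space "\<Pi>\<^sub>M i\<in>?I. ?N" by (rule prob_space_PiM) unfold_locales
  have sets_law: "sets (regression_law P f0) = sets (P \<Otimes>\<^sub>M borel)" by (simp add: regression_law_def)
  let ?D = "distr (design_noise n P) (\<Pi>\<^sub>M i\<in>?I. P \<Otimes>\<^sub>M borel) (sample_of n f0)"
  have "?D = PiM ?I (\<lambda>_. regression_law P f0)"
  proof (rule LL.PiM_eqI)
    show "sets ?D = sets (PiM ?I (\<lambda>_. regression_law P f0))"
      unfolding sets_distr by (intro sets_PiM_cong refl) (simp add: sets_law)
    fix A :: "nat \<Rightarrow> ('a \<times> real) set" assume "\<And>i. i \<in> ?I \<Longrightarrow> A i \<in> sets (regression_law P f0)"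
    then have A[measurable]: "\<And>i. i \<in> ?I \<Longrightarrow> A i \<in> sets (P \<Otimes>\<^sub>M borel)" by (simp add: sets_law)
    have [measurable]: "PiE ?I A \<in> sets (\<Pi>\<^sub>M i\<in>?I. P \<Otimes>\<^sub>M borel)" by (intro sets_PiM_I_finite A) auto
    have m[measurable]: "i \<in> ?I \<Longrightarrow> (\<lambda>(x, e). indicator (A i) (x, f0 x + e) :: ennreal) \<in> borel_measurable (P \<Otimes>\<^sub>M ?N)" for i
      unfolding case_prod_unfold by (rule measurable_compose[OF _ borel_measurable_indicator[OF A]]) measurable
    have ind: "indicator (PiE ?I A) (sample_of n f0 (x, e)) = (\<Prod>i\<in>?I. indicator (A i) (x i, f0 (x i) + e i) :: ennreal)" for x e
    proof (cases "\<forall>i\<in>?I. (x i, f0 (x i) + e i) \<in> A i")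
      case False
      then obtain i where "i \<in> ?I" "(x i, f0 (x i) + e i) \<notin> A i" by blast
      then have "(\<Prod>i\<in>?I. indicator (A i) (x i, f0 (x i) + e i) :: ennreal) = 0"
        by (intro prod_zero finite_lessThan bexI[of _ i]) auto
      then show ?thesis using False by (auto simp: sample_of_def PiE_iff)
    qed (auto simp: sample_of_def PiE_iff extensional_def)
    have "emeasure ?D (PiE ?I A) = (\<integral>\<^sup>+w. indicator (PiE ?I A) w \<partial>?D)" by simp
    also have "\<dots> = (\<integral>\<^sup>+z. indicator (PiE ?I A) (sample_of n f0 z) \<partial>design_noise n P)"
      by (subst nn_integral_distr) auto
    also have "\<dots> = (\<integral>\<^sup>+x. \<integral>\<^sup>+e. indicator (PiE ?I A) (sample_of n f0 (x, e)) \<partial>(\<Pi>\<^sub>M i\<in>?I. ?N) \<partial>(\<Pi>\<^sub>M i\<in>?I. P))"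
      by (rule PNs.nn_integral_fst[symmetric]) measurable
    also have "\<dots> = (\<integral>\<^sup>+x. (\<Prod>i\<in>?I. \<integral>\<^sup>+e. indicator (A i) (x i, f0 (x i) + e) \<partial>?N) \<partial>(\<Pi>\<^sub>M i\<in>?I. P))"
    proof (rule nn_integral_cong)
      fix x assume "x \<in> space (\<Pi>\<^sub>M i\<in>?I. P)"
      then have x: "i \<in> ?I \<Longrightarrow> x i \<in> space P" for i by (auto simp: space_PiM PiE_iff)
      show "(\<integral>\<^sup>+e. indicator (PiE ?I A) (sample_of n f0 (x, e)) \<partial>(\<Pi>\<^sub>M i\<in>?I. ?N)) = (\<Prod>i\<in>?I. \<integral>\<^sup>+e. indicator (A i) (x i, f0 (x i) + e) \<partial>?N)"
        unfolding ind
      proof (rule NN.product_nn_integral_prod)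
        fix i assume i: "i \<in> ?I"
        show "(\<lambda>e. indicator (A i) (x i, f0 (x i) + e) :: ennreal) \<in> borel_measurable ?N"
          using measurable_compose[OF measurable_Pair1'[OF x[OF i]] m[OF i]] by simp
      qed simp
    qed
    also have "\<dots> = (\<Prod>i\<in>?I. \<integral>\<^sup>+x. \<integral>\<^sup>+e. indicator (A i) (x, f0 x + e) \<partial>?N \<partial>P)"
    proof (rule PP.product_nn_integral_prod)
      fix i assume "i \<in> ?I"
      from m[OF this] show "(\<lambda>x. \<integral>\<^sup>+e. indicator (A i) (x, f0 x + e) \<partial>?N) \<in> borel_measurable P"
        by (rule N.borel_measurable_nn_integral)
    qed simp
    also have "\<dots> = (\<Prod>i\<in>?I. emeasure (regression_law P f0) (A i))"
    proof (rule prod.cong[OF refl])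
      fix i assume i: "i \<in> ?I"
      have "emeasure (regression_law P f0) (A i) = (\<integral>\<^sup>+w. indicator (A i) w \<partial>regression_law P f0)"
        using A[OF i] by (simp add: sets_law)
      also have "\<dots> = (\<integral>\<^sup>+z. indicator (A i) (case z of (x, e) \<Rightarrow> (x, f0 x + e)) \<partial>(P \<Otimes>\<^sub>M ?N))"
        unfolding regression_law_def using A[OF i] by (intro nn_integral_distr) auto
      also have "\<dots> = (\<integral>\<^sup>+x. \<integral>\<^sup>+e. indicator (A i) (x, f0 x + e) \<partial>?N \<partial>P)"
        using N.nn_integral_fst[OF m[OF i]] by (simp add: case_prod_unfold)
      finally show "(\<integral>\<^sup>+x. \<integral>\<^sup>+e. indicator (A i) (x, f0 x + e) \<partial>?N \<partial>P) = emeasure (regression_law P f0) (A i)" by simp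
    qed
    finally show "emeasure ?D (PiE ?I A) = (\<Prod>i\<in>?I. emeasure (regression_law P f0) (A i))" .
  qed simp
  then show ?thesis by (simp add: regression_sample_def)
qed

section \<open>Moments and tail bounds under product measures\<close>

lemma nn_integral_PiM_two_coordinates:
  assumes P: "prob_space P" and "finite I" "i \<in> I" "j \<in> I" "i \<noteq> j"
    and h[measurable]: "(\<lambda>(y, z). h y z) \<in> borel_measurable (P \<Otimes>\<^sub>M P)"
  shows "(\<integral>\<^sup>+x. h (x i) (x j) \<partial>(\<Pi>\<^sub>M i\<in>I. P)) = (\<integral>\<^sup>+y. \<integral>\<^sup>+z. h y z \<partial>P \<partial>P)"
proof -
  interpret P: prob_space P by fact
  interpret PP: product_sigma_finite "\<lambda>_. P" by (rule product_sigma_finite_const[OF P])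
  interpret R: prob_space "\<Pi>\<^sub>M k\<in>I - {i, j}. P" by (rule prob_space_PiM) unfold_locales
  have I: "I = insert i (insert j (I - {i, j}))" using assms by auto
  have fin: "finite (insert j (I - {i, j}))" "i \<notin> insert j (I - {i, j})" "finite (I - {i, j})" "j \<notin> I - {i, j}"
    using assms by auto
  have [measurable]: "(\<lambda>y. \<integral>\<^sup>+z. h y z \<partial>P) \<in> borel_measurable P"
    by (rule P.borel_measurable_nn_integral[OF h])
  have "(\<integral>\<^sup>+x. h (x i) (x j) \<partial>(\<Pi>\<^sub>M i\<in>I. P)) = (\<integral>\<^sup>+x. h (x i) (x j) \<partial>(\<Pi>\<^sub>M i\<in>insert i (insert j (I - {i, j})). P))"
    using I by simp
  also have "\<dots> = (\<integral>\<^sup>+y. \<integral>\<^sup>+x. h y (x j) \<partial>(\<Pi>\<^sub>M k\<in>insert j (I - {i, j}). P) \<partial>P)"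
    using assms(5) by (subst PP.product_nn_integral_insert_rev[OF fin(1,2)]) auto
  also have "\<dots> = (\<integral>\<^sup>+y. \<integral>\<^sup>+z. h y z \<partial>P \<partial>P)"
  proof (rule nn_integral_cong)
    fix y assume y: "y \<in> space P"
    have [measurable]: "h y \<in> borel_measurable P"
      using measurable_compose[OF measurable_Pair1'[OF y] h] by simp
    show "(\<integral>\<^sup>+x. h y (x j) \<partial>(\<Pi>\<^sub>M k\<in>insert j (I - {i, j}). P)) = (\<integral>\<^sup>+z. h y z \<partial>P)"
      by (subst PP.product_nn_integral_insert_rev[OF fin(3,4)]) (auto simp: R.emeasure_space_1)
  qed
  finally show ?thesis .
qed

lemma std_normal_second_moments:
  fixes i j n :: nat
  assumes "i < n" "j < n"
  shows "integrable (\<Pi>\<^sub>M i\<in>{..<n}. std_normal_distribution) (\<lambda>e. e i * e j)"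
    and "(LINT e|(\<Pi>\<^sub>M i\<in>{..<n}. std_normal_distribution). e i * e j) = (if i = j then 1 else 0)"
proof -
  let ?N = std_normal_distribution
  interpret N: prob_space ?N by (rule prob_space_normal_density) simp
  interpret NN: product_sigma_finite "\<lambda>_ :: nat. ?N" by (rule product_sigma_finite_const) unfold_locales
  \<comment> \<open>The factors of \<open>e i * e j\<close> over all coordinates. For
    \<open>i = j\<close> both conditions hit the same factor, so one product formula covers both
    cases.\<close>
  define F where "F k e = (if k = i then e else 1) * (if k = j then e else (1 :: real))" for k :: nat and e
  have m: "integrable ?N (\<lambda>x. x)" "integrable ?N (\<lambda>x. x * x)" "(LINT x|?N. x) = 0" "(LINT x|?N. x * x) = 1"
    using integrable_std_normal_distribution_moment[of 1] integrable_std_normal_distribution_moment[of 2]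
      integral_std_normal_distribution_moment_odd[of 1] std_normal_distribution_even_moments(1)[of 1]
    by (simp_all add: power2_eq_square)
  have int: "integrable ?N (F k)" for k
    using m unfolding F_def by (cases "k = i"; cases "k = j") auto
  have F: "(\<Prod>k<n. F k (e k)) = e i * e j" for e
    using assms by (simp add: F_def prod.distrib)
  show "integrable (\<Pi>\<^sub>M i\<in>{..<n}. ?N) (\<lambda>e. e i * e j)"
    using NN.product_integrable_prod[of "{..<n}" F] int by (simp add: F)
  have "(LINT e|(\<Pi>\<^sub>M i\<in>{..<n}. ?N). e i * e j) = (\<Prod>k<n. LINT e|?N. F k e)"
    using NN.product_integral_prod[of "{..<n}" F] int by (simp add: F)
  also have "\<dots> = (if i = j then 1 else 0)"
  proof (cases "i = j")
    case True
    then have "(LINT e|?N. F k e) = 1" for k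
      using m(4) N.prob_space by (cases "k = i") (auto simp: F_def)
    then show ?thesis using True by simp
  next
    case False
    then have "(LINT e|?N. F i e) = 0" using m(3) by (simp add: F_def)
    then show ?thesis using False assms by (auto intro!: prod_zero)
  qed
  finally show "(LINT e|(\<Pi>\<^sub>M i\<in>{..<n}. ?N). e i * e j) = (if i = j then 1 else 0)" .
qed

lemma nn_integral_std_normal_linear_squared:
  fixes n :: nat and v :: "nat \<Rightarrow> real"
  shows
  "(\<integral>\<^sup>+e. ennreal ((\<Sum>i<n. e i * v i)\<^sup>2) \<partial>(\<Pi>\<^sub>M i\<in>{..<n}. std_normal_distribution)) = ennreal (\<Sum>i<n. (v i)\<^sup>2)"
proof -
  let ?M = "\<Pi>\<^sub>M i\<in>{..<n}. std_normal_distribution"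
  have eq: "(\<Sum>i<n. e i * v i)\<^sup>2 = (\<Sum>i<n. \<Sum>j<n. (v i * v j) * (e i * e j))" for e
    by (simp add: power2_eq_square sum_product mult_ac)
  have int: "integrable ?M (\<lambda>e. (v i * v j) * (e i * e j))" if "i < n" "j < n" for i j
    using std_normal_second_moments(1)[OF that] by (rule integrable_mult_right)
  have "(LINT e|?M. (\<Sum>i<n. e i * v i)\<^sup>2) = (\<Sum>i<n. LINT e|?M. (\<Sum>j<n. (v i * v j) * (e i * e j)))"
    unfolding eq by (intro Bochner_Integration.integral_sum Bochner_Integration.integrable_sum int) auto
  also have "\<dots> = (\<Sum>i<n. \<Sum>j<n. LINT e|?M. (v i * v j) * (e i * e j))"
    by (intro sum.cong refl Bochner_Integration.integral_sum int) auto
  also have "\<dots> = (\<Sum>i<n. \<Sum>j<n. (v i * v j) * (LINT e|?M. e i * e j))"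
    by simp
  also have "\<dots> = (\<Sum>i<n. \<Sum>j<n. if j = i then v i * v j else 0)"
    by (intro sum.cong refl) (auto simp: std_normal_second_moments)
  also have "\<dots> = (\<Sum>i<n. (v i)\<^sup>2)" by (simp add: power2_eq_square)
  finally have "(LINT e|?M. (\<Sum>i<n. e i * v i)\<^sup>2) = (\<Sum>i<n. (v i)\<^sup>2)" .
  moreover have "integrable ?M (\<lambda>e. (\<Sum>i<n. e i * v i)\<^sup>2)"
    unfolding eq by (intro Bochner_Integration.integrable_sum int) auto
  ultimately show ?thesis by (subst nn_integral_eq_integral) auto
qed

lemma card_eq_sum_indicator:
  fixes n :: nat
  shows "real (card {i. i < n \<and> x i \<in> A}) = (\<Sum>i<n. indicator A (x i))"
proof -
  have "{i. i < n \<and> x i \<in> A} = {..<n} \<inter> {i. x i \<in> A}" by auto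
  then show ?thesis by (simp add: indicator_def)
qed

text \<open>The moment generating function of a binomial count, bounded through
  \<open>1 + x \<le> exp x\<close>.\<close>

lemma nn_integral_exp_count:
  fixes t :: real and n :: nat
  assumes P: "prob_space P" and A: "A \<in> sets P"
  shows "(\<integral>\<^sup>+x. ennreal (exp (t * card {i. i < n \<and> x i \<in> A})) \<partial>(\<Pi>\<^sub>M i\<in>{..<n}. P))
     \<le> ennreal (exp (n * measure P A * (exp t - 1)))"
proof -
  interpret P: prob_space P by fact
  interpret PP: product_sigma_finite "\<lambda>_ :: nat. P" by (rule product_sigma_finite_const[OF P])
  define q where "q = measure P A"
  have fA: "integrable P (indicat_real A)"
    using A by (intro integrable_real_indicator) (auto simp: less_top[symmetric])
  have one: "(\<integral>\<^sup>+x. ennreal (exp (t * indicator A x)) \<partial>P) = ennreal (1 + q * (exp t - 1))"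
  proof -
    have e: "exp (t * indicator A x) = 1 + (exp t - 1) * indicator A x" for x by (simp add: indicator_def)
    have "(\<integral>\<^sup>+x. ennreal (exp (t * indicator A x)) \<partial>P) = ennreal (LINT x|P. exp (t * indicator A x))"
    proof (rule nn_integral_eq_integral)
      show "integrable P (\<lambda>x. exp (t * indicator A x))"
        unfolding e by (intro Bochner_Integration.integrable_add integrable_mult_right fA) simp
    qed simp
    also have "(LINT x|P. exp (t * indicator A x)) = 1 + q * (exp t - 1)"
      unfolding e using fA A by (simp add: P.prob_space q_def mult.commute Int_absorb2 sets.sets_into_space)
    finally show ?thesis .
  qed
  have q0: "0 \<le> 1 + q * (exp t - 1)"
  proof -
    have "0 \<le> (1 - q) + q * exp t"
      using P.prob_le_1[of A] by (intro add_nonneg_nonneg mult_nonneg_nonneg) (auto simp: q_def)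
    then show ?thesis by (simp add: algebra_simps)
  qed
  have "(\<integral>\<^sup>+x. ennreal (exp (t * card {i. i < n \<and> x i \<in> A})) \<partial>(\<Pi>\<^sub>M i\<in>{..<n}. P))
      = (\<integral>\<^sup>+x. (\<Prod>i<n. ennreal (exp (t * indicator A (x i)))) \<partial>(\<Pi>\<^sub>M i\<in>{..<n}. P))"
    unfolding card_eq_sum_indicator sum_distrib_left
    by (subst exp_sum, simp, subst prod_ennreal, simp, rule refl)
  also have "\<dots> = (\<Prod>i<n. \<integral>\<^sup>+x. ennreal (exp (t * indicator A x)) \<partial>P)"
    using A by (intro PP.product_nn_integral_prod) auto
  also have "\<dots> = ennreal ((1 + q * (exp t - 1)) ^ n)"
    using q0 by (simp add: one ennreal_power)
  also have "\<dots> \<le> ennreal (exp (q * (exp t - 1)) ^ n)"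
    using q0 by (intro ennreal_leI power_mono) auto
  also have "exp (q * (exp t - 1)) ^ n = exp (n * measure P A * (exp t - 1))"
    by (simp add: q_def exp_of_nat_mult[symmetric] mult.assoc)
  finally show ?thesis .
qed

text \<open>Chernoff with \<open>t = -1\<close>. The bound decays because
  \<open>exp (- 1) < 1 / 2\<close>, which is established when the final rate constant is
  chosen.\<close>

lemma chernoff_lower:
  fixes q :: real and n :: nat
  assumes P: "prob_space P" and A[measurable]: "A \<in> sets P" and q: "0 \<le> q" "q \<le> measure P A"
  shows "emeasure (\<Pi>\<^sub>M i\<in>{..<n}. P) {x \<in> space (\<Pi>\<^sub>M i\<in>{..<n}. P). card {i. i < n \<and> x i \<in> A} < n * q / 2}
    \<le> ennreal (exp (- (1 / 2 - exp (- 1)) * (n * q)))"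
proof -
  let ?M = "\<Pi>\<^sub>M i\<in>{..<n}. P" and ?c = "\<lambda>x. real (card {i. i < n \<and> x i \<in> A})"
  have [measurable]: "?c \<in> borel_measurable ?M" unfolding card_eq_sum_indicator by simp
  have "emeasure ?M {x \<in> space ?M. ?c x < n * q / 2}
     \<le> emeasure ?M {x \<in> space ?M. 1 \<le> ennreal (exp (n * q / 2)) * ennreal (exp (- 1 * ?c x))}"
    by (intro emeasure_mono) (auto simp: ennreal_mult[symmetric] exp_add[symmetric] simp flip: ennreal_1)
  also have "\<dots> \<le> ennreal (exp (n * q / 2)) * (\<integral>\<^sup>+x. ennreal (exp (- 1 * ?c x)) * indicator (space ?M) x \<partial>?M)"
    by (rule nn_integral_Markov_inequality) measurable
  also have "(\<integral>\<^sup>+x. ennreal (exp (- 1 * ?c x)) * indicator (space ?M) x \<partial>?M) = (\<integral>\<^sup>+x. ennreal (exp (- 1 * ?c x)) \<partial>?M)"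
    by (intro nn_integral_cong) simp
  also have "\<dots> \<le> ennreal (exp (n * measure P A * (exp (- 1) - 1)))"
    by (rule nn_integral_exp_count[OF P A])
  also have "\<dots> \<le> ennreal (exp (n * q * (exp (- 1) - 1)))"
    using q by (intro ennreal_leI) (auto intro!: mult_right_mono_neg mult_left_mono)
  finally have "emeasure ?M {x \<in> space ?M. ?c x < n * q / 2} \<le> ennreal (exp (n * q / 2)) * ennreal (exp (n * q * (exp (- 1) - 1)))"
    by (simp add: mult_left_mono)
  also have "\<dots> = ennreal (exp (- (1 / 2 - exp (- 1)) * (n * q)))"
    by (simp add: ennreal_mult[symmetric] exp_add[symmetric] algebra_simps)
  finally show ?thesis .
qed

text \<open>Chernoff with \<open>t = 1\<close>: as \<open>exp 1 - 1 \<le> 2\<close>, the factor 3 in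
  the threshold leaves the exponent \<open>- (n * q)\<close>.\<close>

lemma chernoff_upper:
  fixes q :: real and n :: nat
  assumes P: "prob_space P" and A[measurable]: "A \<in> sets P" and q: "measure P A \<le> q"
  shows "emeasure (\<Pi>\<^sub>M i\<in>{..<n}. P) {x \<in> space (\<Pi>\<^sub>M i\<in>{..<n}. P). 3 * n * q < card {i. i < n \<and> x i \<in> A}}
    \<le> ennreal (exp (- (n * q)))"
proof -
  let ?M = "\<Pi>\<^sub>M i\<in>{..<n}. P" and ?c = "\<lambda>x. real (card {i. i < n \<and> x i \<in> A})"
  have [measurable]: "?c \<in> borel_measurable ?M" unfolding card_eq_sum_indicator by simp
  have "emeasure ?M {x \<in> space ?M. 3 * n * q < ?c x}
     \<le> emeasure ?M {x \<in> space ?M. 1 \<le> ennreal (exp (- (3 * n * q))) * ennreal (exp (1 * ?c x))}"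
    by (intro emeasure_mono) (auto simp: ennreal_mult[symmetric] exp_add[symmetric] simp flip: ennreal_1)
  also have "\<dots> \<le> ennreal (exp (- (3 * n * q))) * (\<integral>\<^sup>+x. ennreal (exp (1 * ?c x)) * indicator (space ?M) x \<partial>?M)"
    by (rule nn_integral_Markov_inequality) measurable
  also have "(\<integral>\<^sup>+x. ennreal (exp (1 * ?c x)) * indicator (space ?M) x \<partial>?M) = (\<integral>\<^sup>+x. ennreal (exp (1 * ?c x)) \<partial>?M)"
    by (intro nn_integral_cong) simp
  also have "\<dots> \<le> ennreal (exp (n * measure P A * (exp 1 - 1)))"
    by (rule nn_integral_exp_count[OF P A])
  also have "\<dots> \<le> ennreal (exp (n * q * 2))"
  proof -
    have "0 \<le> q" using q measure_nonneg[of P A] by linarith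
    then show ?thesis using q exp_le by (intro ennreal_leI) (auto intro!: mult_mono)
  qed
  finally have "emeasure ?M {x \<in> space ?M. 3 * n * q < ?c x} \<le> ennreal (exp (- (3 * n * q))) * ennreal (exp (n * q * 2))"
    by (simp add: mult_left_mono)
  also have "\<dots> = ennreal (exp (- (n * q)))"
    by (simp add: ennreal_mult[symmetric] exp_add[symmetric] algebra_simps)
  finally show ?thesis .
qed

section \<open>Bias and variance under a random design\<close>

text \<open>The sum runs over ordered pairs and counts every edge twice, hence the division by
  2.\<close>

lemma qform_laplacian:
  assumes sym: "\<And>i j. i < n \<Longrightarrow> j < n \<Longrightarrow> W i j = W j i"
  shows "qform n (laplacian_matrix n W) f f = (\<Sum>i<n. \<Sum>j<n. W i j * (f i - f j)\<^sup>2) / 2"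
proof -
  define S where "S = (\<Sum>i<n. \<Sum>j<n. W i j * (f i)\<^sup>2)"
  define T where "T = (\<Sum>i<n. \<Sum>j<n. W i j * (f i * f j))"
  have S': "(\<Sum>i<n. \<Sum>j<n. W i j * (f j)\<^sup>2) = S"
    unfolding S_def by (subst sum.swap) (use sym in \<open>auto intro!: sum.cong\<close>)
  have "qform n (laplacian_matrix n W) f f = (\<Sum>i<n. (\<Sum>j<n. if i = j then f i * (\<Sum>k<n. W i k) * f j else 0) - (\<Sum>j<n. W i j * (f i * f j)))"
    unfolding qform_def laplacian_matrix_def degree_matrix_def sum_subtractf[symmetric]
    by (intro sum.cong refl) (auto simp: algebra_simps)
  also have "\<dots> = (\<Sum>i<n. f i * (\<Sum>k<n. W i k) * f i) - T"
    by (simp add: T_def sum_subtractf)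
  also have "(\<Sum>i<n. f i * (\<Sum>k<n. W i k) * f i) = S"
    unfolding S_def by (intro sum.cong refl) (simp add: power2_eq_square sum_distrib_left sum_distrib_right mult_ac)
  finally have q: "qform n (laplacian_matrix n W) f f = S - T" .
  have "(\<Sum>i<n. \<Sum>j<n. W i j * (f i - f j)\<^sup>2) = (\<Sum>i<n. \<Sum>j<n. W i j * (f i)\<^sup>2 + W i j * (f j)\<^sup>2 - 2 * (W i j * (f i * f j)))"
    by (intro sum.cong refl) (simp add: power2_eq_square algebra_simps)
  also have "\<dots> = S + S - 2 * T"
    unfolding S_def[symmetric] T_def sum.distrib sum_subtractf S' by (simp add: sum_distrib_left)
  finally show ?thesis using q by simp
qed

section \<open>The design distribution against Lebesgue measure\<close>

lemma borel_measurable_design: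
  "f \<in> borel_measurable borel \<Longrightarrow> f \<in> borel_measurable (design_distribution X p)"
proof -
  assume "f \<in> borel_measurable borel"
  then have "f \<in> borel_measurable (lebesgue_on X)"
    by (intro measurable_restrict_space1 measurable_completion) simp
  then show ?thesis by (simp add: design_distribution_def)
qed

lemma measurable_id_design[measurable]: "(\<lambda>x. x) \<in> design_distribution X p \<rightarrow>\<^sub>M borel"
  by (rule borel_measurable_design) simp

lemma space_design[simp]: "space (design_distribution X p) = X"
  by (simp add: design_distribution_def space_restrict_space)

lemma sets_design: "open X \<Longrightarrow> A \<in> sets borel \<Longrightarrow> A \<subseteq> X \<Longrightarrow> A \<in> sets (design_distribution X p)"
  unfolding design_distribution_def sets_density
  by (subst sets_restrict_space_iff) (auto intro: sets_completionI_sets)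

text \<open>Completion does not change nonnegative integrals, so \<open>F\<close> may be merely
  Lebesgue measurable although the right side is an integral over \<open>lborel\<close>.\<close>

lemma nn_integral_design:
  fixes X :: "'a::euclidean_space set"
  assumes X: "open X" and p: "continuous_on X p" and F: "F \<in> borel_measurable (design_distribution X p)"
  shows "(\<integral>\<^sup>+x. F x \<partial>design_distribution X p) = (\<integral>\<^sup>+x. ennreal (p x) * F x * indicator X x \<partial>lborel)"
proof -
  have pm: "p \<in> borel_measurable (lebesgue_on X)"
    using X p by (intro continuous_imp_measurable_on_sets_lebesgue) auto
  have Fm: "F \<in> borel_measurable (lebesgue_on X)"
    using F by (simp add: design_distribution_def)
  have "(\<integral>\<^sup>+x. F x \<partial>design_distribution X p) = (\<integral>\<^sup>+x. ennreal (p x) * F x \<partial>lebesgue_on X)"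
    unfolding design_distribution_def using pm Fm by (intro nn_integral_density) auto
  also have "\<dots> = (\<integral>\<^sup>+x. ennreal (p x) * F x * indicator X x \<partial>lebesgue)"
    using X by (intro nn_integral_restrict_space) auto
  finally show ?thesis by (simp add: nn_integral_completion)
qed

lemma emeasure_design:
  fixes X :: "'a::euclidean_space set"
  assumes X: "open X" and p: "continuous_on X p" and A: "A \<in> sets borel" "A \<subseteq> X"
  shows "emeasure (design_distribution X p) A = (\<integral>\<^sup>+x. ennreal (p x) * indicator A x \<partial>lborel)"
proof -
  have "emeasure (design_distribution X p) A = (\<integral>\<^sup>+x. indicator A x \<partial>design_distribution X p)"
    using sets_design[OF X A] by simp
  also have "\<dots> = (\<integral>\<^sup>+x. ennreal (p x) * indicator A x * indicator X x \<partial>lborel)"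
    using sets_design[OF X A] by (intro nn_integral_design X p) auto
  also have "\<dots> = (\<integral>\<^sup>+x. ennreal (p x) * indicator A x \<partial>lborel)"
    using A(2) by (intro nn_integral_cong) (auto simp: indicator_def)
  finally show ?thesis .
qed

lemma emeasure_design_ge:
  fixes X :: "'a::euclidean_space set"
  assumes X: "open X" and p: "continuous_on X p" "\<And>x. x \<in> X \<Longrightarrow> p_min \<le> p x" and A: "A \<in> sets borel" "A \<subseteq> X"
  shows "ennreal p_min * emeasure lborel A \<le> emeasure (design_distribution X p) A"
proof -
  have "ennreal p_min * emeasure lborel A = (\<integral>\<^sup>+x. ennreal p_min * indicator A x \<partial>lborel)"
    using A by (simp add: nn_integral_cmult_indicator)
  also have "\<dots> \<le> (\<integral>\<^sup>+x. ennreal (p x) * indicator A x \<partial>lborel)"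
    using p(2) A(2) by (intro nn_integral_mono) (auto simp: indicator_def intro!: ennreal_leI)
  finally show ?thesis by (simp add: emeasure_design[OF X p(1) A])
qed

lemma emeasure_design_le:
  fixes X :: "'a::euclidean_space set"
  assumes X: "open X" and p: "continuous_on X p" "\<And>x. x \<in> X \<Longrightarrow> p x \<le> p_max" and A: "A \<in> sets borel" "A \<subseteq> X"
  shows "emeasure (design_distribution X p) A \<le> ennreal p_max * emeasure lborel A"
proof -
  have "(\<integral>\<^sup>+x. ennreal (p x) * indicator A x \<partial>lborel) \<le> (\<integral>\<^sup>+x. ennreal p_max * indicator A x \<partial>lborel)"
    using p(2) A(2) by (intro nn_integral_mono) (auto simp: indicator_def intro!: ennreal_leI)
  also have "\<dots> = ennreal p_max * emeasure lborel A"
    using A by (simp add: nn_integral_cmult_indicator)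
  finally show ?thesis by (simp add: emeasure_design[OF X p(1) A])
qed

section \<open>The good event for the design points\<close>

locale regression_design = lipschitz_domain X \<kappa> s0 for X :: "'a::euclidean_space set" and \<kappa> s0 +
  fixes p :: "'a \<Rightarrow> real" and p_min p_max :: real and K :: "real \<Rightarrow> real"
  assumes P: "prob_space (design_distribution X p)" and p_cont: "continuous_on X p"
    and p_min: "0 < p_min" and p_bounds: "\<And>x. x \<in> X \<Longrightarrow> p_min \<le> p x" "\<And>x. x \<in> X \<Longrightarrow> p x \<le> p_max"
    and K_nonneg: "\<And>t. 0 \<le> t \<Longrightarrow> 0 \<le> K t" and K_antimono: "antimono_on {0..} K"
    and K_support: "\<And>t. 1 < t \<Longrightarrow> K t = 0" and K1: "0 < K 1" and s0_le_1: "s0 \<le> 1"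
begin

abbreviation "P \<equiv> design_distribution X p"

lemma X_nonempty: "X \<noteq> {}"
  using prob_space.not_empty[OF P] by simp

lemma p_max: "0 < p_max"
proof -
  obtain x where "x \<in> X" using X_nonempty by blast
  then show ?thesis using p_bounds[of x] p_min by linarith
qed

lemma K_le: "0 \<le> t \<Longrightarrow> K t \<le> K 0 * of_bool (t \<le> 1)"
  using K_antimono K_support[of t] by (auto simp: monotone_on_def)

lemma K_ge: "0 \<le> t \<Longrightarrow> K 1 * of_bool (t \<le> 1) \<le> K t"
  using K_antimono K_nonneg[of t] by (auto simp: monotone_on_def)

lemma K0: "0 < K 0"
  using K_le[of 1] K1 by simp

text \<open>Monotone functions are Borel; as \<open>K\<close> is monotone only on the half line, it
  is first made constant to the left of 0.\<close>

lemma measurable_K_norm: "f \<in> borel_measurable M \<Longrightarrow> (\<And>x. 0 \<le> f x) \<Longrightarrow> (\<lambda>x. K (f x)) \<in> borel_measurable M"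
proof -
  assume f: "f \<in> borel_measurable M" "\<And>x. 0 \<le> f x"
  have "mono (\<lambda>t. - K (max t 0))"
    using K_antimono by (auto simp: mono_def monotone_on_def max_def)
  then have "(\<lambda>t. - (- K (max t 0))) \<in> borel_measurable borel"
    by (intro borel_measurable_uminus borel_measurable_mono)
  then have "(\<lambda>x. K (max (f x) 0)) \<in> borel_measurable M"
    using f(1) by simp
  moreover have "max (f x) 0 = f x" for x using f(2)[of x] by simp
  ultimately show ?thesis by simp
qed

definition net_of :: "real \<Rightarrow> 'a set" where
  "net_of s = (SOME Z. finite Z \<and> Z \<subseteq> X \<and> (\<forall>x\<in>X. \<exists>z\<in>Z. dist z x < s) \<and>
     real (card Z) \<le> 2 ^ DIM('a) * measure lborel X / cone_const / s ^ DIM('a))"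

lemma net_of:
  assumes "0 < s" "s \<le> s0"
  shows "finite (net_of s)" "net_of s \<subseteq> X" "\<And>x. x \<in> X \<Longrightarrow> \<exists>z\<in>net_of s. dist z x < s"
    "real (card (net_of s)) \<le> 2 ^ DIM('a) * measure lborel X / cone_const / s ^ DIM('a)"
proof -
  have "\<exists>Z. finite Z \<and> Z \<subseteq> X \<and> (\<forall>x\<in>X. \<exists>z\<in>Z. dist z x < s) \<and>
     real (card Z) \<le> 2 ^ DIM('a) * measure lborel X / cone_const / s ^ DIM('a)"
    using ex_net[OF assms] by metis
  from someI_ex[OF this] show "finite (net_of s)" "net_of s \<subseteq> X" "\<And>x. x \<in> X \<Longrightarrow> \<exists>z\<in>net_of s. dist z x < s"
    "real (card (net_of s)) \<le> 2 ^ DIM('a) * measure lborel X / cone_const / s ^ DIM('a)"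
    unfolding net_of_def[symmetric] by auto
qed

text \<open>\<open>2 * a0 * r ^ d\<close> bounds from below the mass of a ball of radius
  \<open>r / 8\<close> centred in \<open>X\<close>, and the lower tail bound loses the factor 2. For
  \<open>a1\<close>, the mass of a ball of radius \<open>r / 2\<close> is at most
  \<open>a1 / 3 * r ^ d\<close>, and the upper tail bound loses the factor 3.\<close>

definition a0 :: real where "a0 = p_min * cone_const / 8 ^ DIM('a) / 2"

definition a1 :: real where "a1 = 3 * (p_max * V / 2 ^ DIM('a))"

lemma a0_pos: "0 < a0" and a1_pos: "0 < a1"
  using p_min cone_const_pos p_max V_pos by (auto simp: a0_def a1_def)

text \<open>If \<open>dist z y < r / 8\<close>, then \<open>ball y (r / 4)\<close> contains
  \<open>ball z (r / 8)\<close> and is contained in \<open>ball z (r / 2)\<close>, so counts around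
  net points control the counts around every point of \<open>X\<close>. Finiteness of the net makes
  the event measurable and permits a union bound.\<close>

definition good :: "nat \<Rightarrow> real \<Rightarrow> (nat \<Rightarrow> 'a) set" where
  "good n r = {x \<in> space (\<Pi>\<^sub>M i\<in>{..<n}. P). \<forall>z\<in>net_of (r / 8).
     n * (2 * a0 * r ^ DIM('a)) / 2 \<le> card {i. i < n \<and> x i \<in> X \<inter> ball z (r / 8)} \<and>
     card {i. i < n \<and> x i \<in> X \<inter> ball z (r / 2)} \<le> 3 * n * (a1 / 3 * r ^ DIM('a))}"

lemma sets_cell_P[measurable]: "X \<inter> ball z t \<in> sets P"
  using open_X by (intro sets_design) auto

lemma sets_good[measurable]:
  assumes "0 < r" "r \<le> s0" shows "good n r \<in> sets (\<Pi>\<^sub>M i\<in>{..<n}. P)"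
proof -
  have "(\<lambda>x. real (card {i. i < n \<and> x i \<in> X \<inter> ball z t})) \<in> borel_measurable (\<Pi>\<^sub>M i\<in>{..<n}. P)" for z t
    unfolding card_eq_sum_indicator by simp
  note mc = this
  have "finite (net_of (r / 8))" using net_of(1)[of "r / 8"] assms s0 by simp
  then show ?thesis
    unfolding good_def
    by (intro sets.sets_Collect_finite_All sets.sets_Collect_conj borel_measurable_le borel_measurable_const mc)
qed

lemma emeasure_not_good:
  assumes r: "0 < r" "r \<le> s0"
  shows "emeasure (\<Pi>\<^sub>M i\<in>{..<n}. P) (space (\<Pi>\<^sub>M i\<in>{..<n}. P) - good n r)
     \<le> ennreal (card (net_of (r / 8)) * (exp (- (1 / 2 - exp (- 1)) * (n * (2 * a0 * r ^ DIM('a)))) + exp (- (n * (a1 / 3 * r ^ DIM('a))))))"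
proof -
  let ?M = "\<Pi>\<^sub>M i\<in>{..<n}. P"
  interpret P: prob_space P by (rule P)
  define L where "L z = {x \<in> space ?M. card {i. i < n \<and> x i \<in> X \<inter> ball z (r / 8)} < n * (2 * a0 * r ^ DIM('a)) / 2}" for z
  define U where "U z = {x \<in> space ?M. 3 * n * (a1 / 3 * r ^ DIM('a)) < card {i. i < n \<and> x i \<in> X \<inter> ball z (r / 2)}}" for z
  have Z: "finite (net_of (r / 8))" "net_of (r / 8) \<subseteq> X" using net_of[of "r / 8"] r s0 by auto
  have mc: "(\<lambda>x. real (card {i. i < n \<and> x i \<in> X \<inter> ball z t})) \<in> borel_measurable ?M" for z t
    unfolding card_eq_sum_indicator by simp
  have [measurable]: "L z \<in> sets ?M" "U z \<in> sets ?M" for z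
    unfolding L_def U_def by (intro borel_measurable_less borel_measurable_const mc)+
  have em: "emeasure P (X \<inter> ball z t) = ennreal (measure P (X \<inter> ball z t))" for z t
    by (rule P.emeasure_eq_measure)
  have el: "emeasure lborel (X \<inter> ball z t) = ennreal (measure lborel (X \<inter> ball z t))" for z :: 'a and t
    by (rule emeasure_eq_ennreal_measure) (use emeasure_bounded_less_top[of "X \<inter> ball z t"] in \<open>auto simp: bounded_Int\<close>)
  have lo: "2 * a0 * r ^ DIM('a) \<le> measure P (X \<inter> ball z (r / 8))" if "z \<in> net_of (r / 8)" for z
  proof -
    have "cone_const * (r / 8) ^ DIM('a) \<le> measure lborel (X \<inter> ball z (r / 8))"
      using that Z r s0 by (intro volume_ge) auto
    then have "p_min * (cone_const * (r / 8) ^ DIM('a)) \<le> p_min * measure lborel (X \<inter> ball z (r / 8))"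
      using p_min by (intro mult_left_mono) auto
    moreover have "ennreal p_min * emeasure lborel (X \<inter> ball z (r / 8)) \<le> emeasure P (X \<inter> ball z (r / 8))"
      using p_bounds open_X by (intro emeasure_design_ge p_cont) auto
    then have "p_min * measure lborel (X \<inter> ball z (r / 8)) \<le> measure P (X \<inter> ball z (r / 8))"
      using p_min by (simp add: em el ennreal_mult[symmetric])
    ultimately have "p_min * (cone_const * (r / 8) ^ DIM('a)) \<le> measure P (X \<inter> ball z (r / 8))"
      by linarith
    then show ?thesis by (simp add: a0_def power_divide mult_ac)
  qed
  have up: "measure P (X \<inter> ball z (r / 2)) \<le> a1 / 3 * r ^ DIM('a)" for z
  proof -
    have "emeasure P (X \<inter> ball z (r / 2)) \<le> ennreal p_max * emeasure lborel (X \<inter> ball z (r / 2))"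
      using p_bounds open_X by (intro emeasure_design_le p_cont) auto
    then have "measure P (X \<inter> ball z (r / 2)) \<le> p_max * measure lborel (X \<inter> ball z (r / 2))"
      using p_max by (simp add: em el ennreal_mult[symmetric])
    also have "\<dots> \<le> p_max * measure lborel (ball z (r / 2))"
      using p_max open_X
      by (intro mult_left_mono measure_mono_fmeasurable fmeasurableI) (auto simp: emeasure_bounded_less_top)
    also have "\<dots> = a1 / 3 * r ^ DIM('a)"
      using r by (simp add: measure_ball a1_def power_divide)
    finally show ?thesis .
  qed
  have "space ?M - good n r \<subseteq> (\<Union>z\<in>net_of (r / 8). L z \<union> U z)"
    by (auto simp: good_def L_def U_def not_le)
  then have "emeasure ?M (space ?M - good n r) \<le> emeasure ?M (\<Union>z\<in>net_of (r / 8). L z \<union> U z)"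
    using Z by (intro emeasure_mono) auto
  also have "\<dots> \<le> (\<Sum>z\<in>net_of (r / 8). emeasure ?M (L z \<union> U z))"
    using Z by (intro emeasure_subadditive_finite) auto
  also have "\<dots> \<le> (\<Sum>z\<in>net_of (r / 8). ennreal (exp (- (1 / 2 - exp (- 1)) * (n * (2 * a0 * r ^ DIM('a)))) + exp (- (n * (a1 / 3 * r ^ DIM('a))))))"
  proof (rule sum_mono)
    fix z assume z: "z \<in> net_of (r / 8)"
    have "emeasure ?M (L z \<union> U z) \<le> emeasure ?M (L z) + emeasure ?M (U z)"
      by (intro emeasure_subadditive) auto
    also have "\<dots> \<le> ennreal (exp (- (1 / 2 - exp (- 1)) * (n * (2 * a0 * r ^ DIM('a))))) + ennreal (exp (- (n * (a1 / 3 * r ^ DIM('a)))))"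
    proof (rule add_mono)
      show "emeasure ?M (L z) \<le> ennreal (exp (- (1 / 2 - exp (- 1)) * (n * (2 * a0 * r ^ DIM('a)))))"
        unfolding L_def using a0_pos r by (intro chernoff_lower[OF P] lo[OF z]) auto
      show "emeasure ?M (U z) \<le> ennreal (exp (- (n * (a1 / 3 * r ^ DIM('a)))))"
        unfolding U_def by (intro chernoff_upper[OF P] up) auto
    qed
    finally show "emeasure ?M (L z \<union> U z) \<le> ennreal (exp (- (1 / 2 - exp (- 1)) * (n * (2 * a0 * r ^ DIM('a)))) + exp (- (n * (a1 / 3 * r ^ DIM('a)))))"
      by simp
  qed
  also have "\<dots> = ennreal (card (net_of (r / 8)) * (exp (- (1 / 2 - exp (- 1)) * (n * (2 * a0 * r ^ DIM('a)))) + exp (- (n * (a1 / 3 * r ^ DIM('a))))))"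
    by (simp add: ennreal_of_nat_eq_real_of_nat ennreal_mult)
  finally show ?thesis .
qed

lemma graph_sample_good:
  assumes r: "0 < r" "r \<le> s0" and n: "0 < n" and x: "x \<in> good n r"
  shows "graph_sample X \<kappa> s0 n r x (n * a0 * r ^ DIM('a)) (n * a1 * r ^ DIM('a))"
proof
  show "0 < n * a0 * r ^ DIM('a)" "0 \<le> n * a1 * r ^ DIM('a)" using n a0_pos a1_pos r by auto
  show xs: "x i \<in> X" if "i < n" for i
    using x that by (auto simp: good_def space_PiM PiE_iff)
  fix y assume y: "y \<in> X"
  obtain z where z: "z \<in> net_of (r / 8)" "dist z y < r / 8"
    using net_of(3)[of "r / 8" y] y r s0 by auto
  have "n * a0 * r ^ DIM('a) = n * (2 * a0 * r ^ DIM('a)) / 2" by simp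
  also have "\<dots> \<le> card {i. i < n \<and> x i \<in> X \<inter> ball z (r / 8)}" using x z by (auto simp: good_def)
  also have "\<dots> \<le> card {i. i < n \<and> dist (x i) y < r / 4}"
  proof (intro of_nat_mono card_mono)
    show "{i. i < n \<and> x i \<in> X \<inter> ball z (r / 8)} \<subseteq> {i. i < n \<and> dist (x i) y < r / 4}"
    proof clarify
      fix i assume "x i \<in> ball z (r / 8)"
      then show "dist (x i) y < r / 4"
        using z(2) dist_triangle[of "x i" y z] by (simp add: dist_commute)
    qed
  qed simp
  finally show "n * a0 * r ^ DIM('a) \<le> card {i. i < n \<and> dist (x i) y < r / 4}" .
  have "real (card {i. i < n \<and> dist (x i) y < r / 4}) \<le> card {i. i < n \<and> x i \<in> X \<inter> ball z (r / 2)}"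
  proof (intro of_nat_mono card_mono)
    show "{i. i < n \<and> dist (x i) y < r / 4} \<subseteq> {i. i < n \<and> x i \<in> X \<inter> ball z (r / 2)}"
    proof clarify
      fix i assume i: "i < n" "dist (x i) y < r / 4"
      then have "dist z (x i) < r / 2"
        using z(2) dist_triangle[of z "x i" y] r by (simp add: dist_commute)
      then show "x i \<in> X \<inter> ball z (r / 2)" using xs[OF i(1)] by simp
    qed
  qed simp
  also have "\<dots> \<le> 3 * n * (a1 / 3 * r ^ DIM('a))" using x z by (auto simp: good_def)
  finally show "real (card {i. i < n \<and> dist (x i) y < r / 4}) \<le> n * a1 * r ^ DIM('a)" by simp
qed (use r in auto)

end

section \<open>The smoother as the solution of a linear system\<close>

context eigensystem
begin

lemma ip_cong: "(\<And>i. i < n \<Longrightarrow> y i = y' i) \<Longrightarrow> ip n y z = ip n y' z"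
  by (simp add: ip_def)

lemma smoother_cong: "(\<And>i. i < n \<Longrightarrow> y i = y' i) \<Longrightarrow> smoother \<rho> y = smoother \<rho> y'"
  using ip_cong[of y y'] by (simp add: smoother_def)

lemma qform_eigenvector:
  assumes "k < n" shows "qform n L (v k) f = ev k * ip n f (v k)"
proof -
  have "qform n L (v k) f = qform n L (v k) (\<lambda>i. \<Sum>l<n. ip n f (v l) * v l i)"
    unfolding qform_def by (intro sum.cong refl) (simp add: expand[of _ f])
  also have "\<dots> = (\<Sum>l<n. if l = k then ip n f (v l) * ev k else 0)"
    unfolding qform_sum_right by (intro sum.cong refl) (use assms in \<open>auto simp: offdiag ev_def\<close>)
  finally show ?thesis using assms by (simp add: mult.commute)
qed

text \<open>Both sides have the same inner product with every eigenvector, and the eigenvectors are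
  complete. This is the fixed point equation that the Jacobi iteration solves.\<close>

lemma smoother_equation:
  assumes "0 \<le> \<rho>" "i < n"
  shows "smoother \<rho> y i + \<rho> * (\<Sum>j<n. L i j * smoother \<rho> y j) = y i"
proof -
  define f where "f = smoother \<rho> y"
  define g where "g i = f i + \<rho> * (\<Sum>j<n. L i j * f j)" for i
  have "ip n g (v k) = ip n y (v k)" if k: "k < n" for k
  proof -
    have "ip n g (v k) = ip n f (v k) + \<rho> * qform n L (v k) f"
      by (simp add: ip_def g_def qform_def algebra_simps sum.distrib sum_distrib_left)
    also have "\<dots> = (1 + \<rho> * ev k) * ip n f (v k)"
      by (simp add: qform_eigenvector[OF k] algebra_simps)
    also have "\<dots> = ip n y (v k)"
    proof -
      have "0 < 1 + \<rho> * ev k" using assms ev_nonneg[of k] by (intro add_pos_nonneg) auto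
      then show ?thesis by (simp add: f_def ip_smoother[OF k])
    qed
    finally show ?thesis .
  qed
  then have "g i = y i"
    using expand[OF assms(2), of g] expand[OF assms(2), of y] by simp
  then show ?thesis by (simp add: g_def f_def)
qed

end

section \<open>Eigenvalue counts and the variance term\<close>

context regression_design
begin

abbreviation lap :: "nat \<Rightarrow> real \<Rightarrow> (nat \<Rightarrow> 'a) \<Rightarrow> nat \<Rightarrow> nat \<Rightarrow> real" where
  "lap n r x \<equiv> laplacian_matrix n (weight_matrix K r x)"

lemma weight_nonneg: "0 < r \<Longrightarrow> 0 \<le> weight_matrix K r x i j"
  by (simp add: weight_matrix_def K_nonneg)

lemma qform_lap:
  "qform n (lap n r x) f f = (\<Sum>i<n. \<Sum>j<n. weight_matrix K r x i j * (f i - f j)\<^sup>2) / 2"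
  by (rule qform_laplacian) (simp add: weight_matrix_def norm_minus_commute)

lemma ex_eigensystem:
  assumes "0 < r" obtains v where "eigensystem n (lap n r x) v"
proof -
  have psd: "0 \<le> qform n (lap n r x) f f" for f
    unfolding qform_lap using weight_nonneg[OF assms] by (intro divide_nonneg_nonneg sum_nonneg mult_nonneg_nonneg) auto
  have "lap n r x i j = lap n r x j i" if "i < n" "j < n" for i j
    by (simp add: laplacian_matrix_def degree_matrix_def weight_matrix_def norm_minus_commute)
  note sym = this
  show thesis
  proof (rule symmetric_diagonalization[of n "lap n r x"])
    fix v :: "nat \<Rightarrow> nat \<Rightarrow> real"
    assume "\<And>k l. k < n \<Longrightarrow> l < n \<Longrightarrow> ip n (v k) (v l) = (if k = l then 1 else 0)"
      "\<And>i j. i < n \<Longrightarrow> j < n \<Longrightarrow> (\<Sum>k<n. v k i * v k j) = (if i = j then 1 else 0)"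
      "\<And>k l. k < n \<Longrightarrow> l < n \<Longrightarrow> k \<noteq> l \<Longrightarrow> qform n (lap n r x) (v k) (v l) = 0"
    with psd show thesis by (intro that[of v] eigensystem.intro)
  qed (rule sym)
qed

text \<open>The constant \<open>A\<close> of \<open>discrete_poincare\<close> for
  \<open>N0 = n * a0 * r ^ d\<close> and \<open>N1 = n * a1 * r ^ d\<close>: all powers of
  \<open>r\<close> cancel and \<open>energy_const / n\<close> remains. \<open>coarse_const\<close>
  arises from the bound on \<open>U z\<close> in the same way, and \<open>poincare_const\<close>
  adds the factor \<open>2 / K 1\<close> for passing from the graph energy to the Laplacian
  form.\<close>

definition energy_const :: real where
  "energy_const = 2 * V / (4 ^ DIM('a) * a0)
     + 4 * a1 * (2 * \<kappa> + 7) ^ (DIM('a) + 2) * (2 * \<kappa> + 5) ^ DIM('a) * V / (4 ^ DIM('a) * a0)\<^sup>2"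

definition poincare_const :: real where
  "poincare_const = 4 ^ DIM('a) / cone_const * energy_const * (2 / K 1)"

definition coarse_const :: real where
  "coarse_const = 4 * a1 * 2 ^ DIM('a) * V / (cone_const * a0)"

definition net_const :: real where
  "net_const = 2 ^ DIM('a) * measure lborel X / cone_const"

definition count_const :: real where "count_const = 2 * coarse_const * net_const + 1"

lemma consts_pos: "0 < energy_const" "0 < poincare_const" "0 < coarse_const" "0 \<le> net_const" "0 < count_const"
proof -
  show 1: "0 < energy_const" unfolding energy_const_def
    using V_pos a0_pos a1_pos \<kappa> by (intro add_pos_nonneg) auto
  show "0 < poincare_const" unfolding poincare_const_def using 1 cone_const_pos K1 by simp
  show 2: "0 < coarse_const" unfolding coarse_const_def using V_pos a0_pos a1_pos cone_const_pos by simp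
  show 3: "0 \<le> net_const" unfolding net_const_def using cone_const_pos by simp
  show "0 < count_const" unfolding count_const_def using 2 3 by (intro add_nonneg_pos) auto
qed

text \<open>\<open>K 1\<close> bounds the kernel from below for pairs within \<open>r\<close>, so
  the graph energy is at most \<open>2 / K 1\<close> times the Laplacian form, and the Poincare
  inequality at scale \<open>s\<close> becomes the premise of
  \<open>count_small_eigenvalues\<close>. \<open>xx\<close> is tied to \<open>x\<close> only below
  \<open>n\<close>, because a sample is undefined beyond.\<close>

lemma card_small_eigenvalues:
  assumes r: "0 < r" "r \<le> s0" and n: "0 < n" and x: "x \<in> good n r" and xx: "\<And>i. i < n \<Longrightarrow> xx i = x i"
    and v: "eigensystem n (lap n r xx) v" and s: "r \<le> s" "s \<le> s0"
  shows "real (card {k. k < n \<and> eigensystem.ev n (lap n r xx) v k < n * r ^ (DIM('a) + 2) / (2 * poincare_const) / s\<^sup>2})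
     \<le> count_const / s ^ DIM('a)"
proof -
  let ?L = "lap n r xx"
  interpret E: eigensystem n ?L v by (rule v)
  interpret S: graph_sample X \<kappa> s0 n r x "n * a0 * r ^ DIM('a)" "n * a1 * r ^ DIM('a)"
    by (rule graph_sample_good[OF r n x])
  have s_pos: "0 < s" using s r by simp
  define vN where "vN = S.vb / (n * a0 * r ^ DIM('a))"
  have vN: "vN = V / (4 ^ DIM('a) * a0) / n"
    using r n a0_pos by (simp add: vN_def S.vb_def power_divide)
  define T where "T = poincare_const * s\<^sup>2 / (n * r ^ (DIM('a) + 2))"
  have T: "0 < T" using consts_pos s_pos r n by (simp add: T_def)
  obtain Z :: "'a set" and U where Z: "finite Z" "real (card Z) \<le> 2 ^ DIM('a) * measure lborel X / cone_const / s ^ DIM('a)"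
    and U: "\<And>z. z \<in> Z \<Longrightarrow> (\<Sum>i<n. (U z i)\<^sup>2) \<le> 4 ^ DIM('a) / (cone_const * r ^ DIM('a)) * 4 * (n * a1 * r ^ DIM('a)) * 2 ^ DIM('a) * S.vb / (n * a0 * r ^ DIM('a))"
    and P: "\<And>f. (\<Sum>i<n. (f i)\<^sup>2) \<le> (\<Sum>z\<in>Z. (ip n f (U z))\<^sup>2) + 4 ^ DIM('a) / (cone_const * r ^ DIM('a)) *
       (2 * S.vb / (n * a0 * r ^ DIM('a)) + 4 * (n * a1 * r ^ DIM('a)) * (2 * \<kappa> + 7) ^ (DIM('a) + 2) * (2 * \<kappa> + 5) ^ DIM('a) * (S.vb / (n * a0 * r ^ DIM('a)))\<^sup>2 / (V * r ^ DIM('a)))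
       * (s / r)\<^sup>2 * S.energy f"
    using S.discrete_poincare[OF s] by blast
  have "real (card {k. k < n \<and> E.ev k < 1 / (2 * T)}) \<le> 2 * coarse_const * card Z"
  proof (rule E.count_small_eigenvalues[OF Z(1) _ _ T])
    fix z assume "z \<in> Z"
    from U[OF this] have "(\<Sum>i<n. (U z i)\<^sup>2) \<le> 4 ^ DIM('a) / (cone_const * r ^ DIM('a)) * 4 * (n * a1 * r ^ DIM('a)) * 2 ^ DIM('a) * vN"
      by (simp add: vN_def)
    also have "\<dots> = coarse_const"
      using r n by (simp add: vN coarse_const_def)
    finally show "(\<Sum>i<n. (U z i)\<^sup>2) \<le> coarse_const" .
  next
    fix f
    have "K 1 / 2 * S.energy f \<le> qform n ?L f f"
      unfolding S.energy_def qform_lap sum_distrib_left sum_divide_distrib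
    proof (intro sum_mono)
      fix i j assume "i \<in> {..<n}" "j \<in> {..<n}"
      then have "K 1 * of_bool (dist (x i) (x j) \<le> r) \<le> weight_matrix K r xx i j"
        using K_ge[of "norm (x i - x j) / r"] r xx by (simp add: weight_matrix_def dist_norm)
      then have "K 1 * of_bool (dist (x i) (x j) \<le> r) * (f i - f j)\<^sup>2 \<le> weight_matrix K r xx i j * (f i - f j)\<^sup>2"
        by (rule mult_right_mono) simp
      then show "K 1 / 2 * (of_bool (dist (x i) (x j) \<le> r) * (f i - f j)\<^sup>2) \<le> weight_matrix K r xx i j * (f i - f j)\<^sup>2 / 2"
        by simp
    qed
    then have e: "S.energy f \<le> 2 / K 1 * qform n ?L f f" using K1 by (simp add: field_simps)
    let ?A = "2 * S.vb / (n * a0 * r ^ DIM('a)) + 4 * (n * a1 * r ^ DIM('a)) * (2 * \<kappa> + 7) ^ (DIM('a) + 2) * (2 * \<kappa> + 5) ^ DIM('a) * (S.vb / (n * a0 * r ^ DIM('a)))\<^sup>2 / (V * r ^ DIM('a))"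
    have A: "?A = energy_const / n"
    proof -
      define b c where "b = (2 * \<kappa> + 7) ^ (DIM('a) + 2)" and "c = (2 * \<kappa> + 5) ^ DIM('a)"
      have "?A = 2 * vN + 4 * (n * a1 * r ^ DIM('a)) * b * c * vN\<^sup>2 / (V * r ^ DIM('a))"
        by (simp add: vN_def b_def c_def)
      also have "\<dots> = (2 * V / (4 ^ DIM('a) * a0) + 4 * a1 * b * c * V / (4 ^ DIM('a) * a0)\<^sup>2) / n"
        using r n V_pos by (simp add: vN add_divide_distrib power_divide power2_eq_square)
      finally show ?thesis by (simp add: energy_const_def b_def c_def)
    qed
    have "4 ^ DIM('a) / (cone_const * r ^ DIM('a)) * ?A * (s / r)\<^sup>2 * S.energy f
       \<le> 4 ^ DIM('a) / (cone_const * r ^ DIM('a)) * ?A * (s / r)\<^sup>2 * (2 / K 1 * qform n ?L f f)"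
      unfolding A using cone_const_pos r consts_pos by (intro mult_left_mono e) auto
    also have "\<dots> = T * qform n ?L f f"
      unfolding A by (simp add: T_def poincare_const_def power_add power_divide power2_eq_square mult_ac)
    finally show "(\<Sum>i<n. (f i)\<^sup>2) \<le> (\<Sum>z\<in>Z. (ip n f (U z))\<^sup>2) + T * qform n ?L f f"
      using P[of f] by linarith
  qed
  also have "\<dots> \<le> 2 * coarse_const * (net_const / s ^ DIM('a))"
    using Z(2) consts_pos by (intro mult_left_mono) (auto simp: net_const_def)
  also have "\<dots> \<le> count_const / s ^ DIM('a)"
    using s_pos by (simp add: count_const_def divide_right_mono)
  also have "1 / (2 * T) = n * r ^ (DIM('a) + 2) / (2 * poincare_const) / s\<^sup>2"
    by (simp add: T_def)
  finally show ?thesis .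
qed

definition variance_const :: real where
  "variance_const = count_const * (2 / s0) ^ DIM('a) + 32 * count_const / (1 / (2 * poincare_const))\<^sup>2 + 1 / (1 / (2 * poincare_const))\<^sup>2"

lemma variance_const_pos: "0 < variance_const"
  unfolding variance_const_def using consts_pos s0 by (intro add_pos_pos) auto

lemma variance_bound:
  assumes r: "0 < r" "r \<le> s0" and n: "0 < n" and x: "x \<in> good n r" and xx: "\<And>i. i < n \<Longrightarrow> xx i = x i"
    and v: "eigensystem n (lap n r xx) v"
    and \<sigma>: "r \<le> \<sigma>" "\<sigma> \<le> 1" "n * r ^ 4 \<le> \<sigma> ^ (4 - DIM('a))" and d: "DIM('a) \<le> 3"
    and \<rho>: "0 < \<rho>" "\<rho> * (n * r ^ (DIM('a) + 2)) = \<sigma>\<^sup>2"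
  shows "(\<Sum>k<n. 1 / (1 + \<rho> * eigensystem.ev n (lap n r xx) v k)\<^sup>2) \<le> variance_const / \<sigma> ^ DIM('a)"
  unfolding variance_const_def
proof (rule sum_inverse_square_bound[where r=r and A="n * r ^ (DIM('a) + 2) / (2 * poincare_const)"])
  show "0 \<le> eigensystem.ev n (lap n r xx) v k" for k by (rule eigensystem.ev_nonneg[OF v])
  show "\<rho> * (n * r ^ (DIM('a) + 2) / (2 * poincare_const)) = 1 / (2 * poincare_const) * \<sigma>\<^sup>2"
    using \<rho>(2) by simp
  show "real (card {k. k < n \<and> eigensystem.ev n (lap n r xx) v k < n * r ^ (DIM('a) + 2) / (2 * poincare_const) / s\<^sup>2})
     \<le> count_const / s ^ DIM('a)" if "r \<le> s" "s \<le> s0" for s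
    by (rule card_small_eigenvalues[OF r n x xx v that])
qed (use assms consts_pos s0_le_1 in auto)

section \<open>The bias term and measurability of the estimator\<close>

definition bias_const :: real where "bias_const = p_max * (p_max * K 0) * sobolev_const"

lemma bias_const_pos: "0 < bias_const"
  using p_max K0 sobolev_const_pos by (simp add: bias_const_def)

lemma measurable_f0: "f0 \<in> H1_ball X M \<Longrightarrow> f0 \<in> borel_measurable P"
  by (simp add: H1_ball_def H1_space_def L2_space_def design_distribution_def)

text \<open>Bounding both densities by \<open>p_max\<close> and the kernel by \<open>K 0\<close> on
  \<open>[0, 1]\<close> leaves the nonlocal energy at scale \<open>r\<close>. Since \<open>P\<close>
  has a density, \<open>f0\<close> may be exchanged for its Borel representative in both
  variables.\<close>

lemma pair_energy_bound:
  assumes f0: "f0 \<in> H1_ball X M" and r: "0 < r" "r \<le> s0"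
  shows "(\<integral>\<^sup>+y. \<integral>\<^sup>+z. ennreal (K (norm (y - z) / r) * (f0 y - f0 z)\<^sup>2) \<partial>P \<partial>P)
     \<le> ennreal (bias_const * r ^ (DIM('a) + 2) * M\<^sup>2)"
proof -
  interpret P: prob_space P by (rule P)
  have [measurable]: "f0 \<in> borel_measurable P" by (rule measurable_f0[OF f0])
  have [measurable]: "X \<in> sets borel" using open_X by simp
  obtain f g where f: "integrable lborel f" and g: "integrable lborel g"
    and W: "\<And>\<phi> i. test_function X \<phi> \<Longrightarrow> i \<in> Basis \<Longrightarrow>
       (LINT x|lborel. f x * frechet_derivative \<phi> (at x) i) = - (LINT x|lborel. (g x \<bullet> i) * \<phi> x)"
    and eq: "AE x in lborel. x \<in> X \<longrightarrow> f0 x = f x" and gM: "sq_int X g \<le> ennreal (M\<^sup>2)"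
    using H1_ball_representative[OF open_X finite_X f0] by blast
  have [measurable]: "f \<in> borel_measurable borel" using f by auto
  define h where "h y z = ennreal (K (norm (y - z) / r) * (f0 y - f0 z)\<^sup>2)" for y z
  define e where "e y z = ennreal (of_bool (y \<in> X \<and> z \<in> X \<and> dist y z \<le> r) * (f y - f z)\<^sup>2)" for y z
  have mh[measurable]: "(\<lambda>(y, z). h y z) \<in> borel_measurable (P \<Otimes>\<^sub>M P)"
  proof -
    have 1: "fst \<in> P \<Otimes>\<^sub>M P \<rightarrow>\<^sub>M borel" "snd \<in> P \<Otimes>\<^sub>M P \<rightarrow>\<^sub>M borel"
      using measurable_compose[OF measurable_fst measurable_id_design] measurable_compose[OF measurable_snd measurable_id_design] by auto
    have "(\<lambda>w. K (norm (fst w - snd w) / r)) \<in> borel_measurable (P \<Otimes>\<^sub>M P)"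
      using 1 r by (intro measurable_K_norm) auto
    moreover have "(\<lambda>w. (f0 (fst w) - f0 (snd w))\<^sup>2) \<in> borel_measurable (P \<Otimes>\<^sub>M P)" by measurable
    ultimately show ?thesis unfolding h_def case_prod_unfold by measurable
  qed
  have me[measurable]: "(\<lambda>(y, z). e y z) \<in> borel_measurable (lborel \<Otimes>\<^sub>M lborel)"
    unfolding e_def by measurable
  have inner: "(\<integral>\<^sup>+z. h y z \<partial>P) \<le> ennreal (p_max * K 0) * (\<integral>\<^sup>+z. e y z \<partial>lborel)" if y: "y \<in> X" "f0 y = f y" for y
  proof -
    have hy: "h y \<in> borel_measurable P"
      using measurable_compose[OF measurable_Pair1' mh, of y] y by simp
    have "(\<integral>\<^sup>+z. h y z \<partial>P) = (\<integral>\<^sup>+z. ennreal (p z) * h y z * indicator X z \<partial>lborel)"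
      by (rule nn_integral_design[OF open_X p_cont hy])
    also have "\<dots> \<le> (\<integral>\<^sup>+z. ennreal (p_max * K 0) * e y z \<partial>lborel)"
    proof (rule nn_integral_mono_AE, use eq in eventually_elim)
      fix z assume z: "z \<in> X \<longrightarrow> f0 z = f z"
      show "ennreal (p z) * h y z * indicator X z \<le> ennreal (p_max * K 0) * e y z"
      proof (cases "z \<in> X")
        case True
        have "K (norm (y - z) / r) \<le> K 0 * of_bool (dist y z \<le> r)"
          using K_le[of "norm (y - z) / r"] r by (simp add: dist_norm)
        then have "p z * (K (norm (y - z) / r) * (f y - f z)\<^sup>2) \<le> p_max * (K 0 * of_bool (dist y z \<le> r) * (f y - f z)\<^sup>2)"
          using p_bounds[OF True] p_min K_nonneg r by (intro mult_mono mult_right_mono mult_nonneg_nonneg) auto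
        then show ?thesis
          using True y z p_bounds(1)[OF True] p_min p_max K0 r K_nonneg[of "norm (y - z) / r"]
          by (simp add: h_def e_def ennreal_mult[symmetric] ennreal_leI mult_ac)
      qed simp
    qed
    also have "\<dots> = ennreal (p_max * K 0) * (\<integral>\<^sup>+z. e y z \<partial>lborel)"
      using measurable_compose[OF measurable_Pair1' me, of y] by (intro nn_integral_cmult) simp
    finally show ?thesis .
  qed
  have mh': "(\<lambda>y. \<integral>\<^sup>+z. h y z \<partial>P) \<in> borel_measurable P"
    by (rule P.borel_measurable_nn_integral[OF mh])
  have "(\<integral>\<^sup>+y. \<integral>\<^sup>+z. h y z \<partial>P \<partial>P) = (\<integral>\<^sup>+y. ennreal (p y) * (\<integral>\<^sup>+z. h y z \<partial>P) * indicator X y \<partial>lborel)"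
    by (rule nn_integral_design[OF open_X p_cont mh'])
  also have "\<dots> \<le> (\<integral>\<^sup>+y. ennreal (p_max * (p_max * K 0)) * (\<integral>\<^sup>+z. e y z \<partial>lborel) \<partial>lborel)"
  proof (rule nn_integral_mono_AE, use eq in eventually_elim)
    fix y assume y: "y \<in> X \<longrightarrow> f0 y = f y"
    show "ennreal (p y) * (\<integral>\<^sup>+z. h y z \<partial>P) * indicator X y \<le> ennreal (p_max * (p_max * K 0)) * (\<integral>\<^sup>+z. e y z \<partial>lborel)"
    proof (cases "y \<in> X")
      case True
      have "ennreal (p y) * (\<integral>\<^sup>+z. h y z \<partial>P) \<le> ennreal p_max * (ennreal (p_max * K 0) * (\<integral>\<^sup>+z. e y z \<partial>lborel))"
        using True y p_bounds[OF True] by (intro mult_mono inner ennreal_leI) auto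
      then show ?thesis using True p_max K0 by (simp add: ennreal_mult mult.assoc)
    qed simp
  qed
  also have "\<dots> = ennreal (p_max * (p_max * K 0)) * nonlocal_energy X r f"
    unfolding nonlocal_energy_def e_def[symmetric] by (rule nn_integral_cmult) measurable
  also have "\<dots> \<le> ennreal (p_max * (p_max * K 0)) * (ennreal (sobolev_const * r ^ (DIM('a) + 2)) * ennreal (M\<^sup>2))"
    by (intro mult_left_mono order_trans[OF nonlocal_energy_le_sobolev[OF f g W r]] gM) auto
  also have "\<dots> = ennreal (bias_const * r ^ (DIM('a) + 2) * M\<^sup>2)"
    using p_max K0 sobolev_const_pos r by (simp add: bias_const_def ennreal_mult mult_ac)
  finally show ?thesis unfolding h_def .
qed

text \<open>By linearity: diagonal pairs vanish, and every other pair consists of two independent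
  design points.\<close>

lemma bias_bound:
  assumes f0: "f0 \<in> H1_ball X M" and r: "0 < r" "r \<le> s0"
  shows "(\<integral>\<^sup>+x. ennreal ((\<Sum>i<n. \<Sum>j<n. K (norm (x i - x j) / r) * (f0 (x i) - f0 (x j))\<^sup>2) / 2) \<partial>(\<Pi>\<^sub>M i\<in>{..<n}. P))
     \<le> ennreal ((real n)\<^sup>2 * (bias_const * r ^ (DIM('a) + 2) * M\<^sup>2) / 2)"
proof -
  let ?M = "\<Pi>\<^sub>M i\<in>{..<n}. P"
  define J where "J = bias_const * r ^ (DIM('a) + 2) * M\<^sup>2"
  have J: "0 \<le> J" using bias_const_pos r by (simp add: J_def)
  have [measurable]: "f0 \<in> borel_measurable P" by (rule measurable_f0[OF f0])
  have mc: "(\<lambda>x. x i) \<in> ?M \<rightarrow>\<^sub>M borel" if "i < n" for i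
  proof -
    have "(\<lambda>x. x i) \<in> ?M \<rightarrow>\<^sub>M P" using that by simp
    from measurable_compose[OF this measurable_id_design] show ?thesis by simp
  qed
  define h where "h x i j = K (norm (x i - x j) / r) * (f0 (x i) - f0 (x j))\<^sup>2" for x :: "nat \<Rightarrow> 'a" and i j
  have h0: "0 \<le> h x i j" for x i j using r by (simp add: h_def K_nonneg)
  have mh: "(\<lambda>x. h x i j) \<in> borel_measurable ?M" if ij: "i < n" "j < n" for i j
  proof -
    have "(\<lambda>x. K (norm (x i - x j) / r)) \<in> borel_measurable ?M"
      using mc[OF ij(1)] mc[OF ij(2)] r by (intro measurable_K_norm) auto
    moreover have "(\<lambda>x. f0 (x i)) \<in> borel_measurable ?M" "(\<lambda>x. f0 (x j)) \<in> borel_measurable ?M"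
      using ij by auto
    ultimately show ?thesis unfolding h_def by measurable
  qed
  have pair: "(\<integral>\<^sup>+x. ennreal (h x i j) \<partial>?M) \<le> ennreal J" if ij: "i < n" "j < n" for i j
  proof (cases "i = j")
    case False
    have 1: "fst \<in> P \<Otimes>\<^sub>M P \<rightarrow>\<^sub>M borel" "snd \<in> P \<Otimes>\<^sub>M P \<rightarrow>\<^sub>M borel"
      using measurable_compose[OF measurable_fst measurable_id_design] measurable_compose[OF measurable_snd measurable_id_design] by auto
    have "(\<lambda>w. K (norm (fst w - snd w) / r)) \<in> borel_measurable (P \<Otimes>\<^sub>M P)"
      using 1 r by (intro measurable_K_norm) auto
    then have "(\<lambda>w. ennreal (K (norm (fst w - snd w) / r) * (f0 (fst w) - f0 (snd w))\<^sup>2)) \<in> borel_measurable (P \<Otimes>\<^sub>M P)"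
      by measurable
    then have "(\<integral>\<^sup>+x. ennreal (h x i j) \<partial>?M) = (\<integral>\<^sup>+y. \<integral>\<^sup>+z. ennreal (K (norm (y - z) / r) * (f0 y - f0 z)\<^sup>2) \<partial>P \<partial>P)"
      unfolding h_def using ij False
      by (intro nn_integral_PiM_two_coordinates[OF P, where h="\<lambda>y z. ennreal (K (norm (y - z) / r) * (f0 y - f0 z)\<^sup>2)"])
         (auto simp: case_prod_unfold)
    also have "\<dots> \<le> ennreal J" unfolding J_def by (rule pair_energy_bound[OF f0 r])
    finally show ?thesis .
  qed (simp add: h_def)
  have "(\<integral>\<^sup>+x. ennreal ((\<Sum>i<n. \<Sum>j<n. h x i j) / 2) \<partial>?M) = (\<integral>\<^sup>+x. ennreal (1 / 2) * (\<Sum>i<n. \<Sum>j<n. ennreal (h x i j)) \<partial>?M)"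
    using h0 by (intro nn_integral_cong) (simp add: sum_nonneg ennreal_mult[symmetric] del: ennreal_half)
  also have "\<dots> = ennreal (1 / 2) * (\<Sum>i<n. \<Sum>j<n. \<integral>\<^sup>+x. ennreal (h x i j) \<partial>?M)"
  proof -
    have "(\<integral>\<^sup>+x. ennreal (1 / 2) * (\<Sum>i<n. \<Sum>j<n. ennreal (h x i j)) \<partial>?M) = ennreal (1 / 2) * (\<integral>\<^sup>+x. (\<Sum>i<n. \<Sum>j<n. ennreal (h x i j)) \<partial>?M)"
      using mh by (intro nn_integral_cmult borel_measurable_sum measurable_compose[OF _ measurable_ennreal]) auto
    also have "(\<integral>\<^sup>+x. (\<Sum>i<n. \<Sum>j<n. ennreal (h x i j)) \<partial>?M) = (\<Sum>i<n. \<integral>\<^sup>+x. (\<Sum>j<n. ennreal (h x i j)) \<partial>?M)"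
      using mh by (intro nn_integral_sum borel_measurable_sum measurable_compose[OF _ measurable_ennreal]) auto
    also have "\<dots> = (\<Sum>i<n. \<Sum>j<n. \<integral>\<^sup>+x. ennreal (h x i j) \<partial>?M)"
      using mh by (intro sum.cong refl nn_integral_sum measurable_compose[OF _ measurable_ennreal]) auto
    finally show ?thesis .
  qed
  also have "\<dots> \<le> ennreal (1 / 2) * (\<Sum>i<n. \<Sum>j<n. ennreal J)"
    by (intro mult_left_mono sum_mono pair) auto
  also have "\<dots> = ennreal ((real n)\<^sup>2 * J / 2)"
    using J by (simp add: ennreal_of_nat_eq_real_of_nat ennreal_mult[symmetric] power2_eq_square del: ennreal_half)
  finally show ?thesis unfolding h_def J_def .
qed

text \<open>The spectral formula yields no measurability, since the eigenvectors are chosen sample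
  by sample. The Jacobi iterates are explicit in the data, hence measurable, and converge pointwise
  to the estimator.\<close>

lemma measurable_laplacian_smoothing:
  assumes r: "0 < r" and \<rho>: "0 \<le> \<rho>" and i: "i < n"
  shows "(\<lambda>\<omega>. laplacian_smoothing K n r \<rho> \<omega> i) \<in> borel_measurable (\<Pi>\<^sub>M i\<in>{..<n}. P \<Otimes>\<^sub>M borel)"
proof -
  let ?M = "\<Pi>\<^sub>M i\<in>{..<n}. P \<Otimes>\<^sub>M (borel :: real measure)"
  let ?W = "\<lambda>\<omega> :: nat \<Rightarrow> 'a \<times> real. weight_matrix K r (\<lambda>i. fst (\<omega> i))" and ?y = "\<lambda>(\<omega> :: nat \<Rightarrow> 'a \<times> real) i. snd (\<omega> i)"
  have mx: "(\<lambda>\<omega>. fst (\<omega> i)) \<in> borel_measurable ?M" if "i < n" for i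
  proof -
    have "(\<lambda>\<omega>. fst (\<omega> i)) \<in> ?M \<rightarrow>\<^sub>M P" using that by simp
    from measurable_compose[OF this measurable_id_design] show ?thesis by simp
  qed
  have mW: "(\<lambda>\<omega>. ?W \<omega> i j) \<in> borel_measurable ?M" if "i < n" "j < n" for i j
    unfolding weight_matrix_def using mx[OF that(1)] mx[OF that(2)] r by (intro measurable_K_norm) auto
  have my: "(\<lambda>\<omega>. snd (\<omega> i)) \<in> borel_measurable ?M" if "i < n" for i using that by simp
  have mj: "(\<lambda>\<omega>. jacobi n (?W \<omega>) \<rho> (?y \<omega>) t i) \<in> borel_measurable ?M" if "i < n" for t i
    using that
  proof (induction t arbitrary: i)
    case (Suc t)
    then show ?case
      using mW my by (auto intro!: borel_measurable_divide borel_measurable_add borel_measurable_times borel_measurable_sum)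
  qed simp
  show ?thesis
  proof (rule borel_measurable_LIMSEQ_real[OF _ mj[OF i]])
    fix \<omega> :: "nat \<Rightarrow> 'a \<times> real" assume "\<omega> \<in> space ?M"
    obtain v where v: "eigensystem n (lap n r (\<lambda>i. fst (\<omega> i))) v" using ex_eigensystem[OF r] by blast
    have fh: "laplacian_smoothing K n r \<rho> \<omega> i = eigensystem.smoother n (lap n r (\<lambda>i. fst (\<omega> i))) v \<rho> (?y \<omega>) i" if "i < n" for i
      unfolding laplacian_smoothing_def by (rule eigensystem.arg_min_objective[OF v \<rho> that])
    show "(\<lambda>t. jacobi n (?W \<omega>) \<rho> (?y \<omega>) t i) \<longlonglongrightarrow> laplacian_smoothing K n r \<rho> \<omega> i"
      unfolding fh[OF i]
      by (rule jacobi_tendsto[OF \<rho> weight_nonneg[OF r] eigensystem.smoother_equation[OF v \<rho>] i])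
  qed
qed

text \<open>With the design frozen, the spectrum is constant and each \<open>ip n e (v k)\<close>
  has second moment 1, so the noise term integrates to the sum controlled by
  \<open>variance_bound\<close>.\<close>

lemma conditional_error_bound:
  fixes r \<sigma> \<rho> M :: real
  assumes f0: "f0 \<in> H1_ball X M" and r: "0 < r" "r \<le> s0" and n: "0 < n" and x: "x \<in> good n r"
    and \<sigma>: "r \<le> \<sigma>" "\<sigma> \<le> 1" "n * r ^ 4 \<le> \<sigma> ^ (4 - DIM('a))" and d: "DIM('a) \<le> 3"
    and \<rho>: "0 < \<rho>" "\<rho> * (n * r ^ (DIM('a) + 2)) = \<sigma>\<^sup>2"
  shows "(\<integral>\<^sup>+e. ennreal (in_sample_error n f0 (sample_of n f0 (x, e)) (laplacian_smoothing K n r \<rho> (sample_of n f0 (x, e))))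
        \<partial>(\<Pi>\<^sub>M i\<in>{..<n}. std_normal_distribution))
    \<le> ennreal (2 * \<rho> / n) * ennreal ((\<Sum>i<n. \<Sum>j<n. K (norm (x i - x j) / r) * (f0 (x i) - f0 (x j))\<^sup>2) / 2)
      + ennreal (2 * variance_const * (1 / (n * \<sigma> ^ DIM('a))))"
proof -
  let ?N = "\<Pi>\<^sub>M i\<in>{..<n}. std_normal_distribution"
  interpret NN: prob_space ?N by (rule prob_space_PiM) (rule prob_space_normal_density, simp)
  \<comment> \<open>Matches the first components of a sample outside its index range, so that the
    Laplacian of the sample is literally \<open>lap n r xx\<close>.\<close>
  define xx where "xx i = (if i < n then x i else fst (undefined :: 'a \<times> real))" for i
  define \<theta> where "\<theta> i = f0 (x i)" for i
  obtain v where v: "eigensystem n (lap n r xx) v" using ex_eigensystem[OF r(1)] by blast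
  interpret E: eigensystem n "lap n r xx" v by (rule v)
  define q where "q = (\<Sum>i<n. \<Sum>j<n. K (norm (x i - x j) / r) * (f0 (x i) - f0 (x j))\<^sup>2) / 2"
  have q: "qform n (lap n r xx) \<theta> \<theta> = q"
    unfolding qform_lap q_def by (simp add: weight_matrix_def xx_def \<theta>_def)
  have q0: "0 \<le> q" using E.psd[of \<theta>] by (simp add: q)
  have xs: "(\<lambda>i. fst (sample_of n f0 (x, e) i)) = xx" for e
    by (auto simp: sample_of_def xx_def)
  have fs: "fst (sample_of n f0 (x, e) i) = x i" "snd (sample_of n f0 (x, e) i) = \<theta> i + e i" if "i < n" for e i
    using that by (auto simp: sample_of_def \<theta>_def)
  define w where "w k = 2 / n * (1 / (1 + \<rho> * E.ev k)\<^sup>2)" for k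
  have w0: "0 \<le> w k" for k by (simp add: w_def)
  have err: "in_sample_error n f0 (sample_of n f0 (x, e)) (laplacian_smoothing K n r \<rho> (sample_of n f0 (x, e)))
     \<le> 2 * \<rho> / n * q + (\<Sum>k<n. w k * (ip n e (v k))\<^sup>2)" for e
  proof -
    let ?\<omega> = "sample_of n f0 (x, e)"
    have ls: "laplacian_smoothing K n r \<rho> ?\<omega> i = E.smoother \<rho> (\<lambda>i. \<theta> i + e i) i" if i: "i < n" for i
    proof -
      have "laplacian_smoothing K n r \<rho> ?\<omega> i = E.smoother \<rho> (\<lambda>i. snd (?\<omega> i)) i"
        unfolding laplacian_smoothing_def xs by (rule E.arg_min_objective) (use \<rho> i in auto)
      also have "E.smoother \<rho> (\<lambda>i. snd (?\<omega> i)) = E.smoother \<rho> (\<lambda>i. \<theta> i + e i)"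
        by (rule E.smoother_cong) (simp add: fs)
      finally show ?thesis .
    qed
    have "in_sample_error n f0 ?\<omega> (laplacian_smoothing K n r \<rho> ?\<omega>) = 1 / n * (\<Sum>i<n. (E.smoother \<rho> (\<lambda>i. \<theta> i + e i) i - \<theta> i)\<^sup>2)"
      unfolding in_sample_error_def by (intro arg_cong2[where f="(*)"] sum.cong refl) (simp add: ls fs \<theta>_def)
    also have "\<dots> \<le> 1 / n * (2 * \<rho> * q + 2 * (\<Sum>k<n. (ip n e (v k))\<^sup>2 / (1 + \<rho> * E.ev k)\<^sup>2))"
      using E.smoother_error[of \<rho> \<theta> e] \<rho> by (intro mult_left_mono) (auto simp: q)
    also have "\<dots> = 2 * \<rho> / n * q + (\<Sum>k<n. w k * (ip n e (v k))\<^sup>2)"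
      by (simp add: w_def sum_distrib_left algebra_simps)
    finally show ?thesis .
  qed
  have mip: "(\<lambda>e. ip n e (v k)) \<in> borel_measurable ?N" for k
  proof -
    have "(\<lambda>e. e i) \<in> borel_measurable ?N" if "i < n" for i
    proof -
      have "(\<lambda>e. e i) \<in> ?N \<rightarrow>\<^sub>M std_normal_distribution" by (rule measurable_component_singleton) (use that in simp)
      then show ?thesis by simp
    qed
    then show ?thesis unfolding ip_def by (intro borel_measurable_sum borel_measurable_times) auto
  qed
  have "(\<integral>\<^sup>+e. ennreal (in_sample_error n f0 (sample_of n f0 (x, e)) (laplacian_smoothing K n r \<rho> (sample_of n f0 (x, e)))) \<partial>?N)
     \<le> (\<integral>\<^sup>+e. ennreal (2 * \<rho> / n * q) + (\<Sum>k<n. ennreal (w k) * ennreal ((ip n e (v k))\<^sup>2)) \<partial>?N)"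
  proof (rule nn_integral_mono)
    fix e
    have "ennreal (2 * \<rho> / n * q + (\<Sum>k<n. w k * (ip n e (v k))\<^sup>2)) = ennreal (2 * \<rho> / n * q) + ennreal (\<Sum>k<n. w k * (ip n e (v k))\<^sup>2)"
      using \<rho> q0 w0 by (intro ennreal_plus) (auto intro!: sum_nonneg)
    also have "ennreal (\<Sum>k<n. w k * (ip n e (v k))\<^sup>2) = (\<Sum>k<n. ennreal (w k) * ennreal ((ip n e (v k))\<^sup>2))"
      using w0 by (subst sum_ennreal[symmetric]) (auto simp: ennreal_mult)
    finally show "ennreal (in_sample_error n f0 (sample_of n f0 (x, e)) (laplacian_smoothing K n r \<rho> (sample_of n f0 (x, e))))
      \<le> ennreal (2 * \<rho> / n * q) + (\<Sum>k<n. ennreal (w k) * ennreal ((ip n e (v k))\<^sup>2))"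
      using ennreal_leI[OF err[of e]] by simp
  qed
  also have "\<dots> = ennreal (2 * \<rho> / n * q) + (\<Sum>k<n. ennreal (w k) * (\<integral>\<^sup>+e. ennreal ((ip n e (v k))\<^sup>2) \<partial>?N))"
    using mip by (subst nn_integral_add) (auto simp: nn_integral_sum nn_integral_cmult NN.emeasure_space_1)
  also have "(\<Sum>k<n. ennreal (w k) * (\<integral>\<^sup>+e. ennreal ((ip n e (v k))\<^sup>2) \<partial>?N)) = (\<Sum>k<n. ennreal (w k))"
  proof (rule sum.cong[OF refl])
    fix k assume "k \<in> {..<n}"
    then have "(\<Sum>i<n. (v k i)\<^sup>2) = 1" using E.row[of k k] by (simp add: ip_def power2_eq_square)
    then have "(\<integral>\<^sup>+e. ennreal ((ip n e (v k))\<^sup>2) \<partial>?N) = 1"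
      unfolding ip_def by (simp add: nn_integral_std_normal_linear_squared)
    then show "ennreal (w k) * (\<integral>\<^sup>+e. ennreal ((ip n e (v k))\<^sup>2) \<partial>?N) = ennreal (w k)" by simp
  qed
  also have "\<dots> = ennreal (2 / n * (\<Sum>k<n. 1 / (1 + \<rho> * E.ev k)\<^sup>2))"
    using w0 by (subst sum_ennreal) (auto simp: w_def sum_distrib_left)
  also have "\<dots> \<le> ennreal (2 / n * (variance_const / \<sigma> ^ DIM('a)))"
  proof (intro ennreal_leI mult_left_mono)
    show "(\<Sum>k<n. 1 / (1 + \<rho> * E.ev k)\<^sup>2) \<le> variance_const / \<sigma> ^ DIM('a)"
      by (rule variance_bound[OF r n x _ v \<sigma> d \<rho>]) (simp add: xx_def)
  qed simp
  also have "2 / n * (variance_const / \<sigma> ^ DIM('a)) = 2 * variance_const * (1 / (n * \<sigma> ^ DIM('a)))" by simp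
  also have "ennreal (2 * \<rho> / n * q) = ennreal (2 * \<rho> / n) * ennreal q"
    using \<rho> q0 by (intro ennreal_mult) auto
  finally show ?thesis unfolding q_def by (simp add: add_left_mono)
qed

definition error_const :: real where "error_const = bias_const + 2 * variance_const"

lemma error_const_pos: "0 < error_const"
  using bias_const_pos variance_const_pos by (simp add: error_const_def)

text \<open>The variance bound is available on good designs only, hence the indicator; the bias is
  integrated over all designs. The relation between \<open>\<rho>\<close> and
  \<open>\<sigma>\<close> makes both terms multiples of the same \<open>R\<close>.\<close>

lemma expected_error_bound:
  fixes r \<sigma> \<rho> M :: real
  assumes f0: "f0 \<in> H1_ball X M" and r: "0 < r" "r \<le> s0" and n: "0 < n"
    and \<sigma>: "r \<le> \<sigma>" "\<sigma> \<le> 1" "n * r ^ 4 \<le> \<sigma> ^ (4 - DIM('a))" and d: "DIM('a) \<le> 3"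
    and \<rho>: "0 < \<rho>" "\<rho> * (n * r ^ (DIM('a) + 2)) = \<sigma>\<^sup>2"
    and R: "\<sigma>\<^sup>2 * M\<^sup>2 = R" "1 / (n * \<sigma> ^ DIM('a)) = R"
  defines "err \<equiv> \<lambda>\<omega>. in_sample_error n f0 \<omega> (laplacian_smoothing K n r \<rho> \<omega>)"
  shows "(\<integral>\<^sup>+z. ennreal (err (sample_of n f0 z)) * indicator (good n r \<times> space (\<Pi>\<^sub>M i\<in>{..<n}. std_normal_distribution)) z \<partial>design_noise n P)
     \<le> ennreal (error_const * R)"
proof -
  let ?N = "\<Pi>\<^sub>M i\<in>{..<n}. std_normal_distribution" and ?M = "\<Pi>\<^sub>M i\<in>{..<n}. P"
  interpret NN: prob_space ?N by (rule prob_space_PiM) (rule prob_space_normal_density, simp)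
  interpret PP: prob_space ?M by (rule prob_space_PiM) (rule P)
  have [measurable]: "f0 \<in> borel_measurable P" by (rule measurable_f0[OF f0])
  have [measurable]: "err \<in> borel_measurable (\<Pi>\<^sub>M i\<in>{..<n}. P \<Otimes>\<^sub>M borel)"
    unfolding err_def in_sample_error_def
    using measurable_laplacian_smoothing[OF r(1) less_imp_le[OF \<rho>(1)]]
    by (intro borel_measurable_times borel_measurable_const borel_measurable_sum borel_measurable_power borel_measurable_diff) auto
  have [measurable]: "good n r \<in> sets ?M" by (rule sets_good[OF r])
  define q where "q x = (\<Sum>i<n. \<Sum>j<n. K (norm (x i - x j) / r) * (f0 (x i) - f0 (x j))\<^sup>2) / 2" for x
  have R0: "0 \<le> R" using R(1) by (metis zero_le_mult_iff zero_le_power2)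
  have "(\<integral>\<^sup>+z. ennreal (err (sample_of n f0 z)) * indicator (good n r \<times> space ?N) z \<partial>design_noise n P)
     = (\<integral>\<^sup>+x. \<integral>\<^sup>+e. ennreal (err (sample_of n f0 (x, e))) * indicator (good n r \<times> space ?N) (x, e) \<partial>?N \<partial>?M)"
    by (rule NN.nn_integral_fst[symmetric]) measurable
  also have "\<dots> \<le> (\<integral>\<^sup>+x. ennreal (2 * \<rho> / n) * ennreal (q x) + ennreal (2 * variance_const * R) \<partial>?M)"
  proof (rule nn_integral_mono)
    fix x
    show "(\<integral>\<^sup>+e. ennreal (err (sample_of n f0 (x, e))) * indicator (good n r \<times> space ?N) (x, e) \<partial>?N)
      \<le> ennreal (2 * \<rho> / n) * ennreal (q x) + ennreal (2 * variance_const * R)"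
    proof (cases "x \<in> good n r")
      case True
      have "(\<integral>\<^sup>+e. ennreal (err (sample_of n f0 (x, e))) * indicator (good n r \<times> space ?N) (x, e) \<partial>?N)
        \<le> (\<integral>\<^sup>+e. ennreal (err (sample_of n f0 (x, e))) \<partial>?N)"
        by (intro nn_integral_mono) (simp add: indicator_def)
      also have "\<dots> \<le> ennreal (2 * \<rho> / n) * ennreal (q x) + ennreal (2 * variance_const * R)"
        unfolding err_def q_def R(2)[symmetric] by (rule conditional_error_bound[OF f0 r n True \<sigma> d \<rho>])
      finally show ?thesis .
    qed simp
  qed
  also have "\<dots> \<le> ennreal (2 * \<rho> / n) * ennreal ((real n)\<^sup>2 * (bias_const * r ^ (DIM('a) + 2) * M\<^sup>2) / 2) + ennreal (2 * variance_const * R)"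
  proof -
    have mc: "(\<lambda>x. x i) \<in> ?M \<rightarrow>\<^sub>M borel" if "i < n" for i
    proof -
      have "(\<lambda>x. x i) \<in> ?M \<rightarrow>\<^sub>M P" using that by simp
      from measurable_compose[OF this measurable_id_design] show ?thesis by simp
    qed
    have mK: "(\<lambda>x. K (norm (x i - x j) / r)) \<in> borel_measurable ?M" if "i < n" "j < n" for i j
      using mc[OF that(1)] mc[OF that(2)] r by (intro measurable_K_norm) auto
    have "q \<in> borel_measurable ?M"
      unfolding q_def using mK
      by (intro borel_measurable_divide borel_measurable_sum borel_measurable_times borel_measurable_power borel_measurable_diff borel_measurable_const) auto
    then have "(\<integral>\<^sup>+x. ennreal (2 * \<rho> / n) * ennreal (q x) + ennreal (2 * variance_const * R) \<partial>?M)
       = ennreal (2 * \<rho> / n) * (\<integral>\<^sup>+x. ennreal (q x) \<partial>?M) + ennreal (2 * variance_const * R)"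
      by (subst nn_integral_add) (auto simp: nn_integral_cmult PP.emeasure_space_1)
    also have "\<dots> \<le> ennreal (2 * \<rho> / n) * ennreal ((real n)\<^sup>2 * (bias_const * r ^ (DIM('a) + 2) * M\<^sup>2) / 2) + ennreal (2 * variance_const * R)"
      unfolding q_def by (intro add_right_mono mult_left_mono bias_bound[OF f0 r]) simp
    finally show ?thesis .
  qed
  also have "\<dots> = ennreal (2 * \<rho> / n * ((real n)\<^sup>2 * (bias_const * r ^ (DIM('a) + 2) * M\<^sup>2) / 2) + 2 * variance_const * R)"
    using \<rho>(1) r bias_const_pos variance_const_pos R0 by (subst ennreal_mult[symmetric]) auto
  also have "2 * \<rho> / n * ((real n)\<^sup>2 * (bias_const * r ^ (DIM('a) + 2) * M\<^sup>2) / 2) = bias_const * ((\<rho> * (n * r ^ (DIM('a) + 2))) * M\<^sup>2)"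
    using n by (simp add: power2_eq_square)
  also have "\<dots> = bias_const * R" unfolding \<rho>(2) R(1) ..
  also have "bias_const * R + 2 * variance_const * R = error_const * R" by (simp add: error_const_def algebra_simps)
  finally show ?thesis .
qed

text \<open>A large error requires a bad design or, on a good one, an error above
  \<open>1 / \<delta>\<close> times its expectation bound; Markov's inequality gives the latter
  probability at most \<open>\<delta>\<close>.\<close>

lemma high_probability_bound:
  fixes r \<sigma> \<rho> M :: real
  assumes f0: "f0 \<in> H1_ball X M" and r: "0 < r" "r \<le> s0" and n: "0 < n"
    and \<sigma>: "r \<le> \<sigma>" "\<sigma> \<le> 1" "n * r ^ 4 \<le> \<sigma> ^ (4 - DIM('a))" and d: "DIM('a) \<le> 3"
    and \<rho>: "0 < \<rho>" "\<rho> * (n * r ^ (DIM('a) + 2)) = \<sigma>\<^sup>2"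
    and R: "\<sigma>\<^sup>2 * M\<^sup>2 = R" "1 / (n * \<sigma> ^ DIM('a)) = R" and \<delta>: "0 < \<delta>"
  defines "err \<equiv> \<lambda>\<omega>. in_sample_error n f0 \<omega> (laplacian_smoothing K n r \<rho> \<omega>)"
  shows "1 - \<delta> - card (net_of (r / 8)) * (exp (- (1 / 2 - exp (- 1)) * (n * (2 * a0 * r ^ DIM('a)))) + exp (- (n * (a1 / 3 * r ^ DIM('a)))))
    \<le> measure (regression_sample n P f0) {\<omega> \<in> space (regression_sample n P f0). err \<omega> \<le> error_const / \<delta> * R}"
proof -
  let ?N = "\<Pi>\<^sub>M i\<in>{..<n}. std_normal_distribution" and ?M = "\<Pi>\<^sub>M i\<in>{..<n}. P"
  let ?Q = "\<Pi>\<^sub>M i\<in>{..<n}. P \<Otimes>\<^sub>M (borel :: real measure)" and ?S = "regression_sample n P f0" and ?T = "sample_of n f0"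
  define bad where "bad = card (net_of (r / 8)) * (exp (- (1 / 2 - exp (- 1)) * (n * (2 * a0 * r ^ DIM('a)))) + exp (- (n * (a1 / 3 * r ^ DIM('a)))))"
  have bad0: "0 \<le> bad" by (simp add: bad_def)
  interpret NN: prob_space ?N by (rule prob_space_PiM) (rule prob_space_normal_density, simp)
  interpret PP: prob_space ?M by (rule prob_space_PiM) (rule P)
  have f0m[measurable]: "f0 \<in> borel_measurable P" by (rule measurable_f0[OF f0])
  have [measurable]: "err \<in> borel_measurable ?Q"
    unfolding err_def in_sample_error_def
    using measurable_laplacian_smoothing[OF r(1) less_imp_le[OF \<rho>(1)]]
    by (intro borel_measurable_times borel_measurable_const borel_measurable_sum borel_measurable_power borel_measurable_diff) auto
  have [measurable]: "good n r \<in> sets ?M" by (rule sets_good[OF r])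
  have S: "?S = distr (design_noise n P) ?Q ?T" by (rule regression_sample_eq_distr[OF P f0m])
  interpret S: prob_space ?S
    unfolding regression_sample_def by (rule prob_space_PiM) (rule prob_space_regression_law[OF P f0m])
  have R0: "0 < R"
  proof -
    have "0 < \<sigma>" using r \<sigma> by linarith
    then show ?thesis using n unfolding R(2)[symmetric] by simp
  qed
  define CR where "CR = error_const * R"
  have CR: "0 < CR" using error_const_pos R0 by (simp add: CR_def)
  let ?E = "{\<omega> \<in> space ?S. err \<omega> \<le> error_const / \<delta> * R}"
  let ?B = "{\<omega> \<in> space ?Q. error_const / \<delta> * R < err \<omega>}"
  let ?G = "good n r \<times> space ?N"
  have [measurable]: "?B \<in> sets ?Q" by measurable
  have "emeasure ?S ?B = emeasure (design_noise n P) (?T -` ?B \<inter> space (design_noise n P))"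
    unfolding S by (rule emeasure_distr) measurable
  also have "\<dots> \<le> emeasure (design_noise n P) ((space ?M - good n r) \<times> space ?N \<union>
       {z \<in> ?G. 1 \<le> ennreal (\<delta> / CR) * ennreal (err (?T z))})"
  proof (rule emeasure_mono)
    show "?T -` ?B \<inter> space (design_noise n P) \<subseteq> (space ?M - good n r) \<times> space ?N \<union>
       {z \<in> ?G. 1 \<le> ennreal (\<delta> / CR) * ennreal (err (?T z))}"
    proof
      fix z assume z: "z \<in> ?T -` ?B \<inter> space (design_noise n P)"
      then have "error_const / \<delta> * R < err (?T z)" and zs: "z \<in> space ?M \<times> space ?N"
        by (auto simp: space_pair_measure)
      then have "CR < err (?T z) * \<delta>" using \<delta> by (simp add: CR_def field_simps)
      then have "1 \<le> \<delta> / CR * err (?T z)" using CR by (simp add: field_simps)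
      moreover have "0 \<le> err (?T z)" unfolding err_def in_sample_error_def by (simp add: sum_nonneg)
      ultimately have "1 \<le> ennreal (\<delta> / CR) * ennreal (err (?T z))"
        using CR \<delta> by (simp add: ennreal_mult[symmetric] flip: ennreal_1)
      then show "z \<in> (space ?M - good n r) \<times> space ?N \<union> {z \<in> ?G. 1 \<le> ennreal (\<delta> / CR) * ennreal (err (?T z))}"
        using zs by auto
    qed
  qed measurable
  also have "\<dots> \<le> emeasure (design_noise n P) ((space ?M - good n r) \<times> space ?N)
      + emeasure (design_noise n P) {z \<in> ?G. 1 \<le> ennreal (\<delta> / CR) * ennreal (err (?T z))}"
    by (rule emeasure_subadditive) measurable
  also have "\<dots> \<le> ennreal bad + ennreal \<delta>"
  proof (rule add_mono)
    show "emeasure (design_noise n P) ((space ?M - good n r) \<times> space ?N) \<le> ennreal bad"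
      using emeasure_not_good[OF r, of n]
      by (subst NN.emeasure_pair_measure_Times) (auto simp: NN.emeasure_space_1 bad_def)
    have "emeasure (design_noise n P) {z \<in> ?G. 1 \<le> ennreal (\<delta> / CR) * ennreal (err (?T z))}
       \<le> ennreal (\<delta> / CR) * (\<integral>\<^sup>+z. ennreal (err (?T z)) * indicator ?G z \<partial>design_noise n P)"
      by (rule nn_integral_Markov_inequality) measurable
    also have "\<dots> \<le> ennreal (\<delta> / CR) * ennreal CR"
      unfolding CR_def err_def by (intro mult_left_mono expected_error_bound[OF f0 r n \<sigma> d \<rho> R]) simp
    also have "\<dots> = ennreal \<delta>" using CR \<delta> by (simp add: ennreal_mult[symmetric])
    finally show "emeasure (design_noise n P) {z \<in> ?G. 1 \<le> ennreal (\<delta> / CR) * ennreal (err (?T z))} \<le> ennreal \<delta>" .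
  qed
  also have "\<dots> = ennreal (bad + \<delta>)" using bad0 \<delta> by simp
  finally have "emeasure ?S ?B \<le> ennreal (bad + \<delta>)" .
  then have "measure ?S ?B \<le> bad + \<delta>"
    using bad0 \<delta> by (simp add: S.emeasure_eq_measure del: ennreal_plus)
  moreover have "measure ?S ?E = 1 - measure ?S ?B"
  proof -
    have sp: "space ?S = space ?Q" "sets ?S = sets ?Q" by (simp_all add: S)
    then have "?E = space ?S - ?B" by auto
    moreover have "?B \<in> sets ?S" using \<open>?B \<in> sets ?Q\<close> sp by simp
    ultimately show ?thesis using S.prob_compl[of ?B] by simp
  qed
  ultimately show ?thesis by (simp add: bad_def)
qed

end

text \<open>In the logarithms of \<open>M\<close>, \<open>n\<close> and \<open>r\<close> the
  comparisons become linear for each dimension. The hypotheses fit exactly: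
  \<open>\<sigma> \<le> 1\<close> is the lower bound on \<open>M\<close>,
  \<open>n * r ^ 4 \<le> \<sigma> ^ (4 - d)\<close> is the upper bound on \<open>r\<close>, and
  together with \<open>R \<le> 1\<close>, which is the upper bound on \<open>M\<close>, it gives
  \<open>r \<le> \<sigma>\<close>.\<close>

lemma rate_arithmetic:
  fixes n d :: nat and M r \<rho> \<sigma> R :: real
  assumes d: "d \<in> {1, 2, 3}" and n: "3 \<le> n"
    and M: "real n powr (- 1 / 2) \<le> M" "M \<le> real n powr (1 / d)"
    and r: "(ln n / n) powr (1 / d) \<le> r"
      "r \<le> M powr ((real d - 4) / (4 + 2 * d)) * real n powr (- 3 / (4 + 2 * d))"
    and \<rho>: "\<rho> = M powr (- 4 / (2 + d)) * inverse (n * r ^ (d + 2)) * real n powr (- 2 / (2 + d))"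
  defines "\<sigma> \<equiv> (M\<^sup>2 * n) powr (- 1 / (2 + d))"
    and "R \<equiv> M powr (2 * d / (2 + d)) * real n powr (- 2 / (2 + d))"
  shows "0 < r" "1 / n \<le> r ^ d" "r \<le> \<sigma>" "\<sigma> \<le> 1" "n * r ^ 4 \<le> \<sigma> ^ (4 - d)" "0 < \<rho>"
    "\<rho> * (n * r ^ (d + 2)) = \<sigma>\<^sup>2" "\<sigma>\<^sup>2 * M\<^sup>2 = R" "1 / (n * \<sigma> ^ d) = R"
proof -
  \<comment> \<open>The origin of \<open>N = 3\<close>: from there on \<open>ln n \<ge> 1\<close>,
    so the lower bound on \<open>r\<close> yields \<open>1 / n \<le> r ^ d\<close>.\<close>
  have ln_n: "1 \<le> ln (real n)"
  proof -
    have "exp 1 \<le> real n" using exp_le n by linarith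
    then show ?thesis using n by (subst ln_ge_iff) auto
  qed
  have M_pos: "0 < M" using M(1) n by (intro less_le_trans[OF _ M(1)]) auto
  show r_pos: "0 < r" using ln_n n by (intro less_le_trans[OF _ r(1)]) auto
  define a b l where "a = ln M" and "b = ln (real n)" and "l = ln r"
  have Me: "M = exp a" and ne: "real n = exp b" and re: "r = exp l"
    using M_pos n r_pos by (auto simp: a_def b_def l_def)
  have D: "real d = 1 \<or> real d = 2 \<or> real d = 3" and d0: "0 < real d" using d by auto
  have a1: "- b / 2 \<le> a"
    using M(1) unfolding Me ne by (simp add: powr_def)
  have a2: "a * real d \<le> b"
    using M(2) d0 unfolding Me ne by (simp add: powr_def field_simps)
  have l1: "l \<le> a * (real d - 4) / (4 + 2 * real d) - 3 * b / (4 + 2 * real d)"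
    using r(2) unfolding Me ne re by (simp add: powr_def exp_add[symmetric] mult_ac)
  have \<sigma>e: "\<sigma> = exp (- (2 * a + b) / (2 + real d))"
    unfolding \<sigma>_def Me ne by (simp add: powr_def exp_of_nat_mult[symmetric] power2_eq_square exp_add[symmetric] ln_mult field_simps)
  have pw: "exp x ^ k = exp (real k * x)" for x :: real and k by (simp add: exp_of_nat_mult)
  have "ln n / n \<le> r ^ d"
  proof -
    have "((ln n / n) powr (1 / d)) powr d \<le> r powr d"
      using r(1) by (intro powr_mono2) auto
    then show ?thesis using ln_n n d0 r_pos by (simp add: powr_powr powr_realpow)
  qed
  moreover have "1 / n \<le> ln n / n" using ln_n n by (intro divide_right_mono) auto
  ultimately show "1 / n \<le> r ^ d" by linarith
  show "r \<le> \<sigma>" unfolding re \<sigma>e using l1 a2 D by (auto simp: field_simps)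
  show "\<sigma> \<le> 1" unfolding \<sigma>e using a1 D by (auto simp: field_simps)
  show "n * r ^ 4 \<le> \<sigma> ^ (4 - d)"
    unfolding ne re \<sigma>e pw exp_add[symmetric] using l1 d by (auto simp: field_simps)
  define A where "A = n * r ^ (d + 2)"
  have A: "0 < A" using n r_pos by (simp add: A_def)
  show "0 < \<rho>" unfolding \<rho> A_def[symmetric] using A M_pos n by simp
  have "\<rho> * (n * r ^ (d + 2)) = M powr (- 4 / (2 + d)) * real n powr (- 2 / (2 + d))"
    unfolding \<rho> A_def[symmetric] using A by simp
  also have "\<dots> = \<sigma>\<^sup>2"
    unfolding Me ne \<sigma>e pw using D by (auto simp: powr_def exp_add[symmetric] field_simps)
  finally show "\<rho> * (n * r ^ (d + 2)) = \<sigma>\<^sup>2" .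
  show "\<sigma>\<^sup>2 * M\<^sup>2 = R"
    unfolding R_def Me ne \<sigma>e pw using D by (auto simp: powr_def exp_add[symmetric] field_simps)
  have "1 / (n * \<sigma> ^ d) = exp (- (b + real d * (- (2 * a + b) / (2 + real d))))"
    unfolding ne \<sigma>e pw by (simp only: exp_add[symmetric] exp_minus inverse_eq_divide)
  also have "\<dots> = R"
    unfolding R_def Me ne using D by (auto simp: powr_def exp_add[symmetric] field_simps)
  finally show "1 / (n * \<sigma> ^ d) = R" .
qed

theorem theorem1:
  fixes d :: nat
    and X :: "'a::euclidean_space set"
    and p :: "'a \<Rightarrow> real"
    and p_min p_max L_p :: real
    and K :: "real \<Rightarrow> real"
  assumes "d = DIM('a)" and "d \<in> {1, 2, 3}"
    and "open X" and "connected X" and "lipschitz_boundary X"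
    and "prob_space (design_distribution X p)"
    and "0 < p_min" and "\<And>x. x \<in> X \<Longrightarrow> p_min \<le> p x \<and> p x \<le> p_max"
    and "L_p-lipschitz_on X p"
    and "\<And>t. 0 \<le> t \<Longrightarrow> 0 \<le> K t" and "antimono_on {0..} K"
    and "\<And>t. 1 < t \<Longrightarrow> K t = 0"
    and "\<exists>L_K. L_K-lipschitz_on {0..1} K" and "0 < K 1"
    and "(\<integral>z. K (norm (z::'a)) \<partial>lborel) = 1"
    and "(\<integral>\<^sup>+z. ennreal ((norm (z::'a))\<^sup>2 * K (norm z)) \<partial>lborel) / of_nat d < \<infinity>"
  shows
    "\<exists>(C\<^sub>0::real) (c\<^sub>0::real) (N::nat) (C::real) (C\<^sub>1::real) (c::real) (c\<^sub>1::real).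
       0 < C\<^sub>0 \<and> 0 < c\<^sub>0 \<and> 0 < N \<and> 0 < C \<and> 0 < C\<^sub>1 \<and> 0 < c \<and> 0 < c\<^sub>1 \<and>
       (\<forall>(n::nat) (M::real) (f\<^sub>0::'a \<Rightarrow> real) (\<delta>::real) (r::real) (\<rho>::real).
          N \<le> n \<longrightarrow>
          real n powr (- 1 / 2) \<le> M \<longrightarrow> M \<le> real n powr (1 / d) \<longrightarrow>
          f\<^sub>0 \<in> H1_ball X M \<longrightarrow>
          0 < \<delta> \<longrightarrow> \<delta> < 1 \<longrightarrow>
          C\<^sub>0 * (ln n / n) powr (1 / d) \<le> r \<longrightarrow>
          r \<le> min c\<^sub>0 (M powr ((real d - 4) / (4 + 2 * d)) * real n powr (- 3 / (4 + 2 * d))) \<longrightarrow>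
          \<rho> = M powr (- 4 / (2 + d)) * inverse (n * r ^ (d + 2)) * real n powr (- 2 / (2 + d)) \<longrightarrow>
          measure (regression_sample n (design_distribution X p) f\<^sub>0)
            {\<omega> \<in> space (regression_sample n (design_distribution X p) f\<^sub>0).
               in_sample_error n f\<^sub>0 \<omega> (laplacian_smoothing K n r \<rho> \<omega>)
               \<le> C / \<delta> * M powr (2 * d / (2 + d)) * real n powr (- 2 / (2 + d))}
          \<ge> 1 - \<delta> - C\<^sub>1 * n * exp (- c\<^sub>1 * n * r ^ d) - exp (- c * (M\<^sup>2 * n) powr (d / (2 + d))))"
proof -
  have p_cont: "continuous_on X p" using assms(9) by (rule lipschitz_on_continuous_on)
  obtain \<kappa> s1 :: real where \<kappa>: "0 \<le> \<kappa>" and s1: "0 < s1"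
    and escape: "\<And>z s. z \<in> X \<Longrightarrow> 0 < s \<Longrightarrow> s \<le> s1 \<Longrightarrow>
       \<exists>q0. dist z q0 \<le> \<kappa> * s \<and> (\<forall>x\<in>X \<inter> ball z (2 * s). \<forall>q\<in>ball q0 s. closed_segment x q \<subseteq> X)"
    using lipschitz_boundary_escape[OF assms(5)] by blast
  define s0 where "s0 = min s1 1"
  \<comment> \<open>A probability density that is at least \<open>p_min\<close> on \<open>X\<close>
    leaves room for a volume of at most \<open>1 / p_min\<close>.\<close>
  have finite_X: "emeasure lborel X < \<infinity>"
  proof -
    interpret prob_space "design_distribution X p" by fact
    have "ennreal p_min * emeasure lborel X \<le> emeasure (design_distribution X p) X"
      using assms(3,8) by (intro emeasure_design_ge p_cont) auto
    also have "\<dots> \<le> 1" by (rule emeasure_le_1)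
    finally have "ennreal p_min * emeasure lborel X < top" by (rule le_less_trans) simp
    then show ?thesis using assms(7) by (auto simp: ennreal_mult_less_top)
  qed
  interpret regression_design X \<kappa> s0 p p_min p_max K
  proof (intro regression_design.intro lipschitz_domain.intro regression_design_axioms.intro)
    show "\<exists>q0. dist z q0 \<le> \<kappa> * s \<and> (\<forall>x\<in>X \<inter> ball z (2 * s). \<forall>q\<in>ball q0 s. closed_segment x q \<subseteq> X)"
      if "z \<in> X" "0 < s" "s \<le> s0" for z s
      using that by (intro escape) (auto simp: s0_def)
    show "0 < s0" "s0 \<le> 1" using s1 by (auto simp: s0_def)
    show "p_min \<le> p x" "p x \<le> p_max" if "x \<in> X" for x using assms(8)[OF that] by auto
  qed (fact assms p_cont finite_X \<kappa>)+
  \<comment> \<open>The smaller of the two Chernoff rates.\<close>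
  define c1 where "c1 = min ((1 / 2 - exp (- 1)) * (2 * a0)) (a1 / 3)"
  \<comment> \<open>Each net point has two tails, and there are at most
    \<open>net_const * 8 ^ d / r ^ d\<close> net points, where \<open>1 / r ^ d \<le> n\<close>. The
    summand 1 secures positivity.\<close>
  define C1 where "C1 = 2 * (net_const * 8 ^ d) + 1"
  have "exp (- 1) < (1 / 2 :: real)"
  proof -
    have "1 + 1 + 1 / 2 \<le> exp (1 :: real)" using exp_lower_Taylor_quadratic[of "1 :: real"] by simp
    then show ?thesis by (simp add: exp_minus field_simps)
  qed
  then have c1: "0 < c1" using a0_pos a1_pos by (simp add: c1_def)
  have C1: "0 < C1" using consts_pos(4) by (simp add: C1_def add_nonneg_pos)
  show ?thesis
  proof (intro exI conjI allI impI)
    \<comment> \<open>These goals also fix the witnesses, in order: \<open>C\<^sub>0 = 1\<close>,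
      \<open>c\<^sub>0 = s0\<close>, \<open>N = 3\<close>, \<open>C = error_const\<close>,
      \<open>C\<^sub>1 = C1\<close>, \<open>c = 1\<close>, \<open>c\<^sub>1 = c1\<close>.\<close>
    show "0 < (1 :: real)" "0 < s0" "0 < (3 :: nat)" "0 < error_const" "0 < C1" "0 < (1 :: real)" "0 < c1"
      using s0 error_const_pos C1 c1 by auto
    fix n :: nat and M :: real and f0 :: "'a \<Rightarrow> real" and \<delta> r \<rho> :: real
    assume n: "3 \<le> n" and M: "real n powr (- 1 / 2) \<le> M" "M \<le> real n powr (1 / d)"
      and f0: "f0 \<in> H1_ball X M" and \<delta>: "0 < \<delta>" "\<delta> < 1"
      and r: "1 * (ln n / n) powr (1 / d) \<le> r"
        "r \<le> min s0 (M powr ((real d - 4) / (4 + 2 * d)) * real n powr (- 3 / (4 + 2 * d)))"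
      and \<rho>: "\<rho> = M powr (- 4 / (2 + d)) * inverse (n * r ^ (d + 2)) * real n powr (- 2 / (2 + d))"
    define \<sigma> where "\<sigma> = (M\<^sup>2 * n) powr (- 1 / (2 + d))"
    define R where "R = M powr (2 * d / (2 + d)) * real n powr (- 2 / (2 + d))"
    have r': "(ln n / n) powr (1 / d) \<le> r" "r \<le> M powr ((real d - 4) / (4 + 2 * d)) * real n powr (- 3 / (4 + 2 * d))"
      and rs: "r \<le> s0" using r by auto
    note A = rate_arithmetic[OF assms(2) n M r' \<rho>, folded \<sigma>_def R_def]
    let ?S = "regression_sample n P f0"
    have "1 - \<delta> - card (net_of (r / 8)) * (exp (- (1 / 2 - exp (- 1)) * (n * (2 * a0 * r ^ DIM('a)))) + exp (- (n * (a1 / 3 * r ^ DIM('a)))))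
      \<le> measure ?S {\<omega> \<in> space ?S. in_sample_error n f0 \<omega> (laplacian_smoothing K n r \<rho> \<omega>) \<le> error_const / \<delta> * R}"
      using A n assms(1,2) by (intro high_probability_bound[OF f0 A(1) rs]) (auto intro: \<delta>)
    moreover have "card (net_of (r / 8)) * (exp (- (1 / 2 - exp (- 1)) * (n * (2 * a0 * r ^ DIM('a)))) + exp (- (n * (a1 / 3 * r ^ DIM('a)))))
      \<le> C1 * n * exp (- c1 * n * r ^ d)"
    proof -
      have nr: "0 \<le> n * r ^ d" using A(1) by simp
      have "card (net_of (r / 8)) \<le> 2 ^ DIM('a) * measure lborel X / cone_const / (r / 8) ^ DIM('a)"
        using A(1) rs s0 by (intro net_of(4)) auto
      also have "\<dots> = net_const * 8 ^ d * (1 / r ^ d)"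
        by (simp add: net_const_def assms(1) power_divide)
      also have "\<dots> \<le> net_const * 8 ^ d * n"
      proof (rule mult_left_mono)
        show "1 / r ^ d \<le> n" using A(1,2) n by (simp add: field_simps)
      qed (use consts_pos in auto)
      finally have card: "real (card (net_of (r / 8))) \<le> net_const * 8 ^ d * n" .
      have e1: "exp (- (1 / 2 - exp (- 1)) * (n * (2 * a0 * r ^ DIM('a)))) \<le> exp (- c1 * n * r ^ d)"
      proof -
        have "c1 * (n * r ^ d) \<le> (1 / 2 - exp (- 1)) * (2 * a0) * (n * r ^ d)"
          using nr by (intro mult_right_mono) (auto simp: c1_def)
        then show ?thesis by (simp add: assms(1) algebra_simps)
      qed
      have e2: "exp (- (n * (a1 / 3 * r ^ DIM('a)))) \<le> exp (- c1 * n * r ^ d)"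
      proof -
        have "c1 * (n * r ^ d) \<le> a1 / 3 * (n * r ^ d)"
          using nr by (intro mult_right_mono) (auto simp: c1_def)
        then show ?thesis by (simp add: assms(1) algebra_simps)
      qed
      have "card (net_of (r / 8)) * (exp (- (1 / 2 - exp (- 1)) * (n * (2 * a0 * r ^ DIM('a)))) + exp (- (n * (a1 / 3 * r ^ DIM('a)))))
        \<le> net_const * 8 ^ d * n * (exp (- c1 * n * r ^ d) + exp (- c1 * n * r ^ d))"
        using e1 e2 card consts_pos by (intro mult_mono add_mono) auto
      also have "\<dots> \<le> C1 * n * exp (- c1 * n * r ^ d)"
        by (simp add: C1_def algebra_simps)
      finally show ?thesis .
    qed
    moreover have "0 \<le> exp (- 1 * (M\<^sup>2 * n) powr (d / (2 + d)))" by simp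
    moreover have R: "error_const / \<delta> * M powr (2 * d / (2 + d)) * real n powr (- 2 / (2 + d)) = error_const / \<delta> * R"
      by (simp add: R_def)
    ultimately show "1 - \<delta> - C1 * n * exp (- c1 * n * r ^ d) - exp (- 1 * (M\<^sup>2 * n) powr (d / (2 + d)))
      \<le> measure ?S {\<omega> \<in> space ?S. in_sample_error n f0 \<omega> (laplacian_smoothing K n r \<rho> \<omega>)
               \<le> error_const / \<delta> * M powr (2 * d / (2 + d)) * real n powr (- 2 / (2 + d))}"
      unfolding R by linarith
  qed
qed

end
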